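(* Suppose a finite abelian group $G$ acts on a finite-dimensional algebra $\Lambda$ (in the setting fixed in the context), with $\bar\Lambda$ the associated skew group algebra. Then for any $T_1,T_2\in\mathcal{F}(\Lambda)$, the functor $\phi:\mathcal{F}(\Lambda)\to\mathcal{F}(\bar\Lambda)$ induces the following isomorphisms of vector spaces: $$\mathcal{F}(\bar\Lambda)(\phi(T_1), \phi(T_2))\cong \begin{cases}\bigoplus_{g\in G} \mathcal{F}(\Lambda)({}^gT_1, T_2)&\text{ if } G_{T_1}\neq G;\\ \bigoplus_{g\in G} \mathcal{F}(\Lambda)(T_1, {}^gT_2)&\text{ if }G_{T_2}\neq G;\\ \mathcal{F}(\Lambda)^{|G|}(T_1, T_2)&\text{ if }G_{T_1T_2}= G.\end{cases}$$
   Context: $K$ is an algebraically closed field, $\Lambda=KQ/I$ is a finite-dimensional $K$-algebra with $Q$ a finite quiver, and $\mathrm{mod}\text{-}\Lambda$ is the category of finitely generated right $\Lambda$-modules. $G$ is a finite abelian group of order $n$ acting on $\Lambda$ by $K$-linear automorphisms, the action being induced by an action on $KQ$ permuting the vertices, such that every vertex whose stabilizer is different from $G$ has a $G$-orbit of size $n$. The set $\hat G$ of irreducible representations of $G$ over $K$ is a group under tensor product with $|\hat G|=n$ (so $\mathrm{char}\,K\nmid n$). The skew group algebra $\bar\Lambda=\Lambda G$ is the vector space $\Lambda\otimes_K KG$ with multiplication $(\lambda\otimes g)(\mu\otimes h)=\lambda\, g(\mu)\otimes gh$. The functor $F^\lambda:\mathrm{mod}\text{-}\bar\Lambda\to\mathrm{mod}\text{-}\Lambda$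 is the pushdown functor obtained by viewing $\Lambda$, up to Morita equivalence, as the skew group algebra $\bar\Lambda\hat G$ for the action $\chi(\lambda\otimes g)=\chi(g)\lambda\otimes g$ of $\hat G$ on $\bar\Lambda$; concretely it is restriction of scalars along $\Lambda\to\bar\Lambda$, $\lambda\mapsto\lambda\otimes1$. For $g\in G$ and a right $\Lambda$-module $M$, ${}^gM=M\circ g^{-1}$ is the module with the same underlying space and action $m\cdot\lambda:=m\,g^{-1}(\lambda)$; for a homomorphism $f$, ${}^gf$ is the same underlying linear map. $\mathcal{G}(\Lambda)$ is the category of contravariant $K$-linear functors from $\mathrm{mod}\text{-}\Lambda$ to finite-dimensional $K$-vector spaces, and $\mathcal{F}(\Lambda)$ is its full subcategory of finitely presented functors, i.e. those isomorphic to $\mathrm{Coker}\,\mathrm{Hom}_\Lambda(-,f)$ for some homomorphism $f:M\to N$ in $\mathrm{mod}\text{-}\Lambda$; similarly for $\bar\Lambda$. $\mathcal F(\Lambda)(T_1,T_2)$ is the space of natural transformations. The functor $\phi$ is defined by $\phi(T)=T\circ F^\lambda$, and $\phi(\iota)=\iota_{F^\lambda(-)}$ on morphisms $\iota:T_1\to T_2$; it takes values in $\mathcal{F}(\bar\Lambda)$. $G$ acts on $\mathcal{F}(\Lambda)$ by $({}^gT)(M)=T({}^{g^{-1}}M)$ and $({}^gT)(f)=T({}^{g^{-1}}f)$. $G_T=\{g\in G:{}^gT\cong T\}$ and $G_{T_1T_2}=G_{T_1}\cap G_{T_2}$. $\mathcal{F}(\Lambda)^{|G|}(T_1,T_2)$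 denotes the direct sum of $|G|$ copies of $\mathcal{F}(\Lambda)(T_1,T_2)$. *)

theory Defs
  imports
    "HOL-Algebra.Algebra"
    "Graph_Theory.Arc_Walk"
begin

section \<open>Vector spaces with explicit carriers\<close>

text \<open>
  A vector space over a field \<open>K\<close> is a \<^locale>\<open>module\<close> over \<open>K\<close>.  The record type of modules extends
  that of rings, so it carries a multiplication and a unit; these are meaningful for algebras and
  are ignored for mere vector spaces.  Linear maps are extensional, so that equality of morphisms
  is equality in HOL.
\<close>

definition fin_dim :: "('k, 'p) ring_scheme \<Rightarrow> ('k, 'w, 'q) module_scheme \<Rightarrow> bool" where
  "fin_dim K V \<longleftrightarrow> (\<exists>B. finite B \<and> B \<subseteq> carrier V \<and>
     (\<forall>v\<in>carrier V. \<exists>c\<in>B \<rightarrow> carrier K. v = (\<Oplus>\<^bsub>V\<^esub>b\<in>B. c b \<odot>\<^bsub>V\<^esub> b)))"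

definition linear_maps ::
  "('k, 'p) ring_scheme \<Rightarrow> ('k, 'w, 'q) module_scheme \<Rightarrow> ('k, 'x, 'r) module_scheme \<Rightarrow> ('w \<Rightarrow> 'x) set" where
  "linear_maps K V W = {f \<in> carrier V \<rightarrow>\<^sub>E carrier W.
     (\<forall>x\<in>carrier V. \<forall>y\<in>carrier V. f (x \<oplus>\<^bsub>V\<^esub> y) = f x \<oplus>\<^bsub>W\<^esub> f y) \<and>
     (\<forall>c\<in>carrier K. \<forall>x\<in>carrier V. f (c \<odot>\<^bsub>V\<^esub> x) = c \<odot>\<^bsub>W\<^esub> f x)}"

definition linear_isos ::
  "('k, 'p) ring_scheme \<Rightarrow> ('k, 'w, 'q) module_scheme \<Rightarrow> ('k, 'x, 'r) module_scheme \<Rightarrow> ('w \<Rightarrow> 'x) set" where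
  "linear_isos K V W = {f \<in> linear_maps K V W. bij_betw f (carrier V) (carrier W)}"

definition linear_map_space ::
  "('k, 'p) ring_scheme \<Rightarrow> ('k, 'w) module \<Rightarrow> ('k, 'x) module \<Rightarrow> ('k, 'w \<Rightarrow> 'x) module" where
  "linear_map_space K V W = \<lparr>
     carrier = linear_maps K V W, monoid.mult = undefined, monoid.one = undefined,
     ring.zero = (\<lambda>x\<in>carrier V. \<zero>\<^bsub>W\<^esub>),
     ring.add = (\<lambda>f h. \<lambda>x\<in>carrier V. f x \<oplus>\<^bsub>W\<^esub> h x),
     smult = (\<lambda>c f. \<lambda>x\<in>carrier V. c \<odot>\<^bsub>W\<^esub> f x)\<rparr>"

text \<open>The direct sum of a family indexed by a finite set, realised as the product.\<close>

definition direct_sum :: "'i set \<Rightarrow> ('i \<Rightarrow> ('k, 'w) module) \<Rightarrow> ('k, 'i \<Rightarrow> 'w) module" where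
  "direct_sum J V = \<lparr>
     carrier = (\<Pi>\<^sub>E i\<in>J. carrier (V i)), monoid.mult = undefined, monoid.one = undefined,
     ring.zero = (\<lambda>i\<in>J. \<zero>\<^bsub>V i\<^esub>),
     ring.add = (\<lambda>x y. \<lambda>i\<in>J. x i \<oplus>\<^bsub>V i\<^esub> y i),
     smult = (\<lambda>c x. \<lambda>i\<in>J. c \<odot>\<^bsub>V i\<^esub> x i)\<rparr>"

text \<open>
  The quotient by \<open>W\<close>: the library's \<open>V Quot W\<close> together with the induced scalar multiplication.
  It serves both for the quotient of an algebra by a two-sided ideal and (ignoring the
  multiplicative part) for the quotient of a vector space by a subspace.
\<close>

definition quotient :: "('k, 'w) module \<Rightarrow> 'w set \<Rightarrow> ('k, 'w set) module" (infixl \<open>QuotK\<close> 65) where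
  "V QuotK W = ring.extend (V Quot W)
     (module.fields (\<lambda>c Z. \<Union>x\<in>Z. W +>\<^bsub>V\<^esub> (c \<odot>\<^bsub>V\<^esub> x)))"

section \<open>Path algebras\<close>

text \<open>
  A finite quiver is a \<^locale>\<open>fin_digraph\<close> (loops and multiple arrows allowed).  A path is a triple
  (source, list of arrows, target), so that the path \<open>(v, [], v)\<close> of length 0 exists for every
  vertex \<open>v\<close>.  Paths are composed from left to right.
\<close>

type_synonym ('v, 'e) path = "'v \<times> 'e list \<times> 'v"

definition paths :: "('v, 'e) pre_digraph \<Rightarrow> ('v, 'e) path set" where
  "paths Q = {(u, p, v). pre_digraph.awalk Q u p v}"

definition splittings :: "('v, 'e) pre_digraph \<Rightarrow> ('v, 'e) path \<Rightarrow> (('v, 'e) path \<times> ('v, 'e) path) set" where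
  "splittings Q = (\<lambda>(u, p, w).
     {((u, p1, v), (v, p2, w)) | p1 v p2.
        p = p1 @ p2 \<and> (u, p1, v) \<in> paths Q \<and> (v, p2, w) \<in> paths Q})"

definition path_algebra ::
  "('k, 'p) ring_scheme \<Rightarrow> ('v, 'e) pre_digraph \<Rightarrow> ('k, ('v, 'e) path \<Rightarrow> 'k) module" where
  "path_algebra K Q = \<lparr>
     carrier = {x. (\<forall>p. x p \<in> carrier K) \<and> (\<forall>p. p \<notin> paths Q \<longrightarrow> x p = \<zero>\<^bsub>K\<^esub>) \<and>
                   finite {p. x p \<noteq> \<zero>\<^bsub>K\<^esub>}},
     monoid.mult = (\<lambda>x y p. finsum K (\<lambda>(r, s). x r \<otimes>\<^bsub>K\<^esub> y s) (splittings Q p)),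
     monoid.one = (\<lambda>p. if p \<in> {(v, [], v) | v. v \<in> verts Q} then \<one>\<^bsub>K\<^esub> else \<zero>\<^bsub>K\<^esub>),
     ring.zero = (\<lambda>p. \<zero>\<^bsub>K\<^esub>),
     ring.add = (\<lambda>x y p. x p \<oplus>\<^bsub>K\<^esub> y p),
     smult = (\<lambda>c x p. c \<otimes>\<^bsub>K\<^esub> x p)\<rparr>"

definition vertex_idem :: "('k, 'p) ring_scheme \<Rightarrow> 'v \<Rightarrow> ('v, 'e) path \<Rightarrow> 'k" where
  "vertex_idem K v = (\<lambda>p. if p = (v, [], v) then \<one>\<^bsub>K\<^esub> else \<zero>\<^bsub>K\<^esub>)"

section \<open>The group action and the skew group algebra\<close>

text \<open>
  As \<open>K\<close> is algebraically closed and \<open>G\<close> is abelian, the irreducible representations of \<open>G\<close> are its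
  one-dimensional ones, up to isomorphism the homomorphisms from \<open>G\<close> to the group of units of \<open>K\<close>,
  and their tensor product is the pointwise product.
\<close>

definition dual_group :: "('k, 'p) ring_scheme \<Rightarrow> ('g, 'q) monoid_scheme \<Rightarrow> ('g \<Rightarrow> 'k) set" where
  "dual_group K G = hom G (units_of K) \<inter> extensional (carrier G)"

text \<open>
  The standing assumptions: \<open>\<alpha>\<close> is an action of \<open>G\<close> on the path algebra by \<open>K\<close>-algebra automorphisms
  that permutes the vertices and preserves the ideal \<open>I\<close>.
\<close>

locale skew_setting = K: algebraically_closed K + Q: fin_digraph Q + G: comm_group G +
  I: ideal I "path_algebra K Q" + action: group_action G "carrier (path_algebra K Q)" \<alpha>
  for K :: "'k ring"
    and Q :: "('v, 'e) pre_digraph"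
    and I :: "(('v, 'e) path \<Rightarrow> 'k) set"
    and G :: "'g monoid"
    and \<alpha> :: "'g \<Rightarrow> (('v, 'e) path \<Rightarrow> 'k) \<Rightarrow> (('v, 'e) path \<Rightarrow> 'k)" +
  assumes fin_dim: "fin_dim K (path_algebra K Q QuotK I)"
    and finite_group: "finite (carrier G)"
    and action_ring_hom: "g \<in> carrier G \<Longrightarrow> \<alpha> g \<in> ring_hom (path_algebra K Q) (path_algebra K Q)"
    and action_linear: "g \<in> carrier G \<Longrightarrow> \<alpha> g \<in> linear_maps K (path_algebra K Q) (path_algebra K Q)"
    and action_vertices: "g \<in> carrier G \<Longrightarrow> v \<in> verts Q \<Longrightarrow>
          \<exists>w\<in>verts Q. \<alpha> g (vertex_idem K v) = vertex_idem K w"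
    and action_ideal: "g \<in> carrier G \<Longrightarrow> \<alpha> g ` I \<subseteq> I"
    and vertex_orbits: "v \<in> verts Q \<Longrightarrow> stabilizer G \<alpha> (vertex_idem K v) \<noteq> carrier G \<Longrightarrow>
          card (orbit G \<alpha> (vertex_idem K v)) = order G"
    and card_dual_group: "card (dual_group K G) = order G"

text \<open>The induced action on cosets.\<close>

definition induced_action :: "('g \<Rightarrow> 'b \<Rightarrow> 'b) \<Rightarrow> 'g \<Rightarrow> 'b set \<Rightarrow> 'b set" where
  "induced_action \<alpha> g Z = \<alpha> g ` Z"

text \<open>
  In the skew group algebra of \<open>L\<close> for an action \<open>\<beta>\<close> of \<open>G\<close> on \<open>L\<close>, the tensor \<open>a \<otimes> g\<close> is represented by
  the function on \<open>carrier G\<close> with value \<open>a\<close> at \<open>g\<close> and \<open>0\<close> elsewhere.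
\<close>

definition skew_group_algebra ::
  "('g, 'q) monoid_scheme \<Rightarrow> ('g \<Rightarrow> 'a \<Rightarrow> 'a) \<Rightarrow> ('k, 'a) module \<Rightarrow> ('k, 'g \<Rightarrow> 'a) module" where
  "skew_group_algebra G \<beta> L = \<lparr>
     carrier = carrier G \<rightarrow>\<^sub>E carrier L,
     monoid.mult = (\<lambda>x y. \<lambda>k\<in>carrier G.
        \<Oplus>\<^bsub>L\<^esub>g\<in>carrier G. x g \<otimes>\<^bsub>L\<^esub> \<beta> g (y (inv\<^bsub>G\<^esub> g \<otimes>\<^bsub>G\<^esub> k))),
     monoid.one = (\<lambda>k\<in>carrier G. if k = \<one>\<^bsub>G\<^esub> then \<one>\<^bsub>L\<^esub> else \<zero>\<^bsub>L\<^esub>),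
     ring.zero = (\<lambda>k\<in>carrier G. \<zero>\<^bsub>L\<^esub>),
     ring.add = (\<lambda>x y. \<lambda>k\<in>carrier G. x k \<oplus>\<^bsub>L\<^esub> y k),
     smult = (\<lambda>c x. \<lambda>k\<in>carrier G. c \<odot>\<^bsub>L\<^esub> x k)\<rparr>"

definition skew_embed ::
  "('g, 'q) monoid_scheme \<Rightarrow> ('k, 'a) module \<Rightarrow> 'a \<Rightarrow> 'g \<Rightarrow> 'a" where
  "skew_embed G L a = (\<lambda>k\<in>carrier G. if k = \<one>\<^bsub>G\<^esub> then a else \<zero>\<^bsub>L\<^esub>)"

section \<open>Finitely generated right modules\<close>

text \<open>
  The underlying sets of modules are subsets of a type \<open>'u\<close>.  An algebraically closed field \<open>K\<close> is
  infinite, so nonzero finite-dimensional vector spaces have the cardinality of \<open>K\<close>; hence as soon as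
  \<open>K\<close> injects into \<open>'u\<close>, every finitely generated module over a finite-dimensional \<open>K\<close>-algebra is
  isomorphic to one with underlying set in \<open>'u\<close>.  The multiplicative part of the ring record is
  again ignored.
\<close>

record ('a, 'u) rmodule = "'u ring" +
  ract :: "'u \<Rightarrow> 'a \<Rightarrow> 'u" (infixl \<open>\<diamondop>\<index>\<close> 70)

locale right_module = A: ring A + M: abelian_group M
  for A :: "('a, 'p) ring_scheme" and M :: "('a, 'u) rmodule" +
  assumes ract_closed: "x \<in> carrier M \<Longrightarrow> a \<in> carrier A \<Longrightarrow> x \<diamondop>\<^bsub>M\<^esub> a \<in> carrier M"
    and ract_add_left: "x \<in> carrier M \<Longrightarrow> y \<in> carrier M \<Longrightarrow> a \<in> carrier A \<Longrightarrow>
          (x \<oplus>\<^bsub>M\<^esub> y) \<diamondop>\<^bsub>M\<^esub> a = (x \<diamondop>\<^bsub>M\<^esub> a) \<oplus>\<^bsub>M\<^esub> (y \<diamondop>\<^bsub>M\<^esub> a)"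
    and ract_add_right: "x \<in> carrier M \<Longrightarrow> a \<in> carrier A \<Longrightarrow> b \<in> carrier A \<Longrightarrow>
          x \<diamondop>\<^bsub>M\<^esub> (a \<oplus>\<^bsub>A\<^esub> b) = (x \<diamondop>\<^bsub>M\<^esub> a) \<oplus>\<^bsub>M\<^esub> (x \<diamondop>\<^bsub>M\<^esub> b)"
    and ract_mult: "x \<in> carrier M \<Longrightarrow> a \<in> carrier A \<Longrightarrow> b \<in> carrier A \<Longrightarrow>
          x \<diamondop>\<^bsub>M\<^esub> (a \<otimes>\<^bsub>A\<^esub> b) = (x \<diamondop>\<^bsub>M\<^esub> a) \<diamondop>\<^bsub>M\<^esub> b"
    and ract_one: "x \<in> carrier M \<Longrightarrow> x \<diamondop>\<^bsub>M\<^esub> \<one>\<^bsub>A\<^esub> = x"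

definition fg_modules :: "('a, 'p) ring_scheme \<Rightarrow> ('a, 'u) rmodule set" where
  "fg_modules A = {M. right_module A M \<and>
     (\<exists>S. finite S \<and> S \<subseteq> carrier M \<and>
       (\<forall>x\<in>carrier M. \<exists>c\<in>S \<rightarrow> carrier A. x = (\<Oplus>\<^bsub>M\<^esub>s\<in>S. s \<diamondop>\<^bsub>M\<^esub> c s)))}"

definition module_homs ::
  "('a, 'p) ring_scheme \<Rightarrow> ('a, 'u) rmodule \<Rightarrow> ('a, 'u) rmodule \<Rightarrow> ('u \<Rightarrow> 'u) set" where
  "module_homs A M N = {f \<in> carrier M \<rightarrow>\<^sub>E carrier N.
     (\<forall>x\<in>carrier M. \<forall>y\<in>carrier M. f (x \<oplus>\<^bsub>M\<^esub> y) = f x \<oplus>\<^bsub>N\<^esub> f y) \<and>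
     (\<forall>x\<in>carrier M. \<forall>a\<in>carrier A. f (x \<diamondop>\<^bsub>M\<^esub> a) = f x \<diamondop>\<^bsub>N\<^esub> a)}"

text \<open>A scalar \<open>c\<close> acts on a module over a \<open>K\<close>-algebra \<open>A\<close> as the element \<open>c \<odot> \<one>\<close> of \<open>A\<close>.\<close>

definition hom_space ::
  "('k, 'a) module \<Rightarrow> ('a, 'u) rmodule \<Rightarrow> ('a, 'u) rmodule \<Rightarrow> ('k, 'u \<Rightarrow> 'u) module" where
  "hom_space A M N = \<lparr>
     carrier = module_homs A M N, monoid.mult = undefined, monoid.one = undefined,
     ring.zero = (\<lambda>x\<in>carrier M. \<zero>\<^bsub>N\<^esub>),
     ring.add = (\<lambda>f h. \<lambda>x\<in>carrier M. f x \<oplus>\<^bsub>N\<^esub> h x),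
     smult = (\<lambda>c f. \<lambda>x\<in>carrier M. f x \<diamondop>\<^bsub>N\<^esub> (c \<odot>\<^bsub>A\<^esub> \<one>\<^bsub>A\<^esub>))\<rparr>"

text \<open>Restriction of scalars from the skew group algebra to \<open>L\<close>; it does not change morphisms.\<close>

definition pushdown ::
  "('g, 'q) monoid_scheme \<Rightarrow> ('k, 'a) module \<Rightarrow> ('g \<Rightarrow> 'a, 'u) rmodule \<Rightarrow> ('a, 'u) rmodule" where
  "pushdown G L Z = \<lparr>
     carrier = carrier Z, monoid.mult = monoid.mult Z, monoid.one = monoid.one Z,
     ring.zero = ring.zero Z, ring.add = ring.add Z,
     ract = (\<lambda>x a. x \<diamondop>\<^bsub>Z\<^esub> skew_embed G L a)\<rparr>"

definition twist_module ::
  "('g, 'q) monoid_scheme \<Rightarrow> ('g \<Rightarrow> 'a \<Rightarrow> 'a) \<Rightarrow> 'g \<Rightarrow> ('a, 'u) rmodule \<Rightarrow> ('a, 'u) rmodule" where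
  "twist_module G \<beta> g M = M\<lparr>ract := (\<lambda>x a. x \<diamondop>\<^bsub>M\<^esub> \<beta> (inv\<^bsub>G\<^esub> g) a)\<rparr>"

section \<open>Contravariant functors to finite-dimensional vector spaces\<close>

text \<open>
  The values of functors have underlying sets in a type \<open>'w\<close>, which may differ between functors
  (the cokernel below has values in sets of homomorphisms).
  The map induced by a homomorphism \<open>f\<close> from \<open>M\<close> to \<open>N\<close> is \<open>fmap T M N f\<close>, from \<open>T(N)\<close> to \<open>T(M)\<close>.
  Only its values on homomorphisms matter.
\<close>

record ('a, 'u, 'k, 'w) modfun =
  fobj :: "('a, 'u) rmodule \<Rightarrow> ('k, 'w) module"
  fmap :: "('a, 'u) rmodule \<Rightarrow> ('a, 'u) rmodule \<Rightarrow> ('u \<Rightarrow> 'u) \<Rightarrow> ('w \<Rightarrow> 'w)"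

definition all_functors :: "'k ring \<Rightarrow> ('k, 'a) module \<Rightarrow> ('a, 'u, 'k, 'w) modfun set" where
  "all_functors K A = {T.
     (\<forall>M\<in>fg_modules A. module K (fobj T M) \<and> fin_dim K (fobj T M)) \<and>
     (\<forall>M\<in>fg_modules A. \<forall>N\<in>fg_modules A.
        restrict (fmap T M N) (module_homs A M N)
          \<in> linear_maps K (hom_space A M N) (linear_map_space K (fobj T N) (fobj T M))) \<and>
     (\<forall>M\<in>fg_modules A. fmap T M M (\<lambda>x\<in>carrier M. x) = (\<lambda>x\<in>carrier (fobj T M). x)) \<and>
     (\<forall>L\<in>fg_modules A. \<forall>M\<in>fg_modules A. \<forall>N\<in>fg_modules A.
        \<forall>f\<in>module_homs A L M. \<forall>h\<in>module_homs A M N.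
          fmap T L N (compose (carrier L) h f) =
          compose (carrier (fobj T N)) (fmap T L M f) (fmap T M N h))}"

text \<open>
  Natural transformations are families of linear maps indexed by the finitely generated modules,
  \<open>undefined\<close> at all other values of the type of modules.
\<close>

definition nat_trans ::
  "'k ring \<Rightarrow> ('k, 'a) module \<Rightarrow> ('a, 'u, 'k, 'w) modfun \<Rightarrow> ('a, 'u, 'k, 'x) modfun \<Rightarrow>
    (('a, 'u) rmodule \<Rightarrow> 'w \<Rightarrow> 'x) set" where
  "nat_trans K A T S = {\<iota> \<in> (\<Pi>\<^sub>E M\<in>fg_modules A. linear_maps K (fobj T M) (fobj S M)).
     \<forall>M\<in>fg_modules A. \<forall>N\<in>fg_modules A. \<forall>f\<in>module_homs A M N.
       compose (carrier (fobj T N)) (\<iota> M) (fmap T M N f) =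
       compose (carrier (fobj T N)) (fmap S M N f) (\<iota> N)}"

definition nat_space ::
  "'k ring \<Rightarrow> ('k, 'a) module \<Rightarrow> ('a, 'u, 'k, 'w) modfun \<Rightarrow> ('a, 'u, 'k, 'x) modfun \<Rightarrow>
    ('k, ('a, 'u) rmodule \<Rightarrow> 'w \<Rightarrow> 'x) module" where
  "nat_space K A T S = \<lparr>
     carrier = nat_trans K A T S, monoid.mult = undefined, monoid.one = undefined,
     ring.zero = (\<lambda>M\<in>fg_modules A. \<lambda>x\<in>carrier (fobj T M). \<zero>\<^bsub>fobj S M\<^esub>),
     ring.add = (\<lambda>\<iota> \<kappa>. \<lambda>M\<in>fg_modules A. \<lambda>x\<in>carrier (fobj T M). \<iota> M x \<oplus>\<^bsub>fobj S M\<^esub> \<kappa> M x),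
     smult = (\<lambda>c \<iota>. \<lambda>M\<in>fg_modules A. \<lambda>x\<in>carrier (fobj T M). c \<odot>\<^bsub>fobj S M\<^esub> \<iota> M x)\<rparr>"

definition nat_isos ::
  "'k ring \<Rightarrow> ('k, 'a) module \<Rightarrow> ('a, 'u, 'k, 'w) modfun \<Rightarrow> ('a, 'u, 'k, 'x) modfun \<Rightarrow>
    (('a, 'u) rmodule \<Rightarrow> 'w \<Rightarrow> 'x) set" where
  "nat_isos K A T S = {\<iota> \<in> nat_trans K A T S.
     \<forall>M\<in>fg_modules A. bij_betw (\<iota> M) (carrier (fobj T M)) (carrier (fobj S M))}"

text \<open>The composite of \<open>\<iota>\<close>, which starts at \<open>T\<close>, followed by \<open>\<kappa>\<close>.\<close>

definition nat_comp ::
  "('k, 'a) module \<Rightarrow> ('a, 'u, 'k, 'w) modfun \<Rightarrow> (('a, 'u) rmodule \<Rightarrow> 'x \<Rightarrow> 'y) \<Rightarrow>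
    (('a, 'u) rmodule \<Rightarrow> 'w \<Rightarrow> 'x) \<Rightarrow> (('a, 'u) rmodule \<Rightarrow> 'w \<Rightarrow> 'y)" where
  "nat_comp A T \<kappa> \<iota> = (\<lambda>M\<in>fg_modules A. compose (carrier (fobj T M)) (\<kappa> M) (\<iota> M))"

text \<open>
  The cokernel of \<open>Hom(-, f)\<close> for a homomorphism \<open>f\<close> from \<open>M\<close> to \<open>N\<close>.  Its value at \<open>Z\<close> consists of
  the cosets of the image of \<open>Hom(Z, M)\<close> in \<open>Hom(Z, N)\<close>.
\<close>

definition hom_image ::
  "('k, 'a) module \<Rightarrow> ('a, 'u) rmodule \<Rightarrow> ('u \<Rightarrow> 'u) \<Rightarrow> ('a, 'u) rmodule \<Rightarrow> ('u \<Rightarrow> 'u) set" where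
  "hom_image A M f Z = (\<lambda>h. compose (carrier Z) f h) ` module_homs A Z M"

definition coker_hom ::
  "('k, 'a) module \<Rightarrow> ('a, 'u) rmodule \<Rightarrow> ('a, 'u) rmodule \<Rightarrow> ('u \<Rightarrow> 'u) \<Rightarrow>
    ('a, 'u, 'k, ('u \<Rightarrow> 'u) set) modfun" where
  "coker_hom A M N f = \<lparr>
     fobj = (\<lambda>Z. hom_space A Z N QuotK hom_image A M f Z),
     fmap = (\<lambda>Z Y k. \<lambda>C\<in>carrier (hom_space A Y N QuotK hom_image A M f Y).
        \<Union>h\<in>C. hom_image A M f Z +>\<^bsub>hom_space A Z N\<^esub> compose (carrier Z) h k)\<rparr>"

definition fp_functors :: "'k ring \<Rightarrow> ('k, 'a) module \<Rightarrow> ('a, 'u, 'k, 'w) modfun set" where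
  "fp_functors K A = {T \<in> all_functors K A.
     \<exists>M\<in>fg_modules A. \<exists>N\<in>fg_modules A. \<exists>f\<in>module_homs A M N.
       nat_isos K A T (coker_hom A M N f) \<noteq> {}}"

definition twist_functor ::
  "('g, 'q) monoid_scheme \<Rightarrow> ('g \<Rightarrow> 'a \<Rightarrow> 'a) \<Rightarrow> 'g \<Rightarrow> ('a, 'u, 'k, 'w) modfun \<Rightarrow>
    ('a, 'u, 'k, 'w) modfun" where
  "twist_functor G \<beta> g T = \<lparr>
     fobj = (\<lambda>M. fobj T (twist_module G \<beta> (inv\<^bsub>G\<^esub> g) M)),
     fmap = (\<lambda>M N f. fmap T (twist_module G \<beta> (inv\<^bsub>G\<^esub> g) M) (twist_module G \<beta> (inv\<^bsub>G\<^esub> g) N) f)\<rparr>"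

definition functor_stabilizer ::
  "'k ring \<Rightarrow> ('k, 'a) module \<Rightarrow> 'g monoid \<Rightarrow> ('g \<Rightarrow> 'a \<Rightarrow> 'a) \<Rightarrow> ('a, 'u, 'k, 'w) modfun \<Rightarrow> 'g set" where
  "functor_stabilizer K A G \<beta> T =
     {g \<in> carrier G. nat_isos K A (twist_functor G \<beta> g T) T \<noteq> {}}"

section \<open>The functor given by precomposition with the pushdown functor\<close>

definition phi ::
  "'g monoid \<Rightarrow> ('k, 'a) module \<Rightarrow> ('a, 'u, 'k, 'w) modfun \<Rightarrow> ('g \<Rightarrow> 'a, 'u, 'k, 'w) modfun" where
  "phi G L T = \<lparr>
     fobj = (\<lambda>Z. fobj T (pushdown G L Z)),
     fmap = (\<lambda>Z Y f. fmap T (pushdown G L Z) (pushdown G L Y) f)\<rparr>"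

definition phi_map ::
  "'g monoid \<Rightarrow> ('g \<Rightarrow> 'a \<Rightarrow> 'a) \<Rightarrow> ('k, 'a) module \<Rightarrow> (('a, 'u) rmodule \<Rightarrow> 'w \<Rightarrow> 'x) \<Rightarrow>
    (('g \<Rightarrow> 'a, 'u) rmodule \<Rightarrow> 'w \<Rightarrow> 'x)" where
  "phi_map G \<beta> L \<iota> = (\<lambda>Z\<in>fg_modules (skew_group_algebra G \<beta> L). \<iota> (pushdown G L Z))"

end

theory Submission
  imports Defs
begin

text \<open>
  Restriction of scalars from \<open>LG\<close> to \<open>L\<close> has induction \<open>M \<mapsto> M \<otimes> LG\<close> as a left and as a right adjoint, and
  restricting the induced module gives the direct sum of the twists of \<open>M\<close>.  Precomposing a functor
  with an adjoint pair gives an adjoint pair again, so the natural transformations from \<open>\<phi>(T\<^sub>1)\<close> to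
  \<open>\<phi>(T\<^sub>2)\<close> are those from \<open>T\<^sub>1\<close> to the direct sum of the twists of \<open>T\<^sub>2\<close>, and likewise those
  from the direct sum of the twists of \<open>T\<^sub>1\<close> to \<open>T\<^sub>2\<close>.  Right multiplication by \<open>1 \<otimes> g\<close> is an
  isomorphism from a twist of the restriction of a module to the restriction itself, and provides
  the isomorphisms between \<open>\<phi>(T)\<close> and \<open>\<phi>\<close> of a twist of \<open>T\<close>; in the third case they are composed
  with chosen isomorphisms from the twists of \<open>T\<^sub>1\<close> to \<open>T\<^sub>1\<close>.

  A nonzero module over \<open>\<Lambda>\<close> is infinite because \<open>K\<close> is, so the finite powers of its underlying set
  embed into it; this makes the induced module available in the same type.
\<close>

section \<open>Linear maps and finitely generated modules\<close>

text \<open>For contravariant functors precomposition reverses an adjunction. Induction as a left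
  adjoint of restriction makes precomposition with induction a left adjoint of \<phi>, which puts
  the twists on \<open>T1\<close>; induction as a right adjoint puts them on \<open>T2\<close>. Each
  of these two bijections is written down together with its inverse and rests on one triangle
  identity: \<open>counit_incl\<close> in the first case, \<open>proj_unit\<close> in the second.
  One composite is a Kronecker delta because a projection from the induced module, a group element
  and an inclusion into it compose to the identity or to zero. The other is the identity because
  counit and unit are sums over G of maps through the twists, and a K-linear functor respects such
  sums. The delicate point is that these summands are linear only over L, whereas a natural
  transformation \<kappa> from \<phi>(T1) to \<phi>(T2) commutes only with maps linear over
  \<open>LG\<close>. So the sum has to be assembled before \<kappa> can be moved across it.\<close>

lemma additive_zero:
  assumes "abelian_group M" "abelian_group N" "f \<in> carrier M \<rightarrow> carrier N"
    and "\<And>x y. x \<in> carrier M \<Longrightarrow> y \<in> carrier M \<Longrightarrow> f (x \<oplus>\<^bsub>M\<^esub> y) = f x \<oplus>\<^bsub>N\<^esub> f y"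
  shows "f \<zero>\<^bsub>M\<^esub> = \<zero>\<^bsub>N\<^esub>"
proof -
  interpret M: abelian_group M by fact
  interpret N: abelian_group N by fact
  have "f \<zero>\<^bsub>M\<^esub> \<oplus>\<^bsub>N\<^esub> f \<zero>\<^bsub>M\<^esub> = f \<zero>\<^bsub>M\<^esub>"
    using assms(4)[of "\<zero>\<^bsub>M\<^esub>" "\<zero>\<^bsub>M\<^esub>"] by simp
  moreover have "f \<zero>\<^bsub>M\<^esub> \<in> carrier N"
    using assms(3) by auto
  ultimately show ?thesis
    using N.add.r_cancel_one by blast
qed

text \<open>Stated for bare additive functions, so that one lemma serves linear maps, module
  homomorphisms, ring automorphisms, the action on or by a fixed element, evaluation of a family at
  a coordinate and evaluation of a natural transformation at a point.\<close>

lemma additive_finsum: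
  assumes M: "abelian_group M" and N: "abelian_group N" and f: "f \<in> carrier M \<rightarrow> carrier N"
    and add: "\<And>x y. x \<in> carrier M \<Longrightarrow> y \<in> carrier M \<Longrightarrow> f (x \<oplus>\<^bsub>M\<^esub> y) = f x \<oplus>\<^bsub>N\<^esub> f y"
    and J: "finite J" and h: "\<And>i. i \<in> J \<Longrightarrow> h i \<in> carrier M"
  shows "f (\<Oplus>\<^bsub>M\<^esub>i\<in>J. h i) = (\<Oplus>\<^bsub>N\<^esub>i\<in>J. f (h i))"
proof -
  interpret M: abelian_group M by fact
  interpret N: abelian_group N by fact
  show ?thesis
    using J h
  proof (induction J)
    case empty
    then show ?case
      using additive_zero[OF M N f add] by simp
  next
    case (insert i J)
    then have "h \<in> J \<rightarrow> carrier M" "(\<lambda>i. f (h i)) \<in> J \<rightarrow> carrier N" "h i \<in> carrier M"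
      using f by auto
    with insert f show ?case
      by (simp add: add Pi_iff)
  qed
qed

lemma (in abelian_group) finsum_in:
  "(\<And>i. i \<in> J \<Longrightarrow> h i \<in> carrier G) \<Longrightarrow> (\<Oplus>i\<in>J. h i) \<in> carrier G"
  by (rule finsum_closed) auto

lemma (in abelian_group) finsum_eqI:
  "(\<And>i. i \<in> J \<Longrightarrow> h i = h' i) \<Longrightarrow> (\<And>i. i \<in> J \<Longrightarrow> h i \<in> carrier G) \<Longrightarrow>
    (\<Oplus>i\<in>J. h i) = (\<Oplus>i\<in>J. h' i)"
  by (rule finsum_cong') auto

lemma (in abelian_group) finsum_delta:
  assumes "finite J" "j \<in> J" "y \<in> carrier G"
  shows "(\<Oplus>i\<in>J. if i = j then y else \<zero>) = y"
    and "(\<Oplus>i\<in>J. if j = i then y else \<zero>) = y"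
proof -
  show "(\<Oplus>i\<in>J. if i = j then y else \<zero>) = y"
    using finsum_singleton[of j J "\<lambda>_. y"] assms by (simp add: eq_commute[of j])
  then show "(\<Oplus>i\<in>J. if j = i then y else \<zero>) = y"
    by (simp add: eq_commute[of j])
qed

lemma (in abelian_group) finsum_swap:
  assumes "finite I" "finite J" "\<And>i j. i \<in> I \<Longrightarrow> j \<in> J \<Longrightarrow> h i j \<in> carrier G"
  shows "(\<Oplus>i\<in>I. \<Oplus>j\<in>J. h i j) = (\<Oplus>j\<in>J. \<Oplus>i\<in>I. h i j)"
  using assms(1,3)
proof (induction I)
  case empty
  then show ?case by simp
next
  case (insert k I)
  have "(\<Oplus>i\<in>insert k I. \<Oplus>j\<in>J. h i j) = (\<Oplus>j\<in>J. h k j) \<oplus> (\<Oplus>i\<in>I. \<Oplus>j\<in>J. h i j)"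
    using insert by (subst finsum_insert) (auto intro!: finsum_in)
  also have "\<dots> = (\<Oplus>j\<in>J. h k j \<oplus> (\<Oplus>i\<in>I. h i j))"
    using insert by (subst finsum_addf) (auto intro!: finsum_in)
  also have "\<dots> = (\<Oplus>j\<in>J. \<Oplus>i\<in>insert k I. h i j)"
  proof (rule finsum_eqI)
    fix j assume "j \<in> J"
    then show "h k j \<oplus> (\<Oplus>i\<in>I. h i j) = (\<Oplus>i\<in>insert k I. h i j)"
      using insert by (subst finsum_insert) auto
    show "h k j \<oplus> (\<Oplus>i\<in>I. h i j) \<in> carrier G"
      using insert \<open>j \<in> J\<close> by (auto intro!: finsum_in)
  qed
  finally show ?case .
qed

lemma linear_mapsD:
  assumes "f \<in> linear_maps K V W"
  shows "x \<in> carrier V \<Longrightarrow> f x \<in> carrier W"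
    and "x \<in> carrier V \<Longrightarrow> y \<in> carrier V \<Longrightarrow> f (x \<oplus>\<^bsub>V\<^esub> y) = f x \<oplus>\<^bsub>W\<^esub> f y"
    and "c \<in> carrier K \<Longrightarrow> x \<in> carrier V \<Longrightarrow> f (c \<odot>\<^bsub>V\<^esub> x) = c \<odot>\<^bsub>W\<^esub> f x"
    and "f \<in> extensional (carrier V)"
  using assms by (auto simp: linear_maps_def PiE_def)

lemma linear_maps_finsum:
  assumes "module K V" "module K W" "f \<in> linear_maps K V W" "finite J"
    and "\<And>i. i \<in> J \<Longrightarrow> h i \<in> carrier V"
  shows "f (\<Oplus>\<^bsub>V\<^esub>i\<in>J. h i) = (\<Oplus>\<^bsub>W\<^esub>i\<in>J. f (h i))"
  using assms by (intro additive_finsum) (auto simp: module_def linear_mapsD)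

text \<open>The maps \<open>\<Phi> g\<close> are the components of the inverse of the sum of the maps \<open>\<Psi> g\<close>.\<close>

lemma direct_sum_linear_iso:
  assumes V: "\<And>g. g \<in> J \<Longrightarrow> module K (V g)" and W: "module K W" and J: "finite J"
    and \<Psi>: "\<And>g v. g \<in> J \<Longrightarrow> v \<in> carrier (V g) \<Longrightarrow> \<Psi> g v \<in> carrier W"
    and \<Psi>_add: "\<And>g v v'. g \<in> J \<Longrightarrow> v \<in> carrier (V g) \<Longrightarrow> v' \<in> carrier (V g) \<Longrightarrow>
        \<Psi> g (v \<oplus>\<^bsub>V g\<^esub> v') = \<Psi> g v \<oplus>\<^bsub>W\<^esub> \<Psi> g v'"
    and \<Psi>_smult: "\<And>g c v. g \<in> J \<Longrightarrow> c \<in> carrier K \<Longrightarrow> v \<in> carrier (V g) \<Longrightarrow>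
        \<Psi> g (c \<odot>\<^bsub>V g\<^esub> v) = c \<odot>\<^bsub>W\<^esub> \<Psi> g v"
    and \<Phi>: "\<And>g w. g \<in> J \<Longrightarrow> w \<in> carrier W \<Longrightarrow> \<Phi> g w \<in> carrier (V g)"
    and \<Phi>_add: "\<And>g w w'. g \<in> J \<Longrightarrow> w \<in> carrier W \<Longrightarrow> w' \<in> carrier W \<Longrightarrow>
        \<Phi> g (w \<oplus>\<^bsub>W\<^esub> w') = \<Phi> g w \<oplus>\<^bsub>V g\<^esub> \<Phi> g w'"
    and \<Phi>\<Psi>: "\<And>g h v. g \<in> J \<Longrightarrow> h \<in> J \<Longrightarrow> v \<in> carrier (V h) \<Longrightarrow>
        \<Phi> g (\<Psi> h v) = (if h = g then v else \<zero>\<^bsub>V g\<^esub>)"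
    and \<Psi>\<Phi>: "\<And>w. w \<in> carrier W \<Longrightarrow> (\<Oplus>\<^bsub>W\<^esub>g\<in>J. \<Psi> g (\<Phi> g w)) = w"
  shows "(\<lambda>\<iota>\<in>carrier (direct_sum J V). \<Oplus>\<^bsub>W\<^esub>g\<in>J. \<Psi> g (\<iota> g)) \<in> linear_isos K (direct_sum J V) W"
proof -
  interpret W: module K W by fact
  define F where "F = (\<lambda>\<iota>. \<Oplus>\<^bsub>W\<^esub>g\<in>J. \<Psi> g (\<iota> g))"
  let ?D = "direct_sum J V"
  have D: "\<iota> g \<in> carrier (V g)" if "\<iota> \<in> carrier ?D" "g \<in> J" for \<iota> g
    using that by (auto simp: direct_sum_def)
  have closed: "F \<iota> \<in> carrier W" if "\<iota> \<in> carrier ?D" for \<iota>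
    unfolding F_def using that by (auto intro!: W.finsum_in simp: \<Psi> D)
  \<comment> \<open>Additivity moves \<Phi> g into the sum, where only the term with index g
    survives.\<close>
  have inverse: "\<Phi> g (F \<iota>) = \<iota> g" if \<iota>: "\<iota> \<in> carrier ?D" and g: "g \<in> J" for \<iota> g
  proof -
    interpret V: module K "V g" using V g .
    have "\<Phi> g (F \<iota>) = (\<Oplus>\<^bsub>V g\<^esub>h\<in>J. \<Phi> g (\<Psi> h (\<iota> h)))"
      unfolding F_def using \<iota> g
      by (intro additive_finsum) (auto simp: J W.abelian_group_axioms V.abelian_group_axioms \<Phi> \<Phi>_add \<Psi> D)
    also have "\<dots> = (\<Oplus>\<^bsub>V g\<^esub>h\<in>J. if h = g then \<iota> g else \<zero>\<^bsub>V g\<^esub>)"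
      using \<iota> g by (intro V.finsum_eqI) (auto simp: \<Phi>\<Psi> D)
    also have "\<dots> = \<iota> g"
      using J \<iota> g by (simp add: V.finsum_delta D)
    finally show ?thesis .
  qed
  have add: "F (\<iota> \<oplus>\<^bsub>?D\<^esub> \<iota>') = F \<iota> \<oplus>\<^bsub>W\<^esub> F \<iota>'" if "\<iota> \<in> carrier ?D" "\<iota>' \<in> carrier ?D" for \<iota> \<iota>'
  proof -
    have "F (\<iota> \<oplus>\<^bsub>?D\<^esub> \<iota>') = (\<Oplus>\<^bsub>W\<^esub>g\<in>J. \<Psi> g (\<iota> g) \<oplus>\<^bsub>W\<^esub> \<Psi> g (\<iota>' g))"
      unfolding F_def using that D
      by (intro W.finsum_eqI[symmetric]) (auto simp: direct_sum_def \<Psi>_add \<Psi>)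
    also have "\<dots> = F \<iota> \<oplus>\<^bsub>W\<^esub> F \<iota>'"
      unfolding F_def using that D by (intro W.finsum_addf) (auto simp: \<Psi>)
    finally show ?thesis .
  qed
  have smult: "F (c \<odot>\<^bsub>?D\<^esub> \<iota>) = c \<odot>\<^bsub>W\<^esub> F \<iota>" if "c \<in> carrier K" "\<iota> \<in> carrier ?D" for c \<iota>
  proof -
    have "F (c \<odot>\<^bsub>?D\<^esub> \<iota>) = (\<Oplus>\<^bsub>W\<^esub>g\<in>J. c \<odot>\<^bsub>W\<^esub> \<Psi> g (\<iota> g))"
      unfolding F_def using that D
      by (intro W.finsum_eqI[symmetric]) (auto simp: direct_sum_def \<Psi>_smult \<Psi>)
    also have "\<dots> = c \<odot>\<^bsub>W\<^esub> F \<iota>"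
      unfolding F_def using that D J by (intro W.finsum_smult_ldistr[symmetric]) (auto simp: \<Psi>)
    finally show ?thesis .
  qed
  have closed_add: "\<iota> \<oplus>\<^bsub>?D\<^esub> \<iota>' \<in> carrier ?D" if "\<iota> \<in> carrier ?D" "\<iota>' \<in> carrier ?D" for \<iota> \<iota>'
    using that V[THEN module.axioms(2), THEN abelian_group.axioms(1), THEN abelian_monoid.a_closed]
    by (auto simp: direct_sum_def PiE_iff)
  have closed_smult: "c \<odot>\<^bsub>?D\<^esub> \<iota> \<in> carrier ?D" if "c \<in> carrier K" "\<iota> \<in> carrier ?D" for c \<iota>
    using that V[THEN module.smult_closed] by (auto simp: direct_sum_def)
  have "bij_betw (restrict F (carrier ?D)) (carrier ?D) (carrier W)"
  proof (rule bij_betw_byWitness)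
    show "\<forall>\<iota>\<in>carrier ?D. (\<lambda>w. \<lambda>g\<in>J. \<Phi> g w) (restrict F (carrier ?D) \<iota>) = \<iota>"
      using inverse by (auto simp: direct_sum_def PiE_iff intro!: extensionalityI[where A = J])
    have "(\<lambda>g\<in>J. \<Phi> g w) \<in> carrier ?D \<and> F (\<lambda>g\<in>J. \<Phi> g w) = w" if "w \<in> carrier W" for w
    proof -
      have "F (\<lambda>g\<in>J. \<Phi> g w) = (\<Oplus>\<^bsub>W\<^esub>g\<in>J. \<Psi> g (\<Phi> g w))"
        unfolding F_def using that by (intro W.finsum_eqI) (auto simp: \<Psi> \<Phi>)
      then show ?thesis
        using that \<Psi>\<Phi> by (auto simp: direct_sum_def \<Phi>)
    qed
    then show "\<forall>w\<in>carrier W. restrict F (carrier ?D) (\<lambda>g\<in>J. \<Phi> g w) = w"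
      "(\<lambda>w. \<lambda>g\<in>J. \<Phi> g w) ` carrier W \<subseteq> carrier ?D"
      by (auto simp: restrict_apply)
    show "restrict F (carrier ?D) ` carrier ?D \<subseteq> carrier W"
      using closed by auto
  qed
  then show ?thesis
    unfolding linear_isos_def linear_maps_def F_def[symmetric]
    using closed add smult closed_add closed_smult by auto
qed

section \<open>Right modules and generation tested by submodules\<close>

lemma (in right_module) ract_zero [simp]: "a \<in> carrier A \<Longrightarrow> \<zero>\<^bsub>M\<^esub> \<diamondop>\<^bsub>M\<^esub> a = \<zero>\<^bsub>M\<^esub>"
  by (rule additive_zero[where f = "\<lambda>x. x \<diamondop>\<^bsub>M\<^esub> a"])
    (auto simp: M.abelian_group_axioms ract_closed ract_add_left)

lemma (in right_module) ract_zero_right [simp]: "x \<in> carrier M \<Longrightarrow> x \<diamondop>\<^bsub>M\<^esub> \<zero>\<^bsub>A\<^esub> = \<zero>\<^bsub>M\<^esub>"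
  by (rule additive_zero[where f = "\<lambda>a. x \<diamondop>\<^bsub>M\<^esub> a", OF A.abelian_group_axioms])
    (auto simp: M.abelian_group_axioms ract_closed ract_add_right)

lemma (in right_module) finsum_ract:
  assumes "finite J" "\<And>i. i \<in> J \<Longrightarrow> h i \<in> carrier M" "a \<in> carrier A"
  shows "(\<Oplus>\<^bsub>M\<^esub>i\<in>J. h i) \<diamondop>\<^bsub>M\<^esub> a = (\<Oplus>\<^bsub>M\<^esub>i\<in>J. h i \<diamondop>\<^bsub>M\<^esub> a)"
  using assms
  by (intro additive_finsum[where f = "\<lambda>x. x \<diamondop>\<^bsub>M\<^esub> a"])
    (auto simp: M.abelian_group_axioms ract_closed ract_add_left)

lemma (in right_module) ract_finsum:
  assumes "finite J" "\<And>i. i \<in> J \<Longrightarrow> h i \<in> carrier A" "x \<in> carrier M"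
  shows "x \<diamondop>\<^bsub>M\<^esub> (\<Oplus>\<^bsub>A\<^esub>i\<in>J. h i) = (\<Oplus>\<^bsub>M\<^esub>i\<in>J. x \<diamondop>\<^bsub>M\<^esub> h i)"
  using assms
  by (intro additive_finsum[where f = "\<lambda>a. x \<diamondop>\<^bsub>M\<^esub> a", OF A.abelian_group_axioms])
    (auto simp: M.abelian_group_axioms ract_closed ract_add_right)

definition rsubmodule :: "('a, 'p) ring_scheme \<Rightarrow> ('a, 'u) rmodule \<Rightarrow> 'u set \<Rightarrow> bool" where
  "rsubmodule A M N \<longleftrightarrow> \<zero>\<^bsub>M\<^esub> \<in> N \<and> (\<forall>x\<in>N. \<forall>y\<in>N. x \<oplus>\<^bsub>M\<^esub> y \<in> N) \<and>
     (\<forall>x\<in>N. \<forall>a\<in>carrier A. x \<diamondop>\<^bsub>M\<^esub> a \<in> N)"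

lemma (in right_module) finsum_in_submodule:
  assumes "rsubmodule A M N" "N \<subseteq> carrier M" "finite J" "\<And>i. i \<in> J \<Longrightarrow> h i \<in> N"
  shows "(\<Oplus>\<^bsub>M\<^esub>i\<in>J. h i) \<in> N"
  using assms(3,4)
proof (induction J)
  case empty
  then show ?case
    using assms(1) by (simp add: rsubmodule_def)
next
  case (insert i J)
  with assms(2) have "h \<in> J \<rightarrow> carrier M" "h i \<in> carrier M"
    by auto
  with insert assms(1) show ?case
    by (simp add: rsubmodule_def)
qed

lemma (in right_module) span_submodule:
  assumes S: "finite S" "S \<subseteq> carrier M"
  shows "rsubmodule A M {x. \<exists>c\<in>S \<rightarrow> carrier A. x = (\<Oplus>\<^bsub>M\<^esub>s\<in>S. s \<diamondop>\<^bsub>M\<^esub> c s)}" (is "rsubmodule _ _ ?N")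
  unfolding rsubmodule_def
proof (intro conjI ballI)
  have "(\<Oplus>\<^bsub>M\<^esub>s\<in>S. s \<diamondop>\<^bsub>M\<^esub> \<zero>\<^bsub>A\<^esub>) = (\<Oplus>\<^bsub>M\<^esub>s\<in>S. \<zero>\<^bsub>M\<^esub>)"
    using S by (intro M.finsum_eqI) auto
  then have "\<zero>\<^bsub>M\<^esub> = (\<Oplus>\<^bsub>M\<^esub>s\<in>S. s \<diamondop>\<^bsub>M\<^esub> \<zero>\<^bsub>A\<^esub>)"
    by simp
  then show "\<zero>\<^bsub>M\<^esub> \<in> ?N"
    by (auto intro!: bexI[where x = "\<lambda>_. \<zero>\<^bsub>A\<^esub>"])
next
  have sc: "s \<diamondop>\<^bsub>M\<^esub> a \<in> carrier M" if "s \<in> S" "a \<in> carrier A" for s a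
    using that S ract_closed by auto
  fix x y
  assume "x \<in> ?N"
    "y \<in> ?N"
  then obtain c d where c: "c \<in> S \<rightarrow> carrier A" "x = (\<Oplus>\<^bsub>M\<^esub>s\<in>S. s \<diamondop>\<^bsub>M\<^esub> c s)"
    and d: "d \<in> S \<rightarrow> carrier A" "y = (\<Oplus>\<^bsub>M\<^esub>s\<in>S. s \<diamondop>\<^bsub>M\<^esub> d s)"
    by auto
  have "x \<oplus>\<^bsub>M\<^esub> y = (\<Oplus>\<^bsub>M\<^esub>s\<in>S. s \<diamondop>\<^bsub>M\<^esub> c s \<oplus>\<^bsub>M\<^esub> s \<diamondop>\<^bsub>M\<^esub> d s)"
    unfolding c(2) d(2) using c(1) d(1) sc by (intro M.finsum_addf[symmetric]) auto
  also have "\<dots> = (\<Oplus>\<^bsub>M\<^esub>s\<in>S. s \<diamondop>\<^bsub>M\<^esub> (c s \<oplus>\<^bsub>A\<^esub> d s))"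
    using c(1) d(1) sc S by (intro M.finsum_eqI) (auto simp: ract_add_right subset_iff Pi_iff)
  finally show "x \<oplus>\<^bsub>M\<^esub> y \<in> ?N"
    using c(1) d(1) by (auto intro!: bexI[where x = "\<lambda>s. c s \<oplus>\<^bsub>A\<^esub> d s"])
next
  have sc: "s \<diamondop>\<^bsub>M\<^esub> a \<in> carrier M" if "s \<in> S" "a \<in> carrier A" for s a
    using that S ract_closed by auto
  fix x a
  assume "x \<in> ?N" and a: "a \<in> carrier A"
  then obtain c where c: "c \<in> S \<rightarrow> carrier A" "x = (\<Oplus>\<^bsub>M\<^esub>s\<in>S. s \<diamondop>\<^bsub>M\<^esub> c s)"
    by auto
  have "x \<diamondop>\<^bsub>M\<^esub> a = (\<Oplus>\<^bsub>M\<^esub>s\<in>S. (s \<diamondop>\<^bsub>M\<^esub> c s) \<diamondop>\<^bsub>M\<^esub> a)"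
    unfolding c(2) using c(1) sc S a by (intro finsum_ract) auto
  also have "\<dots> = (\<Oplus>\<^bsub>M\<^esub>s\<in>S. s \<diamondop>\<^bsub>M\<^esub> (c s \<otimes>\<^bsub>A\<^esub> a))"
    using c(1) sc S a by (intro M.finsum_eqI) (auto simp: ract_mult subset_iff Pi_iff ract_closed)
  finally show "x \<diamondop>\<^bsub>M\<^esub> a \<in> ?N"
    using c(1) a by (auto intro!: bexI[where x = "\<lambda>s. c s \<otimes>\<^bsub>A\<^esub> a"])
qed

lemma (in right_module) in_span:
  assumes "finite S" "S \<subseteq> carrier M" "s \<in> S"
  shows "\<exists>c\<in>S \<rightarrow> carrier A. s = (\<Oplus>\<^bsub>M\<^esub>t\<in>S. t \<diamondop>\<^bsub>M\<^esub> c t)"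
proof
  have "(\<Oplus>\<^bsub>M\<^esub>t\<in>S. t \<diamondop>\<^bsub>M\<^esub> (if t = s then \<one>\<^bsub>A\<^esub> else \<zero>\<^bsub>A\<^esub>)) =
      (\<Oplus>\<^bsub>M\<^esub>t\<in>S. if t = s then s else \<zero>\<^bsub>M\<^esub>)"
    using assms by (intro M.finsum_eqI) (auto simp: ract_one subset_iff)
  then show "s = (\<Oplus>\<^bsub>M\<^esub>t\<in>S. t \<diamondop>\<^bsub>M\<^esub> (if t = s then \<one>\<^bsub>A\<^esub> else \<zero>\<^bsub>A\<^esub>))"
    using assms by (simp add: M.finsum_delta subset_iff)
qed auto

text \<open>Generation is restated without coefficients: no proper submodule contains S. The linear
  combinations of S form a submodule containing S, and every submodule containing S contains them.
  In this form finite generation is transferred between rings by pulling submodules back, with no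
  computation of coefficients.\<close>

lemma fg_modules_iff:
  "M \<in> fg_modules A \<longleftrightarrow> right_module A M \<and>
     (\<exists>S. finite S \<and> S \<subseteq> carrier M \<and>
       (\<forall>N. rsubmodule A M N \<longrightarrow> S \<subseteq> N \<longrightarrow> N \<subseteq> carrier M \<longrightarrow> N = carrier M))" (is "_ \<longleftrightarrow> ?R")
proof
  assume "M \<in> fg_modules A"
  then obtain S where M: "right_module A M" and S: "finite S" "S \<subseteq> carrier M"
    and span: "\<forall>x\<in>carrier M. \<exists>c\<in>S \<rightarrow> carrier A. x = (\<Oplus>\<^bsub>M\<^esub>s\<in>S. s \<diamondop>\<^bsub>M\<^esub> c s)"
    by (auto simp: fg_modules_def)
  interpret right_module A M by fact
  have "N = carrier M" if N: "rsubmodule A M N" "S \<subseteq> N" "N \<subseteq> carrier M" for N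
  proof
    show "carrier M \<subseteq> N"
    proof
      fix x assume "x \<in> carrier M"
      then obtain c where "c \<in> S \<rightarrow> carrier A" and x: "x = (\<Oplus>\<^bsub>M\<^esub>s\<in>S. s \<diamondop>\<^bsub>M\<^esub> c s)"
        using span by auto
      then have "s \<diamondop>\<^bsub>M\<^esub> c s \<in> N" if "s \<in> S" for s
        using N(1,2) that by (auto simp: rsubmodule_def subset_iff Pi_iff)
      then show "x \<in> N"
        unfolding x by (intro finsum_in_submodule[OF N(1,3) S(1)])
    qed
  qed fact
  then show ?R
    using M S by blast
next
  assume ?R
  then obtain S where M: "right_module A M" and S: "finite S" "S \<subseteq> carrier M"
    and gen: "\<And>N. rsubmodule A M N \<Longrightarrow> S \<subseteq> N \<Longrightarrow> N \<subseteq> carrier M \<Longrightarrow> N = carrier M"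
    by blast
  interpret right_module A M by fact
  have "{x. \<exists>c\<in>S \<rightarrow> carrier A. x = (\<Oplus>\<^bsub>M\<^esub>s\<in>S. s \<diamondop>\<^bsub>M\<^esub> c s)} = carrier M"
  proof (rule gen)
    show "S \<subseteq> {x. \<exists>c\<in>S \<rightarrow> carrier A. x = (\<Oplus>\<^bsub>M\<^esub>s\<in>S. s \<diamondop>\<^bsub>M\<^esub> c s)}"
      using in_span[OF S] by blast
    show "{x. \<exists>c\<in>S \<rightarrow> carrier A. x = (\<Oplus>\<^bsub>M\<^esub>s\<in>S. s \<diamondop>\<^bsub>M\<^esub> c s)} \<subseteq> carrier M"
      using S by (auto intro!: M.finsum_in ract_closed)
  qed (rule span_submodule[OF S])
  then show "M \<in> fg_modules A"
    using M S unfolding fg_modules_def by blast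
qed

section \<open>The skew group algebra\<close>

text \<open>Isolates what the algebra below takes from the setting: a ring with a finite group
  acting by ring homomorphisms. Paths reappear only in the last section, where the quotient of the
  path algebra is shown to be an instance.\<close>

locale skew_action = L: ring L + G: group G
  for L :: "('k, 'a) module" and G :: "'g monoid" (structure) and \<beta> :: "'g \<Rightarrow> 'a \<Rightarrow> 'a" +
  assumes finite_G [simp]: "finite (carrier G)"
    and \<beta>_hom: "g \<in> carrier G \<Longrightarrow> \<beta> g \<in> ring_hom L L"
    and \<beta>_mult: "g \<in> carrier G \<Longrightarrow> h \<in> carrier G \<Longrightarrow> a \<in> carrier L \<Longrightarrow> \<beta> (g \<otimes> h) a = \<beta> g (\<beta> h a)"
    and \<beta>_one [simp]: "a \<in> carrier L \<Longrightarrow> \<beta> \<one> a = a"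
begin

lemma \<beta>_closed [simp]: "g \<in> carrier G \<Longrightarrow> a \<in> carrier L \<Longrightarrow> \<beta> g a \<in> carrier L"
  using \<beta>_hom by (auto simp: ring_hom_def)

lemma \<beta>_add: "g \<in> carrier G \<Longrightarrow> a \<in> carrier L \<Longrightarrow> b \<in> carrier L \<Longrightarrow> \<beta> g (a \<oplus>\<^bsub>L\<^esub> b) = \<beta> g a \<oplus>\<^bsub>L\<^esub> \<beta> g b"
  and \<beta>_times: "g \<in> carrier G \<Longrightarrow> a \<in> carrier L \<Longrightarrow> b \<in> carrier L \<Longrightarrow> \<beta> g (a \<otimes>\<^bsub>L\<^esub> b) = \<beta> g a \<otimes>\<^bsub>L\<^esub> \<beta> g b"
  and \<beta>_unit [simp]: "g \<in> carrier G \<Longrightarrow> \<beta> g \<one>\<^bsub>L\<^esub> = \<one>\<^bsub>L\<^esub>"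
  using \<beta>_hom by (auto simp: ring_hom_def)

lemma \<beta>_zero [simp]: "g \<in> carrier G \<Longrightarrow> \<beta> g \<zero>\<^bsub>L\<^esub> = \<zero>\<^bsub>L\<^esub>"
  by (rule additive_zero[OF L.abelian_group_axioms L.abelian_group_axioms]) (auto simp: \<beta>_add)

lemma \<beta>_finsum:
  assumes "g \<in> carrier G" "finite J" "\<And>i. i \<in> J \<Longrightarrow> h i \<in> carrier L"
  shows "\<beta> g (\<Oplus>\<^bsub>L\<^esub>i\<in>J. h i) = (\<Oplus>\<^bsub>L\<^esub>i\<in>J. \<beta> g (h i))"
  using assms
  by (intro additive_finsum[OF L.abelian_group_axioms L.abelian_group_axioms]) (auto simp: \<beta>_add)

lemma \<beta>_inv [simp]:
  "g \<in> carrier G \<Longrightarrow> a \<in> carrier L \<Longrightarrow> \<beta> (inv g) (\<beta> g a) = a"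
  "g \<in> carrier G \<Longrightarrow> a \<in> carrier L \<Longrightarrow> \<beta> g (\<beta> (inv g) a) = a"
  by (simp_all flip: \<beta>_mult)

lemma inv_mult_cancel [simp]:
  "g \<in> carrier G \<Longrightarrow> k \<in> carrier G \<Longrightarrow> inv g \<otimes> (g \<otimes> k) = k"
  "g \<in> carrier G \<Longrightarrow> k \<in> carrier G \<Longrightarrow> g \<otimes> (inv g \<otimes> k) = k"
  by (simp_all flip: G.m_assoc)

lemma finsum_shift:
  assumes "abelian_group N" "a \<in> carrier G" "\<And>g. g \<in> carrier G \<Longrightarrow> h g \<in> carrier N"
  shows "(\<Oplus>\<^bsub>N\<^esub>g\<in>carrier G. h (a \<otimes> g)) = (\<Oplus>\<^bsub>N\<^esub>g\<in>carrier G. h g)"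
proof -
  interpret N: abelian_group N by fact
  have "k \<in> (\<lambda>g. a \<otimes> g) ` carrier G" if "k \<in> carrier G" for k
    using assms(2) that by (intro image_eqI[where x = "inv a \<otimes> k"]) auto
  then have "(\<lambda>g. a \<otimes> g) ` carrier G = carrier G"
    using assms(2) by auto
  moreover have "inj_on (\<lambda>g. a \<otimes> g) (carrier G)"
    using assms(2) by (auto intro!: inj_onI)
  ultimately show ?thesis
    using N.finsum_reindex[of h "\<lambda>g. a \<otimes> g" "carrier G"] assms(3) by auto
qed

lemma finsum_inverse:
  assumes "abelian_group N" "\<And>g. g \<in> carrier G \<Longrightarrow> h g \<in> carrier N"
  shows "(\<Oplus>\<^bsub>N\<^esub>g\<in>carrier G. h (inv g)) = (\<Oplus>\<^bsub>N\<^esub>g\<in>carrier G. h g)"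
proof -
  interpret N: abelian_group N by fact
  have "k \<in> (\<lambda>g. inv g) ` carrier G" if "k \<in> carrier G" for k
    using that by (intro image_eqI[where x = "inv k"]) auto
  then have "(\<lambda>g. inv g) ` carrier G = carrier G"
    by auto
  then show ?thesis
    using N.finsum_reindex[of h "\<lambda>g. inv g" "carrier G"] assms(2) by (auto simp: G.inv_inj)
qed

abbreviation LG :: "('k, 'g \<Rightarrow> 'a) module" where
  "LG \<equiv> skew_group_algebra G \<beta> L"

text \<open>The right action of \<open>LG\<close> on families of elements of a module over \<open>L\<close>; for \<open>L\<close> itself it is
  the multiplication of \<open>LG\<close>.\<close>

definition conv :: "('a, 'u) rmodule \<Rightarrow> ('g \<Rightarrow> 'u) \<Rightarrow> ('g \<Rightarrow> 'a) \<Rightarrow> 'g \<Rightarrow> 'u" where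
  "conv M x b = (\<lambda>k\<in>carrier G. \<Oplus>\<^bsub>M\<^esub>g\<in>carrier G. x g \<diamondop>\<^bsub>M\<^esub> \<beta> g (b (inv g \<otimes> k)))"

lemma carrier_LG: "carrier LG = carrier G \<rightarrow>\<^sub>E carrier L"
  by (simp add: skew_group_algebra_def)

lemma LG_app [simp]: "b \<in> carrier LG \<Longrightarrow> g \<in> carrier G \<Longrightarrow> b g \<in> carrier L"
  by (auto simp: carrier_LG)

lemma LG_eqI:
  assumes "b \<in> carrier LG" "c \<in> carrier LG" "\<And>k. k \<in> carrier G \<Longrightarrow> b k = c k"
  shows "b = c"
  using assms by (intro extensionalityI[where A = "carrier G"]) (auto simp: carrier_LG PiE_iff)

lemma mult_LG: "b \<otimes>\<^bsub>LG\<^esub> c = (\<lambda>k\<in>carrier G. \<Oplus>\<^bsub>L\<^esub>g\<in>carrier G. b g \<otimes>\<^bsub>L\<^esub> \<beta> g (c (inv g \<otimes> k)))"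
  and add_LG: "b \<oplus>\<^bsub>LG\<^esub> c = (\<lambda>k\<in>carrier G. b k \<oplus>\<^bsub>L\<^esub> c k)"
  and zero_LG: "\<zero>\<^bsub>LG\<^esub> = (\<lambda>k\<in>carrier G. \<zero>\<^bsub>L\<^esub>)"
  and one_LG: "\<one>\<^bsub>LG\<^esub> = skew_embed G L \<one>\<^bsub>L\<^esub>"
  by (simp_all add: skew_group_algebra_def skew_embed_def)

lemma conv_closed:
  assumes "right_module L M" "x \<in> carrier G \<rightarrow>\<^sub>E carrier M" "b \<in> carrier LG"
  shows "conv M x b \<in> carrier G \<rightarrow>\<^sub>E carrier M"
proof -
  interpret M: right_module L M by fact
  show ?thesis
    using assms(2,3) by (auto simp: conv_def intro!: M.M.finsum_in M.ract_closed)
qed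

lemma mult_LG_closed: "b \<in> carrier LG \<Longrightarrow> c \<in> carrier LG \<Longrightarrow> b \<otimes>\<^bsub>LG\<^esub> c \<in> carrier LG"
  by (auto simp: mult_LG carrier_LG intro!: L.finsum_in)

text \<open>Both sides expand to one double sum over g and h. After the sums are exchanged, the
  inner one is reindexed by g = h \<otimes> l, and \<beta> h (\<beta> l a) = \<beta> (h \<otimes> l)
  a matches the terms. For M = \<open>regular\<close> this becomes associativity of
  \<open>LG\<close>.\<close>

lemma conv_assoc:
  assumes "right_module L M" "x \<in> carrier G \<rightarrow>\<^sub>E carrier M" "b \<in> carrier LG" "c \<in> carrier LG"
  shows "conv M (conv M x b) c = conv M x (b \<otimes>\<^bsub>LG\<^esub> c)"
proof (rule extensionalityI[where A = "carrier G"])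
  interpret M: right_module L M by fact
  fix k assume k: "k \<in> carrier G"
  have x: "x g \<in> carrier M" if "g \<in> carrier G" for g
    using assms(2) that by auto
  let ?t = "\<lambda>g h. x h \<diamondop>\<^bsub>M\<^esub> (\<beta> h (b (inv h \<otimes> g)) \<otimes>\<^bsub>L\<^esub> \<beta> g (c (inv g \<otimes> k)))"
  have t: "?t g h \<in> carrier M" if "g \<in> carrier G" "h \<in> carrier G" for g h
    using assms(3,4) that k x by (auto intro!: M.ract_closed)
  have "conv M (conv M x b) c k = (\<Oplus>\<^bsub>M\<^esub>g\<in>carrier G.
      (\<Oplus>\<^bsub>M\<^esub>h\<in>carrier G. x h \<diamondop>\<^bsub>M\<^esub> \<beta> h (b (inv h \<otimes> g))) \<diamondop>\<^bsub>M\<^esub> \<beta> g (c (inv g \<otimes> k)))"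
    using assms(3,4) k x
    by (auto simp: conv_def intro!: M.M.finsum_eqI M.ract_closed M.M.finsum_in)
  also have "\<dots> = (\<Oplus>\<^bsub>M\<^esub>g\<in>carrier G. \<Oplus>\<^bsub>M\<^esub>h\<in>carrier G. ?t g h)"
  proof (rule M.M.finsum_eqI)
    fix g assume g: "g \<in> carrier G"
    show "(\<Oplus>\<^bsub>M\<^esub>h\<in>carrier G. x h \<diamondop>\<^bsub>M\<^esub> \<beta> h (b (inv h \<otimes> g))) \<diamondop>\<^bsub>M\<^esub> \<beta> g (c (inv g \<otimes> k))
        = (\<Oplus>\<^bsub>M\<^esub>h\<in>carrier G. ?t g h)"
      using assms(3,4) k x g
      by (subst M.finsum_ract) (auto intro!: M.ract_closed M.M.finsum_eqI simp: M.ract_mult)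
    show "(\<Oplus>\<^bsub>M\<^esub>h\<in>carrier G. x h \<diamondop>\<^bsub>M\<^esub> \<beta> h (b (inv h \<otimes> g))) \<diamondop>\<^bsub>M\<^esub> \<beta> g (c (inv g \<otimes> k)) \<in> carrier M"
      using assms(3,4) k x g by (auto intro!: M.ract_closed M.M.finsum_in)
  qed
  also have "\<dots> = (\<Oplus>\<^bsub>M\<^esub>h\<in>carrier G. \<Oplus>\<^bsub>M\<^esub>g\<in>carrier G. ?t g h)"
    using t by (intro M.M.finsum_swap) auto
  also have "\<dots> = (\<Oplus>\<^bsub>M\<^esub>h\<in>carrier G. x h \<diamondop>\<^bsub>M\<^esub> \<beta> h ((b \<otimes>\<^bsub>LG\<^esub> c) (inv h \<otimes> k)))"
  proof (rule M.M.finsum_eqI)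
    fix h assume h: "h \<in> carrier G"
    have "x h \<diamondop>\<^bsub>M\<^esub> \<beta> h ((b \<otimes>\<^bsub>LG\<^esub> c) (inv h \<otimes> k)) = (\<Oplus>\<^bsub>M\<^esub>l\<in>carrier G. ?t (h \<otimes> l) h)"
      using assms(3,4) k x h
      by (auto simp: mult_LG \<beta>_finsum \<beta>_times \<beta>_mult M.ract_finsum G.inv_mult_group G.m_assoc
          intro!: M.M.finsum_eqI M.ract_closed)
    also have "\<dots> = (\<Oplus>\<^bsub>M\<^esub>g\<in>carrier G. ?t g h)"
      using finsum_shift[of M h "\<lambda>g. ?t g h"] t h M.M.abelian_group_axioms by auto
    finally show "(\<Oplus>\<^bsub>M\<^esub>g\<in>carrier G. ?t g h) = x h \<diamondop>\<^bsub>M\<^esub> \<beta> h ((b \<otimes>\<^bsub>LG\<^esub> c) (inv h \<otimes> k))" ..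
    show "(\<Oplus>\<^bsub>M\<^esub>g\<in>carrier G. ?t g h) \<in> carrier M"
      using t h by (auto intro!: M.M.finsum_in)
  qed
  also have "\<dots> = conv M x (b \<otimes>\<^bsub>LG\<^esub> c) k"
    using k by (simp add: conv_def)
  finally show "conv M (conv M x b) c k = conv M x (b \<otimes>\<^bsub>LG\<^esub> c) k" .
qed (auto simp: conv_def)

lemma conv_add_left:
  assumes "right_module L M" "x \<in> carrier G \<rightarrow>\<^sub>E carrier M" "y \<in> carrier G \<rightarrow>\<^sub>E carrier M" "b \<in> carrier LG"
  shows "conv M (\<lambda>k\<in>carrier G. x k \<oplus>\<^bsub>M\<^esub> y k) b = (\<lambda>k\<in>carrier G. conv M x b k \<oplus>\<^bsub>M\<^esub> conv M y b k)"
proof (rule extensionalityI[where A = "carrier G"])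
  interpret M: right_module L M by fact
  fix k assume k: "k \<in> carrier G"
  let ?b = "\<lambda>g. \<beta> g (b (inv g \<otimes> k))"
  have t: "x g \<in> carrier M" "y g \<in> carrier M" "x g \<diamondop>\<^bsub>M\<^esub> ?b g \<in> carrier M" "y g \<diamondop>\<^bsub>M\<^esub> ?b g \<in> carrier M"
    if "g \<in> carrier G" for g
    using that assms(2-) k by (auto simp: PiE_iff intro!: M.ract_closed)
  have "conv M (\<lambda>k\<in>carrier G. x k \<oplus>\<^bsub>M\<^esub> y k) b k =
      (\<Oplus>\<^bsub>M\<^esub>g\<in>carrier G. x g \<diamondop>\<^bsub>M\<^esub> ?b g \<oplus>\<^bsub>M\<^esub> y g \<diamondop>\<^bsub>M\<^esub> ?b g)"
    using assms(4) k t by (auto simp: conv_def M.ract_add_left simp del: M.M.finsum_addf intro!: M.M.finsum_eqI)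
  also have "\<dots> = conv M x b k \<oplus>\<^bsub>M\<^esub> conv M y b k"
    using k t by (subst M.M.finsum_addf) (auto simp: conv_def)
  finally show "conv M (\<lambda>k\<in>carrier G. x k \<oplus>\<^bsub>M\<^esub> y k) b k = (\<lambda>k\<in>carrier G. conv M x b k \<oplus>\<^bsub>M\<^esub> conv M y b k) k"
    using k by simp
qed (auto simp: conv_def)

lemma conv_add_right:
  assumes "right_module L M" "x \<in> carrier G \<rightarrow>\<^sub>E carrier M" "b \<in> carrier LG" "c \<in> carrier LG"
  shows "conv M x (b \<oplus>\<^bsub>LG\<^esub> c) = (\<lambda>k\<in>carrier G. conv M x b k \<oplus>\<^bsub>M\<^esub> conv M x c k)"
proof (rule extensionalityI[where A = "carrier G"])
  interpret M: right_module L M by fact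
  fix k assume k: "k \<in> carrier G"
  let ?b = "\<lambda>b g. \<beta> g (b (inv g \<otimes> k))"
  have t: "x g \<in> carrier M" "x g \<diamondop>\<^bsub>M\<^esub> ?b b g \<in> carrier M" "x g \<diamondop>\<^bsub>M\<^esub> ?b c g \<in> carrier M"
    if "g \<in> carrier G" for g
    using that assms(2-) k by (auto simp: PiE_iff intro!: M.ract_closed)
  have "conv M x (b \<oplus>\<^bsub>LG\<^esub> c) k = (\<Oplus>\<^bsub>M\<^esub>g\<in>carrier G. x g \<diamondop>\<^bsub>M\<^esub> ?b b g \<oplus>\<^bsub>M\<^esub> x g \<diamondop>\<^bsub>M\<^esub> ?b c g)"
    using assms(3,4) k t
    by (auto simp: conv_def add_LG \<beta>_add M.ract_add_right simp del: M.M.finsum_addf intro!: M.M.finsum_eqI)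
  also have "\<dots> = conv M x b k \<oplus>\<^bsub>M\<^esub> conv M x c k"
    using k t by (subst M.M.finsum_addf) (auto simp: conv_def)
  finally show "conv M x (b \<oplus>\<^bsub>LG\<^esub> c) k = (\<lambda>k\<in>carrier G. conv M x b k \<oplus>\<^bsub>M\<^esub> conv M x c k) k"
    using k by simp
qed (auto simp: conv_def)

lemma skew_embed_closed [simp]: "a \<in> carrier L \<Longrightarrow> skew_embed G L a \<in> carrier LG"
  by (auto simp: skew_embed_def carrier_LG)

text \<open>\<open>single g a\<close> is the tensor \<open>a \<otimes> g\<close>.\<close>

definition single :: "'g \<Rightarrow> 'a \<Rightarrow> 'g \<Rightarrow> 'a" where
  "single g a = (\<lambda>k\<in>carrier G. if k = g then a else \<zero>\<^bsub>L\<^esub>)"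

lemma skew_embed_single: "skew_embed G L a = single \<one> a"
  by (simp add: skew_embed_def single_def)

lemma single_app [simp]: "k \<in> carrier G \<Longrightarrow> single g a k = (if k = g then a else \<zero>\<^bsub>L\<^esub>)"
  by (simp add: single_def)

lemma single_closed [simp]: "a \<in> carrier L \<Longrightarrow> single g a \<in> carrier LG"
  by (auto simp: single_def carrier_LG)

lemma inv_mult_eq_iff:
  "g \<in> carrier G \<Longrightarrow> k \<in> carrier G \<Longrightarrow> h \<in> carrier G \<Longrightarrow> inv g \<otimes> k = h \<longleftrightarrow> g = k \<otimes> inv h"
  by (metis G.inv_closed G.inv_inv G.inv_solve_left G.inv_solve_right')

text \<open>Only the index g = k \<otimes> inv h contributes. For a = 1 the result is a translation
  of the family; for h = \<one> it is the action of a on coordinate k through \<beta> k.\<close>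

lemma conv_single:
  assumes "right_module L M" "x \<in> carrier G \<rightarrow>\<^sub>E carrier M" "a \<in> carrier L" "h \<in> carrier G" "k \<in> carrier G"
  shows "conv M x (single h a) k = x (k \<otimes> inv h) \<diamondop>\<^bsub>M\<^esub> \<beta> (k \<otimes> inv h) a"
proof -
  interpret M: right_module L M by fact
  let ?l = "k \<otimes> inv h"
  have "conv M x (single h a) k = (\<Oplus>\<^bsub>M\<^esub>g\<in>carrier G. if g = ?l then x ?l \<diamondop>\<^bsub>M\<^esub> \<beta> ?l a else \<zero>\<^bsub>M\<^esub>)"
    using assms(2-)
    by (auto simp: conv_def single_def PiE_iff inv_mult_eq_iff intro!: M.M.finsum_eqI M.ract_closed)
  also have "\<dots> = x ?l \<diamondop>\<^bsub>M\<^esub> \<beta> ?l a"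
    using assms(2-) by (intro M.M.finsum_delta) (auto intro!: M.ract_closed)
  finally show ?thesis .
qed

text \<open>L as a right module over itself. It makes multiplication in \<open>LG\<close> an
  instance of \<open>conv\<close>, so that associativity and distributivity of \<open>LG\<close>
  follow from the lemmas on families.\<close>

definition regular :: "('a, 'a) rmodule" where
  "regular = \<lparr>carrier = carrier L, monoid.mult = monoid.mult L, monoid.one = \<one>\<^bsub>L\<^esub>,
     ring.zero = \<zero>\<^bsub>L\<^esub>, ring.add = ring.add L,
     ract = monoid.mult L\<rparr>"

lemma regular_simps [simp]:
  "carrier regular = carrier L" "\<zero>\<^bsub>regular\<^esub> = \<zero>\<^bsub>L\<^esub>" "x \<oplus>\<^bsub>regular\<^esub> y = x \<oplus>\<^bsub>L\<^esub> y"
  "x \<diamondop>\<^bsub>regular\<^esub> a = x \<otimes>\<^bsub>L\<^esub> a"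
  by (simp_all add: regular_def)

lemma finsum_regular [simp]: "finsum regular h J = finsum L h J"
  by (simp add: finsum_def finprod_def regular_def)

lemma regular_module: "right_module L regular"
proof -
  interpret R: abelian_group regular
    by (rule abelian_groupI) (auto simp: L.a_ac intro!: bexI[where x = "\<ominus>\<^bsub>L\<^esub> _"] L.l_neg)
  show ?thesis
    by unfold_locales (auto simp: L.m_assoc L.l_distr L.r_distr)
qed

lemma mult_LG_conv: "b \<otimes>\<^bsub>LG\<^esub> c = conv regular b c"
  by (simp add: mult_LG conv_def)

lemma mult_LG_single:
  assumes "b \<in> carrier LG" "a \<in> carrier L" "h \<in> carrier G" "k \<in> carrier G"
  shows "(b \<otimes>\<^bsub>LG\<^esub> single h a) k = b (k \<otimes> inv h) \<otimes>\<^bsub>L\<^esub> \<beta> (k \<otimes> inv h) a"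
  using conv_single[OF regular_module] assms by (simp add: mult_LG_conv carrier_LG)

lemma mult_single_LG:
  assumes "b \<in> carrier LG" "a \<in> carrier L" "h \<in> carrier G" "k \<in> carrier G"
  shows "(single h a \<otimes>\<^bsub>LG\<^esub> b) k = a \<otimes>\<^bsub>L\<^esub> \<beta> h (b (inv h \<otimes> k))"
proof -
  have "(single h a \<otimes>\<^bsub>LG\<^esub> b) k =
      (\<Oplus>\<^bsub>L\<^esub>g\<in>carrier G. if g = h then a \<otimes>\<^bsub>L\<^esub> \<beta> h (b (inv h \<otimes> k)) else \<zero>\<^bsub>L\<^esub>)"
    using assms by (auto simp: mult_LG single_def intro!: L.finsum_eqI)
  also have "\<dots> = a \<otimes>\<^bsub>L\<^esub> \<beta> h (b (inv h \<otimes> k))"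
    using assms by (intro L.finsum_delta) auto
  finally show ?thesis .
qed

lemma single_mult_single:
  assumes "a \<in> carrier L" "b \<in> carrier L" "g \<in> carrier G" "h \<in> carrier G"
  shows "single g a \<otimes>\<^bsub>LG\<^esub> single h b = single (g \<otimes> h) (a \<otimes>\<^bsub>L\<^esub> \<beta> g b)"
proof (rule LG_eqI)
  fix k assume k: "k \<in> carrier G"
  have "inv g \<otimes> k = h \<longleftrightarrow> k = g \<otimes> h"
    using assms k by auto
  then show "(single g a \<otimes>\<^bsub>LG\<^esub> single h b) k = single (g \<otimes> h) (a \<otimes>\<^bsub>L\<^esub> \<beta> g b) k"
    using assms k by (simp add: mult_single_LG)
qed (use assms in \<open>auto simp: mult_LG_closed\<close>)

lemma ring_LG: "ring LG"
proof (rule ringI)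
  show "abelian_group LG"
  proof (rule abelian_groupI)
    fix b assume b: "b \<in> carrier LG"
    then show "\<exists>c\<in>carrier LG. c \<oplus>\<^bsub>LG\<^esub> b = \<zero>\<^bsub>LG\<^esub>"
      by (intro bexI[where x = "\<lambda>g\<in>carrier G. \<ominus>\<^bsub>L\<^esub> b g"])
        (auto simp: add_LG zero_LG carrier_LG L.l_neg)
    show "\<zero>\<^bsub>LG\<^esub> \<oplus>\<^bsub>LG\<^esub> b = b"
      using b by (auto simp: add_LG zero_LG carrier_LG PiE_iff intro!: extensionalityI[where A = "carrier G"])
  qed (auto simp: add_LG zero_LG carrier_LG PiE_iff L.a_ac intro!: restrict_ext)
  show "monoid LG"
  proof (rule monoidI)
    fix b assume b: "b \<in> carrier LG"
    show "\<one>\<^bsub>LG\<^esub> \<otimes>\<^bsub>LG\<^esub> b = b"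
      using b by (intro LG_eqI) (auto simp: one_LG skew_embed_single mult_single_LG mult_LG_closed)
    show "b \<otimes>\<^bsub>LG\<^esub> \<one>\<^bsub>LG\<^esub> = b"
      using b by (intro LG_eqI) (auto simp: one_LG skew_embed_single mult_LG_single mult_LG_closed)
    fix c d assume "c \<in> carrier LG" "d \<in> carrier LG"
    then show "b \<otimes>\<^bsub>LG\<^esub> c \<otimes>\<^bsub>LG\<^esub> d = b \<otimes>\<^bsub>LG\<^esub> (c \<otimes>\<^bsub>LG\<^esub> d)"
      using b conv_assoc[OF regular_module, of b c d] by (simp add: carrier_LG flip: mult_LG_conv)
  qed (auto simp: mult_LG_closed one_LG)
  fix b c d assume bcd: "b \<in> carrier LG" "c \<in> carrier LG" "d \<in> carrier LG"
  show "(b \<oplus>\<^bsub>LG\<^esub> c) \<otimes>\<^bsub>LG\<^esub> d = b \<otimes>\<^bsub>LG\<^esub> d \<oplus>\<^bsub>LG\<^esub> c \<otimes>\<^bsub>LG\<^esub> d"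
    using conv_add_left[OF regular_module, of b c d] bcd by (simp add: mult_LG_conv add_LG carrier_LG)
  show "d \<otimes>\<^bsub>LG\<^esub> (b \<oplus>\<^bsub>LG\<^esub> c) = d \<otimes>\<^bsub>LG\<^esub> b \<oplus>\<^bsub>LG\<^esub> d \<otimes>\<^bsub>LG\<^esub> c"
    using conv_add_right[OF regular_module, of d b c] bcd by (simp add: mult_LG_conv add_LG carrier_LG)
qed

sublocale LG: ring LG
  by (rule ring_LG)

lemma finsum_LG:
  assumes "finite J" "\<And>i. i \<in> J \<Longrightarrow> h i \<in> carrier LG" "k \<in> carrier G"
  shows "(\<Oplus>\<^bsub>LG\<^esub>i\<in>J. h i) k = (\<Oplus>\<^bsub>L\<^esub>i\<in>J. h i k)"
  using assms
  by (intro additive_finsum[where f = "\<lambda>b. b k", OF LG.abelian_group_axioms L.abelian_group_axioms])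
    (auto simp: add_LG)

lemma LG_decomp: "b \<in> carrier LG \<Longrightarrow> (\<Oplus>\<^bsub>LG\<^esub>g\<in>carrier G. single g (b g)) = b"
proof (rule LG_eqI)
  fix k assume b: "b \<in> carrier LG" and k: "k \<in> carrier G"
  then have "(\<Oplus>\<^bsub>LG\<^esub>g\<in>carrier G. single g (b g)) k = (\<Oplus>\<^bsub>L\<^esub>g\<in>carrier G. if k = g then b k else \<zero>\<^bsub>L\<^esub>)"
    by (subst finsum_LG) (auto intro!: L.finsum_eqI)
  then show "(\<Oplus>\<^bsub>LG\<^esub>g\<in>carrier G. single g (b g)) k = b k"
    using b k by (simp add: L.finsum_delta)
qed (auto intro!: LG.finsum_in)

end

section \<open>Twisted, restricted and induced modules\<close>

lemma module_homsD:
  assumes "f \<in> module_homs A M N"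
  shows "x \<in> carrier M \<Longrightarrow> f x \<in> carrier N"
    and "x \<in> carrier M \<Longrightarrow> y \<in> carrier M \<Longrightarrow> f (x \<oplus>\<^bsub>M\<^esub> y) = f x \<oplus>\<^bsub>N\<^esub> f y"
    and "x \<in> carrier M \<Longrightarrow> a \<in> carrier A \<Longrightarrow> f (x \<diamondop>\<^bsub>M\<^esub> a) = f x \<diamondop>\<^bsub>N\<^esub> a"
    and "f \<in> extensional (carrier M)"
  using assms by (auto simp: module_homs_def PiE_def)

lemma module_homsI:
  assumes "\<And>x. x \<in> carrier M \<Longrightarrow> f x \<in> carrier N" "f \<in> extensional (carrier M)"
    and "\<And>x y. x \<in> carrier M \<Longrightarrow> y \<in> carrier M \<Longrightarrow> f (x \<oplus>\<^bsub>M\<^esub> y) = f x \<oplus>\<^bsub>N\<^esub> f y"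
    and "\<And>x a. x \<in> carrier M \<Longrightarrow> a \<in> carrier A \<Longrightarrow> f (x \<diamondop>\<^bsub>M\<^esub> a) = f x \<diamondop>\<^bsub>N\<^esub> a"
  shows "f \<in> module_homs A M N"
  using assms by (auto simp: module_homs_def PiE_def)

lemma module_homs_compose:
  assumes "f \<in> module_homs A L M" "h \<in> module_homs A M N" "right_module A L"
  shows "compose (carrier L) h f \<in> module_homs A L N"
proof -
  interpret L: right_module A L by fact
  show ?thesis
    using assms(1,2)
    by (intro module_homsI)
      (auto simp: compose_def module_homsD[OF assms(1)] module_homsD[OF assms(2)] L.ract_closed)
qed

lemma module_homs_finsum:
  assumes "right_module A M" "right_module A N" "f \<in> module_homs A M N" "finite J"
    and "\<And>i. i \<in> J \<Longrightarrow> h i \<in> carrier M"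
  shows "f (\<Oplus>\<^bsub>M\<^esub>i\<in>J. h i) = (\<Oplus>\<^bsub>N\<^esub>i\<in>J. f (h i))"
  using assms
  by (intro additive_finsum) (auto simp: right_module_def module_homsD)

lemma fg_modules_right_module: "M \<in> fg_modules A \<Longrightarrow> right_module A M"
  by (simp add: fg_modules_def)

text \<open>Restriction and twisting keep the additive fields but produce a new record, for
  restriction even one of another type. The group laws and finite sums are therefore transferred
  field by field.\<close>

lemma abelian_group_cong:
  assumes "carrier N = carrier M" "\<zero>\<^bsub>N\<^esub> = \<zero>\<^bsub>M\<^esub>" "add N = add M"
  shows "abelian_group N \<longleftrightarrow> abelian_group M"
  using assms
  by (simp add: abelian_group_def abelian_monoid_def abelian_group_axioms_def comm_group_def group_def
      group_axioms_def comm_monoid_def comm_monoid_axioms_def monoid_def Units_def)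

lemma finsum_record_cong:
  assumes "carrier N = carrier M" "\<zero>\<^bsub>N\<^esub> = \<zero>\<^bsub>M\<^esub>" "add N = add M"
  shows "finsum N = finsum M"
  by (intro ext) (simp add: finsum_def finprod_def assms)

context skew_action
begin

text \<open>\<open>twist_functor\<close> evaluates T at the module twisted by the inverse. With this
  abbreviation the twist of T by g sends M to the value of T at \<open>tw g M\<close>, on which a
  acts as \<beta> g a.\<close>

abbreviation tw :: "'g \<Rightarrow> ('a, 'u) rmodule \<Rightarrow> ('a, 'u) rmodule" where
  "tw g M \<equiv> twist_module G \<beta> (inv g) M"

abbreviation pd :: "('g \<Rightarrow> 'a, 'u) rmodule \<Rightarrow> ('a, 'u) rmodule" where
  "pd Z \<equiv> pushdown G L Z"

lemma pd_simps [simp]: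
  "carrier (pd Z) = carrier Z" "\<zero>\<^bsub>pd Z\<^esub> = \<zero>\<^bsub>Z\<^esub>" "add (pd Z) = add Z"
  "x \<diamondop>\<^bsub>pd Z\<^esub> a = x \<diamondop>\<^bsub>Z\<^esub> skew_embed G L a"
  by (auto simp: pushdown_def)

lemma finsum_pd [simp]: "finsum (pd Z) = finsum Z"
  by (rule finsum_record_cong) auto

lemma tw_simps [simp]:
  "carrier (tw g M) = carrier M" "\<zero>\<^bsub>tw g M\<^esub> = \<zero>\<^bsub>M\<^esub>" "add (tw g M) = add M"
  "g \<in> carrier G \<Longrightarrow> x \<diamondop>\<^bsub>tw g M\<^esub> a = x \<diamondop>\<^bsub>M\<^esub> \<beta> g a"
  by (auto simp: twist_module_def)

lemma finsum_tw [simp]: "finsum (tw g M) = finsum M"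
  by (rule finsum_record_cong) auto

lemma skew_embed_add:
  "a \<in> carrier L \<Longrightarrow> b \<in> carrier L \<Longrightarrow> skew_embed G L (a \<oplus>\<^bsub>L\<^esub> b) = skew_embed G L a \<oplus>\<^bsub>LG\<^esub> skew_embed G L b"
  by (auto simp: skew_embed_def add_LG)

lemma skew_embed_mult:
  "a \<in> carrier L \<Longrightarrow> b \<in> carrier L \<Longrightarrow> skew_embed G L (a \<otimes>\<^bsub>L\<^esub> b) = skew_embed G L a \<otimes>\<^bsub>LG\<^esub> skew_embed G L b"
  by (simp add: skew_embed_single single_mult_single)

lemma pd_module:
  assumes "right_module LG Z"
  shows "right_module L (pd Z)"
proof -
  interpret Z: right_module LG Z by fact
  interpret P: abelian_group "pd Z"
    using Z.M.abelian_group_axioms by (simp add: abelian_group_cong[of "pd Z" Z])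
  show ?thesis
    by unfold_locales
      (auto simp: Z.ract_closed Z.ract_add_left Z.ract_add_right skew_embed_add skew_embed_mult Z.ract_mult
        Z.ract_one simp flip: one_LG)
qed

lemma tw_module:
  assumes "right_module L M" "g \<in> carrier G"
  shows "right_module L (tw g M)"
proof -
  interpret M: right_module L M by fact
  interpret P: abelian_group "tw g M"
    using M.M.abelian_group_axioms by (simp add: abelian_group_cong[of "tw g M" M])
  show ?thesis
    using assms(2)
    by unfold_locales
      (auto simp: M.ract_closed M.ract_add_left M.ract_add_right \<beta>_add \<beta>_times M.ract_mult M.ract_one)
qed

text \<open>Moves the coefficient to the right of the group element: as a right module over L,
  \<open>LG\<close> is generated by the finitely many elements 1 \<otimes> g.\<close>

lemma single_factor:
  "g \<in> carrier G \<Longrightarrow> a \<in> carrier L \<Longrightarrow>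
    single g a = single g \<one>\<^bsub>L\<^esub> \<otimes>\<^bsub>LG\<^esub> skew_embed G L (\<beta> (inv g) a)"
  by (simp add: skew_embed_single single_mult_single)

lemma ract_LG_decomp:
  assumes "right_module LG Z" "z \<in> carrier Z" "b \<in> carrier LG"
  shows "z \<diamondop>\<^bsub>Z\<^esub> b = (\<Oplus>\<^bsub>Z\<^esub>g\<in>carrier G. z \<diamondop>\<^bsub>Z\<^esub> single g (b g))"
proof -
  interpret Z: right_module LG Z by fact
  have "z \<diamondop>\<^bsub>Z\<^esub> b = z \<diamondop>\<^bsub>Z\<^esub> (\<Oplus>\<^bsub>LG\<^esub>g\<in>carrier G. single g (b g))"
    using assms(3) by (simp add: LG_decomp)
  also have "\<dots> = (\<Oplus>\<^bsub>Z\<^esub>g\<in>carrier G. z \<diamondop>\<^bsub>Z\<^esub> single g (b g))"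
    using assms by (intro Z.ract_finsum) auto
  finally show ?thesis .
qed

text \<open>If S generates Z over \<open>LG\<close>, then the elements s (1 \<otimes> g) generate it
  over L, because each a \<otimes> g is 1 \<otimes> g followed by an element of L.\<close>

lemma pd_fg:
  assumes Z: "Z \<in> fg_modules LG"
  shows "pd Z \<in> fg_modules L"
proof -
  obtain S where "right_module LG Z" and S: "finite S" "S \<subseteq> carrier Z"
    and gen: "\<And>N. rsubmodule LG Z N \<Longrightarrow> S \<subseteq> N \<Longrightarrow> N \<subseteq> carrier Z \<Longrightarrow> N = carrier Z"
    using Z unfolding fg_modules_iff by blast
  then interpret Z: right_module LG Z by simp
  interpret P: right_module L "pd Z"
    by (rule pd_module) (rule Z.right_module_axioms)
  let ?S = "(\<lambda>(s, g). s \<diamondop>\<^bsub>Z\<^esub> single g \<one>\<^bsub>L\<^esub>) ` (S \<times> carrier G)"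
  have "N = carrier Z" if N: "rsubmodule L (pd Z) N" and SN: "?S \<subseteq> N" and NZ: "N \<subseteq> carrier Z" for N
  proof -
    \<comment> \<open>The largest \<open>LG\<close>-submodule of Z contained in N. Once it is shown
      to contain S, it is all of Z, and acting by the unit of \<open>LG\<close> brings every element
      back into N.\<close>
    let ?N = "{z \<in> carrier Z. \<forall>b\<in>carrier LG. z \<diamondop>\<^bsub>Z\<^esub> b \<in> N}"
    have "?N = carrier Z"
    proof (rule gen)
      show "rsubmodule LG Z ?N"
        using N by (auto simp: rsubmodule_def Z.ract_add_left Z.ract_closed simp flip: Z.ract_mult)
      have "s \<diamondop>\<^bsub>Z\<^esub> b \<in> N" if s: "s \<in> S" and b: "b \<in> carrier LG" for s b
      proof -
        have "s \<diamondop>\<^bsub>Z\<^esub> single g (b g) \<in> N" if g: "g \<in> carrier G" for g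
        proof -
          have "s \<diamondop>\<^bsub>Z\<^esub> single g (b g) = s \<diamondop>\<^bsub>Z\<^esub> single g \<one>\<^bsub>L\<^esub> \<diamondop>\<^bsub>pd Z\<^esub> \<beta> (inv g) (b g)"
            using s b g S by (subst single_factor) (auto simp: subset_iff Z.ract_mult)
          moreover have "s \<diamondop>\<^bsub>Z\<^esub> single g \<one>\<^bsub>L\<^esub> \<in> N"
            using s g SN by auto
          ultimately show ?thesis
            using N b g unfolding rsubmodule_def by auto
        qed
        moreover have "s \<in> carrier Z"
          using s S by auto
        ultimately show ?thesis
          using b P.finsum_in_submodule[OF N, of "carrier G" "\<lambda>g. s \<diamondop>\<^bsub>Z\<^esub> single g (b g)"] NZ
          by (subst ract_LG_decomp[OF Z.right_module_axioms]) auto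
      qed
      then show "S \<subseteq> ?N"
        using S by auto
    qed auto
    then have "z \<diamondop>\<^bsub>Z\<^esub> \<one>\<^bsub>LG\<^esub> \<in> N" if "z \<in> carrier Z" for z
      using that LG.one_closed by auto
    then have "carrier Z \<subseteq> N"
      by (auto simp: Z.ract_one)
    with NZ show ?thesis
      by auto
  qed
  moreover have "?S \<subseteq> carrier Z" "finite ?S"
    using S by (auto intro!: Z.ract_closed)
  ultimately show ?thesis
    unfolding fg_modules_iff using P.right_module_axioms by (auto intro!: exI[where x = ?S])
qed

text \<open>\<beta> g permutes the elements of L, so M and its twist have the same submodules and
  the same generating sets.\<close>

lemma tw_fg:
  assumes M: "M \<in> fg_modules L" and g: "g \<in> carrier G"
  shows "tw g M \<in> fg_modules L"
proof -
  obtain S where "right_module L M" and S: "finite S" "S \<subseteq> carrier M"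
    and gen: "\<And>N. rsubmodule L M N \<Longrightarrow> S \<subseteq> N \<Longrightarrow> N \<subseteq> carrier M \<Longrightarrow> N = carrier M"
    using M unfolding fg_modules_iff by blast
  then have "right_module L (tw g M)"
    using g by (simp add: tw_module)
  moreover have "rsubmodule L M N" if N: "rsubmodule L (tw g M) N" for N
  proof -
    have "\<forall>x\<in>N. \<forall>a\<in>carrier L. x \<diamondop>\<^bsub>M\<^esub> \<beta> g a \<in> N"
      using N g by (simp add: rsubmodule_def)
    then have "\<forall>x\<in>N. \<forall>a\<in>carrier L. x \<diamondop>\<^bsub>M\<^esub> a \<in> N"
      using g by (metis \<beta>_inv(2) \<beta>_closed G.inv_closed)
    then show ?thesis
      using N g by (simp add: rsubmodule_def)
  qed
  ultimately show ?thesis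
    unfolding fg_modules_iff using S gen by (auto intro!: exI[where x = S])
qed

section \<open>Right multiplication by group elements\<close>

definition act :: "('g \<Rightarrow> 'a, 'u) rmodule \<Rightarrow> 'g \<Rightarrow> 'u \<Rightarrow> 'u" where
  "act Z g = (\<lambda>z\<in>carrier Z. z \<diamondop>\<^bsub>Z\<^esub> single g \<one>\<^bsub>L\<^esub>)"

text \<open>In \<open>LG\<close>, (\<beta> g a \<otimes> 1)(1 \<otimes> g) = (1 \<otimes> g)(a
  \<otimes> 1). Right multiplication by 1 \<otimes> g is thus linear over L once its source is
  twisted by g.\<close>

lemma act_hom:
  assumes "right_module LG Z" "g \<in> carrier G"
  shows "act Z g \<in> module_homs L (tw g (pd Z)) (pd Z)"
proof -
  interpret Z: right_module LG Z by fact
  show ?thesis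
    using assms(2)
    by (intro module_homsI)
      (auto simp: act_def Z.ract_closed Z.ract_add_left skew_embed_single single_mult_single simp flip: Z.ract_mult)
qed

lemma act_inv_hom:
  assumes "right_module LG Z" "g \<in> carrier G"
  shows "act Z (inv g) \<in> module_homs L (pd Z) (tw g (pd Z))"
proof -
  interpret Z: right_module LG Z by fact
  show ?thesis
    using assms(2)
    by (intro module_homsI)
      (auto simp: act_def Z.ract_closed Z.ract_add_left skew_embed_single single_mult_single simp flip: Z.ract_mult)
qed

lemma act_act_inv:
  assumes "right_module LG Z" "g \<in> carrier G" "z \<in> carrier Z"
  shows "act Z g (act Z (inv g) z) = z" "act Z (inv g) (act Z g z) = z"
proof -
  interpret Z: right_module LG Z by fact
  show "act Z g (act Z (inv g) z) = z" "act Z (inv g) (act Z g z) = z"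
    using assms(2,3)
    by (simp_all add: act_def Z.ract_closed single_mult_single Z.ract_one
        flip: Z.ract_mult skew_embed_single one_LG)
qed

lemma act_natural:
  assumes "right_module LG Z" "f \<in> module_homs LG Z Y" "z \<in> carrier Z"
  shows "f (act Z g z) = act Y g (f z)"
  using assms(3) module_homsD[OF assms(2)] by (simp add: act_def)

lemma module_homs_pd:
  assumes "f \<in> module_homs LG Z Y"
  shows "f \<in> module_homs L (pd Z) (pd Y)"
  using module_homsD[OF assms] by (intro module_homsI) auto

lemma module_homs_tw:
  assumes "f \<in> module_homs L M N" "g \<in> carrier G"
  shows "f \<in> module_homs L (tw g M) (tw g N)"
  using module_homsD[OF assms(1)] assms(2) by (intro module_homsI) auto

section \<open>The induced module and its decomposition into twists\<close>

abbreviation fams :: "('a, 'u) rmodule \<Rightarrow> ('g \<Rightarrow> 'u) set" where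
  "fams M \<equiv> carrier G \<rightarrow>\<^sub>E carrier M"

text \<open>The induced module \<open>M \<otimes> LG\<close>, as the families \<open>carrier G \<rightarrow> M\<close>, coded in the type of \<open>M\<close>.\<close>

definition code :: "('a, 'u) rmodule \<Rightarrow> ('g \<Rightarrow> 'u) \<Rightarrow> 'u" where
  "code M = (SOME j. inj_on j (fams M))"

definition fam :: "('a, 'u) rmodule \<Rightarrow> 'u \<Rightarrow> 'g \<Rightarrow> 'u" where
  "fam M = inv_into (fams M) (code M)"

definition induced :: "('a, 'u) rmodule \<Rightarrow> ('g \<Rightarrow> 'a, 'u) rmodule" where
  "induced M = \<lparr>carrier = code M ` (fams M), monoid.mult = undefined, monoid.one = undefined,
     ring.zero = code M (\<lambda>k\<in>carrier G. \<zero>\<^bsub>M\<^esub>),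
     ring.add = (\<lambda>x y. code M (\<lambda>k\<in>carrier G. fam M x k \<oplus>\<^bsub>M\<^esub> fam M y k)),
     ract = (\<lambda>x b. code M (conv M (fam M x) b))\<rparr>"

definition proj :: "('a, 'u) rmodule \<Rightarrow> 'g \<Rightarrow> 'u \<Rightarrow> 'u" where
  "proj M g = (\<lambda>x\<in>carrier (induced M). fam M x g)"

definition incl :: "('a, 'u) rmodule \<Rightarrow> 'g \<Rightarrow> 'u \<Rightarrow> 'u" where
  "incl M g = (\<lambda>m\<in>carrier M. code M (\<lambda>k\<in>carrier G. if k = g then m else \<zero>\<^bsub>M\<^esub>))"

definition induced_map :: "('a, 'u) rmodule \<Rightarrow> ('a, 'u) rmodule \<Rightarrow> ('u \<Rightarrow> 'u) \<Rightarrow> 'u \<Rightarrow> 'u" where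
  "induced_map M N f = (\<lambda>x\<in>carrier (induced M). code N (\<lambda>k\<in>carrier G. f (fam M x k)))"

text \<open>The evaluation sending z \<otimes> g to z (1 \<otimes> g): the counit of induction as a
  left adjoint of restriction.\<close>

definition counit :: "('g \<Rightarrow> 'a, 'u) rmodule \<Rightarrow> 'u \<Rightarrow> 'u" where
  "counit Z = (\<lambda>x\<in>carrier (induced (pd Z)). \<Oplus>\<^bsub>Z\<^esub>g\<in>carrier G. act Z g (fam (pd Z) x g))"

text \<open>The unit of induction as a right adjoint, sending z to the sum of z (1 \<otimes> inv g)
  \<otimes> g. The inverses are what makes the family depend on z in an \<open>LG\<close>-linear
  way; its coordinate at \<one> is z itself.\<close>

definition unit :: "('g \<Rightarrow> 'a, 'u) rmodule \<Rightarrow> 'u \<Rightarrow> 'u" where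
  "unit Z = (\<lambda>z\<in>carrier Z. code (pd Z) (\<lambda>g\<in>carrier G. act Z (inv g) z))"

end

text \<open>\<open>embed\<close> turns the choice in \<open>code M\<close> into an actual injection,
  so that \<open>fam M\<close> decodes what \<open>code M\<close> has encoded. It is discharged in
  the last section, where infinity of the field provides such injections.\<close>

locale induction = skew_action L G \<beta> + M: right_module L M
  for L :: "('k, 'a) module" and G :: "'g monoid" (structure) and \<beta> :: "'g \<Rightarrow> 'a \<Rightarrow> 'a"
    and M :: "('a, 'u) rmodule" +
  assumes embed: "\<exists>j :: ('g \<Rightarrow> 'u) \<Rightarrow> 'u. inj_on j (fams M)"
begin

abbreviation HM where "HM \<equiv> induced M"

lemma code_inj: "inj_on (code M) (fams M)"
  unfolding code_def using embed by (rule someI_ex)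

lemma fam_code [simp]: "x \<in> fams M \<Longrightarrow> fam M (code M x) = x"
  by (simp add: fam_def code_inj)

lemma code_closed [simp]: "x \<in> fams M \<Longrightarrow> code M x \<in> carrier HM"
  by (simp add: induced_def)

lemma fam_PiE [simp]: "x \<in> carrier HM \<Longrightarrow> fam M x \<in> fams M"
  by (simp add: fam_def induced_def inv_into_into)

lemma code_fam [simp]: "x \<in> carrier HM \<Longrightarrow> code M (fam M x) = x"
  by (simp add: fam_def induced_def f_inv_into_f)

lemma fam_closed [simp]: "x \<in> carrier HM \<Longrightarrow> g \<in> carrier G \<Longrightarrow> fam M x g \<in> carrier M"
  using fam_PiE by blast

lemma induced_eqI:
  assumes "x \<in> carrier HM" "y \<in> carrier HM"
    and "\<And>k. k \<in> carrier G \<Longrightarrow> fam M x k = fam M y k"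
  shows "x = y"
proof -
  have "fam M x = fam M y"
    using fam_PiE[OF assms(1)] fam_PiE[OF assms(2)] assms(3)
    by (intro extensionalityI[where A = "carrier G"]) (auto simp: PiE_iff)
  then have "code M (fam M x) = code M (fam M y)"
    by simp
  then show ?thesis
    using assms(1,2) by simp
qed

lemma induced_eq_iff:
  "x \<in> carrier HM \<Longrightarrow> y \<in> carrier HM \<Longrightarrow>
    x = y \<longleftrightarrow> (\<forall>k\<in>carrier G. fam M x k = fam M y k)"
  using induced_eqI by auto

lemma zero_induced: "\<zero>\<^bsub>HM\<^esub> = code M (\<lambda>k\<in>carrier G. \<zero>\<^bsub>M\<^esub>)"
  and add_induced: "x \<oplus>\<^bsub>HM\<^esub> y = code M (\<lambda>k\<in>carrier G. fam M x k \<oplus>\<^bsub>M\<^esub> fam M y k)"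
  and ract_induced: "x \<diamondop>\<^bsub>HM\<^esub> b = code M (conv M (fam M x) b)"
  by (simp_all add: induced_def)

lemma zero_closed: "\<zero>\<^bsub>HM\<^esub> \<in> carrier HM"
  by (simp add: zero_induced)

lemma add_closed:
  "x \<in> carrier HM \<Longrightarrow> y \<in> carrier HM \<Longrightarrow> x \<oplus>\<^bsub>HM\<^esub> y \<in> carrier HM"
  by (simp add: add_induced)

lemma ract_closed: "x \<in> carrier HM \<Longrightarrow> b \<in> carrier LG \<Longrightarrow> x \<diamondop>\<^bsub>HM\<^esub> b \<in> carrier HM"
  by (simp add: ract_induced conv_closed M.right_module_axioms)

lemma fam_zero: "fam M \<zero>\<^bsub>HM\<^esub> = (\<lambda>k\<in>carrier G. \<zero>\<^bsub>M\<^esub>)"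
  by (simp add: zero_induced)

lemma fam_add:
  "x \<in> carrier HM \<Longrightarrow> y \<in> carrier HM \<Longrightarrow>
    fam M (x \<oplus>\<^bsub>HM\<^esub> y) = (\<lambda>k\<in>carrier G. fam M x k \<oplus>\<^bsub>M\<^esub> fam M y k)"
  by (simp add: add_induced)

lemma fam_ract:
  "x \<in> carrier HM \<Longrightarrow> b \<in> carrier LG \<Longrightarrow> fam M (x \<diamondop>\<^bsub>HM\<^esub> b) = conv M (fam M x) b"
  by (simp add: ract_induced conv_closed M.right_module_axioms)

lemma induced_module: "right_module LG HM"
proof -
  interpret N: abelian_group HM
  proof (rule abelian_groupI)
    fix x assume x: "x \<in> carrier HM"
    define y where "y = code M (\<lambda>k\<in>carrier G. \<ominus>\<^bsub>M\<^esub> fam M x k)"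
    have "(\<lambda>k\<in>carrier G. \<ominus>\<^bsub>M\<^esub> fam M x k) \<in> fams M"
      using x by auto
    then have y: "y \<in> carrier HM" "fam M y = (\<lambda>k\<in>carrier G. \<ominus>\<^bsub>M\<^esub> fam M x k)"
      unfolding y_def by (rule code_closed, rule fam_code)
    then have "y \<oplus>\<^bsub>HM\<^esub> x = \<zero>\<^bsub>HM\<^esub>"
      using x by (subst induced_eq_iff) (simp_all add: add_closed zero_closed fam_add fam_zero M.M.l_neg)
    with y show "\<exists>y\<in>carrier HM. y \<oplus>\<^bsub>HM\<^esub> x = \<zero>\<^bsub>HM\<^esub>"
      by blast
    show "\<zero>\<^bsub>HM\<^esub> \<oplus>\<^bsub>HM\<^esub> x = x"
      using x by (subst induced_eq_iff) (auto simp: add_closed zero_closed fam_add fam_zero)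
    fix y assume y: "y \<in> carrier HM"
    then show "x \<oplus>\<^bsub>HM\<^esub> y = y \<oplus>\<^bsub>HM\<^esub> x"
      using x by (subst induced_eq_iff) (auto simp: add_closed fam_add M.M.a_comm)
    fix z assume "z \<in> carrier HM"
    then show "x \<oplus>\<^bsub>HM\<^esub> y \<oplus>\<^bsub>HM\<^esub> z = x \<oplus>\<^bsub>HM\<^esub> (y \<oplus>\<^bsub>HM\<^esub> z)"
      using x y by (subst induced_eq_iff) (auto simp: add_closed fam_add M.M.a_assoc)
  qed (auto simp: add_closed zero_closed)
  show ?thesis
  proof unfold_locales
    fix x a b assume x: "x \<in> carrier HM" and a: "a \<in> carrier LG"
    show "x \<diamondop>\<^bsub>HM\<^esub> a \<in> carrier HM"
      using x a by (rule ract_closed)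
    show "(x \<oplus>\<^bsub>HM\<^esub> y) \<diamondop>\<^bsub>HM\<^esub> a = x \<diamondop>\<^bsub>HM\<^esub> a \<oplus>\<^bsub>HM\<^esub> y \<diamondop>\<^bsub>HM\<^esub> a"
      if y: "y \<in> carrier HM" for y
      using x y a conv_add_left[OF M.right_module_axioms, of "fam M x" "fam M y" a]
      by (subst induced_eq_iff) (auto simp: add_closed ract_closed fam_add fam_ract)
    assume b: "b \<in> carrier LG"
    show "x \<diamondop>\<^bsub>HM\<^esub> (a \<oplus>\<^bsub>LG\<^esub> b) = x \<diamondop>\<^bsub>HM\<^esub> a \<oplus>\<^bsub>HM\<^esub> x \<diamondop>\<^bsub>HM\<^esub> b"
      using x a b conv_add_right[OF M.right_module_axioms, of "fam M x" a b]
      by (subst induced_eq_iff) (auto simp: add_closed ract_closed fam_add fam_ract)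
    show "x \<diamondop>\<^bsub>HM\<^esub> (a \<otimes>\<^bsub>LG\<^esub> b) = x \<diamondop>\<^bsub>HM\<^esub> a \<diamondop>\<^bsub>HM\<^esub> b"
      using x a b conv_assoc[OF M.right_module_axioms, of "fam M x" a b]
      by (subst induced_eq_iff) (auto simp: ract_closed fam_ract)
  next
    fix x assume x: "x \<in> carrier HM"
    then show "x \<diamondop>\<^bsub>HM\<^esub> \<one>\<^bsub>LG\<^esub> = x"
      by (subst induced_eq_iff)
        (auto simp: ract_closed fam_ract conv_single[OF M.right_module_axioms] M.ract_one one_LG skew_embed_single)
  qed
qed

sublocale HM: right_module LG "HM"
  by (rule induced_module)

lemma fam_act:
  assumes "x \<in> carrier HM" "g \<in> carrier G" "k \<in> carrier G"
  shows "fam M (act HM g x) k = fam M x (k \<otimes> inv g)"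
  using assms by (simp add: act_def fam_ract conv_single[OF M.right_module_axioms] M.ract_one)

text \<open>Coordinate k sees a as \<beta> k a. Hence the restriction of the induced module is the
  direct sum of the modules \<open>tw k M\<close>, with \<open>proj M k\<close> and
  \<open>incl M k\<close> as projections and inclusions.\<close>

lemma fam_embed:
  assumes "x \<in> carrier HM" "a \<in> carrier L" "k \<in> carrier G"
  shows "fam M (x \<diamondop>\<^bsub>HM\<^esub> skew_embed G L a) k = fam M x k \<diamondop>\<^bsub>M\<^esub> \<beta> k a"
  using assms by (simp add: fam_ract conv_single[OF M.right_module_axioms] skew_embed_single)

lemma proj_closed [simp]: "x \<in> carrier HM \<Longrightarrow> g \<in> carrier G \<Longrightarrow> proj M g x \<in> carrier M"
  by (simp add: proj_def)

lemma proj_hom: "g \<in> carrier G \<Longrightarrow> proj M g \<in> module_homs L (pd HM) (tw g M)"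
  by (intro module_homsI) (auto simp: proj_def fam_add add_closed ract_closed fam_embed)

text \<open>Not an instance of \<open>proj_hom\<close>: \<beta> \<one> is known to be the identity
  only on the carrier of L, so \<open>tw \<one> M\<close> need not equal M as a record, and a
  functor may take different values at them. The same applies to
  \<open>incl_one_hom\<close>.\<close>

lemma proj_one_hom: "proj M \<one> \<in> module_homs L (pd HM) M"
  by (intro module_homsI) (auto simp: proj_def fam_add add_closed ract_closed fam_embed)

lemma incl_PiE: "m \<in> carrier M \<Longrightarrow> (\<lambda>k\<in>carrier G. if k = g then m else \<zero>\<^bsub>M\<^esub>) \<in> fams M"
  by auto

lemma incl_closed [simp]: "m \<in> carrier M \<Longrightarrow> incl M g m \<in> carrier HM"
  by (simp add: incl_def code_closed[OF incl_PiE])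

lemma fam_incl: "m \<in> carrier M \<Longrightarrow> k \<in> carrier G \<Longrightarrow> fam M (incl M g m) k = (if k = g then m else \<zero>\<^bsub>M\<^esub>)"
  by (simp add: incl_def fam_code[OF incl_PiE])

lemma incl_add:
  "x \<in> carrier M \<Longrightarrow> y \<in> carrier M \<Longrightarrow> incl M g (x \<oplus>\<^bsub>M\<^esub> y) = incl M g x \<oplus>\<^bsub>HM\<^esub> incl M g y"
  by (subst induced_eq_iff) (auto simp: add_closed fam_add fam_incl)

lemma incl_ract:
  "g \<in> carrier G \<Longrightarrow> x \<in> carrier M \<Longrightarrow> a \<in> carrier L \<Longrightarrow>
    incl M g (x \<diamondop>\<^bsub>M\<^esub> \<beta> g a) = incl M g x \<diamondop>\<^bsub>HM\<^esub> skew_embed G L a"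
  by (subst induced_eq_iff) (auto simp: ract_closed fam_embed fam_incl M.ract_closed)

lemma incl_hom: "g \<in> carrier G \<Longrightarrow> incl M g \<in> module_homs L (tw g M) (pd HM)"
  by (intro module_homsI) (auto simp: incl_add incl_ract, simp add: incl_def)

lemma incl_one_hom: "incl M \<one> \<in> module_homs L M (pd HM)"
  using incl_ract[of "\<one>"] by (intro module_homsI) (auto simp: incl_add, simp add: incl_def)

lemma fam_finsum:
  assumes "finite J" "\<And>i. i \<in> J \<Longrightarrow> h i \<in> carrier HM" "k \<in> carrier G"
  shows "fam M (\<Oplus>\<^bsub>HM\<^esub>i\<in>J. h i) k = (\<Oplus>\<^bsub>M\<^esub>i\<in>J. fam M (h i) k)"
  using assms
  by (intro additive_finsum[where f = "\<lambda>x. fam M x k"])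
    (auto simp: fam_add HM.M.abelian_group_axioms M.M.abelian_group_axioms)

text \<open>The group moves the summand at \<one> onto every other summand. Therefore the copy of M
  at \<one> generates the induced module over \<open>LG\<close>.\<close>

lemma induced_decomp:
  assumes x: "x \<in> carrier HM"
  shows "(\<Oplus>\<^bsub>HM\<^esub>g\<in>carrier G. incl M \<one> (fam M x g) \<diamondop>\<^bsub>HM\<^esub> single g \<one>\<^bsub>L\<^esub>) = x"
proof (rule induced_eqI)
  let ?h = "\<lambda>g. incl M \<one> (fam M x g) \<diamondop>\<^bsub>HM\<^esub> single g \<one>\<^bsub>L\<^esub>"
  have h: "?h g \<in> carrier HM" if "g \<in> carrier G" for g
    using that x by (auto intro!: ract_closed)
  then show "(\<Oplus>\<^bsub>HM\<^esub>g\<in>carrier G. ?h g) \<in> carrier HM"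
    by (rule HM.M.finsum_in)
  fix k assume k: "k \<in> carrier G"
  have "fam M (\<Oplus>\<^bsub>HM\<^esub>g\<in>carrier G. ?h g) k = (\<Oplus>\<^bsub>M\<^esub>g\<in>carrier G. fam M (?h g) k)"
    using h k by (simp add: fam_finsum)
  also have "\<dots> = (\<Oplus>\<^bsub>M\<^esub>g\<in>carrier G. if k = g then fam M x k else \<zero>\<^bsub>M\<^esub>)"
  proof (rule M.M.finsum_eqI)
    fix g assume g: "g \<in> carrier G"
    then have "k \<otimes> inv g = \<one> \<longleftrightarrow> k = g"
      using k by (metis G.inv_equality G.inv_inv G.r_inv G.inv_closed)
    then show "fam M (?h g) k = (if k = g then fam M x k else \<zero>\<^bsub>M\<^esub>)"
      using x k g fam_act[of "incl M \<one> (fam M x g)" g k] by (simp add: act_def fam_incl)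
    show "fam M (?h g) k \<in> carrier M"
      using h[OF g] k by simp
  qed
  also have "\<dots> = fam M x k"
    using x k by (simp add: M.M.finsum_delta)
  finally show "fam M (\<Oplus>\<^bsub>HM\<^esub>g\<in>carrier G. ?h g) k = fam M x k" .
qed fact

lemma induced_fg:
  assumes "M \<in> fg_modules L"
  shows "HM \<in> fg_modules LG"
proof -
  obtain S where S: "finite S" "S \<subseteq> carrier M"
    and gen: "\<And>N. rsubmodule L M N \<Longrightarrow> S \<subseteq> N \<Longrightarrow> N \<subseteq> carrier M \<Longrightarrow> N = carrier M"
    using assms unfolding fg_modules_iff by blast
  let ?i = "incl M \<one>"
  have "N = carrier HM"
    if N: "rsubmodule LG HM N" and SN: "?i ` S \<subseteq> N" and NM: "N \<subseteq> carrier HM" for N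
  proof -
    have i0: "?i \<zero>\<^bsub>M\<^esub> = \<zero>\<^bsub>HM\<^esub>"
      by (rule additive_zero[OF M.M.abelian_group_axioms HM.M.abelian_group_axioms]) (auto simp: incl_add)
    \<comment> \<open>The preimage of N under the inclusion at \<one> is an L-submodule containing
      S. So N contains the whole summand at \<one>, and \<open>induced_decomp\<close> gives the
      rest.\<close>
    have "{m \<in> carrier M. ?i m \<in> N} = carrier M"
    proof (rule gen)
      show "rsubmodule L M {m \<in> carrier M. ?i m \<in> N}"
        using N incl_ract[of "\<one>"] by (auto simp: rsubmodule_def incl_add M.ract_closed i0)
    qed (use S SN in auto)
    then have "?i m \<in> N" if "m \<in> carrier M" for m
      using that by auto
    then have "?i (fam M x g) \<diamondop>\<^bsub>HM\<^esub> single g \<one>\<^bsub>L\<^esub> \<in> N"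
      if "x \<in> carrier HM" "g \<in> carrier G" for x g
      using that N unfolding rsubmodule_def by auto
    then have "x \<in> N" if "x \<in> carrier HM" for x
      using HM.finsum_in_submodule[OF N NM, of "carrier G"] induced_decomp[OF that] that
      by (metis (no_types, lifting) finite_G)
    then show ?thesis
      using NM by auto
  qed
  moreover have "?i ` S \<subseteq> carrier HM" "finite (?i ` S)"
    using S by auto
  ultimately show ?thesis
    unfolding fg_modules_iff using induced_module by (auto intro!: exI[where x = "?i ` S"])
qed

text \<open>Acting by h moves the summand at \<one> to the summand at h. These are the matrix
  entries behind the Kronecker delta in \<open>\<Phi>\<Psi>1\<close>.\<close>

lemma proj_act_incl:
  assumes "g \<in> carrier G" "h \<in> carrier G" "m \<in> carrier M"
  shows "proj M g (act HM h (incl M \<one> m)) = (if h = g then m else \<zero>\<^bsub>M\<^esub>)"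
proof -
  have "g \<otimes> inv h = \<one> \<longleftrightarrow> h = g"
    using assms by (metis G.inv_equality G.inv_inv G.r_inv G.inv_closed)
  then show ?thesis
    using assms by (simp add: proj_def fam_act fam_incl) (simp add: act_def ract_closed)
qed

text \<open>Acting by the inverse of h moves the summand at g to the one at g \<otimes> inv h, which
  is the summand at \<one> just for h = g. This is the counterpart for
  \<open>\<Phi>\<Psi>2\<close>.\<close>

lemma proj_act_inv_incl:
  assumes "g \<in> carrier G" "h \<in> carrier G" "m \<in> carrier M"
  shows "proj M \<one> (act HM (inv h) (incl M g m)) = (if h = g then m else \<zero>\<^bsub>M\<^esub>)"
  using assms by (simp add: proj_def fam_act fam_incl) (simp add: act_def ract_closed)

end

section \<open>Adjunction between induction and restriction\<close>

context skew_action
begin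

lemma induced_map_PiE:
  assumes "induction L G \<beta> M" "f \<in> module_homs L M N" "x \<in> carrier (induced M)"
  shows "(\<lambda>k\<in>carrier G. f (fam M x k)) \<in> fams N"
proof -
  interpret M: induction L G \<beta> M by fact
  show ?thesis
    using assms(3) module_homsD(1)[OF assms(2)] by auto
qed

lemma induced_map_closed:
  assumes "induction L G \<beta> M" "induction L G \<beta> N" "f \<in> module_homs L M N" "x \<in> carrier (induced M)"
  shows "induced_map M N f x \<in> carrier (induced N)"
  using induction.code_closed[OF assms(2) induced_map_PiE[OF assms(1,3,4)]] assms(4)
  by (simp add: induced_map_def)

lemma fam_induced_map:
  assumes "induction L G \<beta> M" "induction L G \<beta> N" "f \<in> module_homs L M N" "x \<in> carrier (induced M)"
    and "k \<in> carrier G"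
  shows "fam N (induced_map M N f x) k = f (fam M x k)"
  using induction.fam_code[OF assms(2) induced_map_PiE[OF assms(1,3,4)]] assms(4,5)
  by (simp add: induced_map_def)

lemma conv_hom:
  assumes "right_module L M" "right_module L N" "f \<in> module_homs L M N"
    and "x \<in> fams M" "b \<in> carrier LG" "k \<in> carrier G"
  shows "conv N (\<lambda>k\<in>carrier G. f (x k)) b k = f (conv M x b k)"
proof -
  interpret M: right_module L M by fact
  interpret N: right_module L N by fact
  let ?b = "\<lambda>g. \<beta> g (b (inv g \<otimes> k))"
  have x: "x g \<in> carrier M" if "g \<in> carrier G" for g
    using assms(4) that by auto
  have "f (conv M x b k) = (\<Oplus>\<^bsub>N\<^esub>g\<in>carrier G. f (x g \<diamondop>\<^bsub>M\<^esub> ?b g))"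
    using assms x by (simp add: conv_def module_homs_finsum[OF assms(1-3)] M.ract_closed)
  also have "\<dots> = conv N (\<lambda>k\<in>carrier G. f (x k)) b k"
    using assms(5,6) x module_homsD[OF assms(3)]
    by (auto simp: conv_def intro!: N.M.finsum_eqI N.ract_closed)
  finally show ?thesis ..
qed

lemma induced_map_hom:
  assumes M: "induction L G \<beta> M" and N: "induction L G \<beta> N" and f: "f \<in> module_homs L M N"
  shows "induced_map M N f \<in> module_homs LG (induced M) (induced N)"
proof (rule module_homsI)
  interpret M: induction L G \<beta> M by fact
  interpret N: induction L G \<beta> N by fact
  note facts = induced_map_closed[OF M N f] fam_induced_map[OF M N f] module_homsD[OF f]
    M.add_closed N.add_closed M.ract_closed N.ract_closed M.fam_add N.fam_add M.fam_ract N.fam_ract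
  show "induced_map M N f \<in> extensional (carrier (induced M))"
    by (simp add: induced_map_def)
  fix x assume x: "x \<in> carrier (induced M)"
  show "induced_map M N f x \<in> carrier (induced N)"
    using x by (rule induced_map_closed[OF M N f])
  show "induced_map M N f (x \<oplus>\<^bsub>induced M\<^esub> y) = induced_map M N f x \<oplus>\<^bsub>induced N\<^esub> induced_map M N f y"
    if "y \<in> carrier (induced M)" for y
    using x that by (subst N.induced_eq_iff) (simp_all add: facts)
  show "induced_map M N f (x \<diamondop>\<^bsub>induced M\<^esub> b) = induced_map M N f x \<diamondop>\<^bsub>induced N\<^esub> b"
    if b: "b \<in> carrier LG" for b
  proof (rule N.induced_eqI)
    fix k assume k: "k \<in> carrier G"
    have "fam N (induced_map M N f x) = (\<lambda>k\<in>carrier G. f (fam M x k))"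
      using x by (simp add: induced_map_def N.fam_code[OF induced_map_PiE[OF M f x]])
    then show "fam N (induced_map M N f (x \<diamondop>\<^bsub>induced M\<^esub> b)) k = fam N (induced_map M N f x \<diamondop>\<^bsub>induced N\<^esub> b) k"
      using x b k conv_hom[OF M.M.right_module_axioms N.M.right_module_axioms f M.fam_PiE[OF x] b k]
      by (simp add: facts)
  qed (use x b in \<open>simp_all add: facts\<close>)
qed

lemma proj_natural:
  assumes "induction L G \<beta> M" "induction L G \<beta> N" "f \<in> module_homs L M N" "g \<in> carrier G"
    and "x \<in> carrier (induced M)"
  shows "proj N g (induced_map M N f x) = f (proj M g x)"
  using induced_map_closed[OF assms(1-3,5)] fam_induced_map[OF assms(1-3,5,4)] assms(5)
  by (simp add: proj_def)

lemma incl_natural: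
  assumes M: "induction L G \<beta> M" and N: "induction L G \<beta> N" and f: "f \<in> module_homs L M N"
    and m: "m \<in> carrier M"
  shows "induced_map M N f (incl M g m) = incl N g (f m)"
proof -
  interpret M: induction L G \<beta> M by fact
  interpret N: induction L G \<beta> N by fact
  have "f \<zero>\<^bsub>M\<^esub> = \<zero>\<^bsub>N\<^esub>"
    by (rule additive_zero[OF M.M.M.abelian_group_axioms N.M.M.abelian_group_axioms])
      (auto simp: module_homsD[OF f])
  then show ?thesis
    using m module_homsD(1)[OF f m]
    by (subst N.induced_eq_iff)
      (simp_all add: induced_map_closed[OF M N f] fam_induced_map[OF M N f] M.fam_incl N.fam_incl)
qed

end

section \<open>Counit and unit, with the triangle identities\<close>

locale restriction = skew_action L G \<beta> + Z: right_module "skew_group_algebra G \<beta> L" Z +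
    P: induction L G \<beta> "pushdown G L Z"
  for L :: "('k, 'a) module" and G :: "'g monoid" (structure) and \<beta> :: "'g \<Rightarrow> 'a \<Rightarrow> 'a"
    and Z :: "('g \<Rightarrow> 'a, 'u) rmodule"
begin

abbreviation HZ where "HZ \<equiv> induced (pd Z)"

lemma act_closed [simp]: "z \<in> carrier Z \<Longrightarrow> act Z g z \<in> carrier Z"
  by (simp add: act_def Z.ract_closed)

lemma act_add: "z \<in> carrier Z \<Longrightarrow> y \<in> carrier Z \<Longrightarrow> act Z g (z \<oplus>\<^bsub>Z\<^esub> y) = act Z g z \<oplus>\<^bsub>Z\<^esub> act Z g y"
  by (simp add: act_def Z.ract_add_left)

lemma fam_in_Z [simp]: "x \<in> carrier HZ \<Longrightarrow> g \<in> carrier G \<Longrightarrow> fam (pd Z) x g \<in> carrier Z"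
  using P.fam_closed by simp

text \<open>Exhibits the counit as a sum over G whose g-th term factors through
  \<open>tw g (pd Z)\<close>; \<open>\<Psi>\<Phi>1\<close> recognizes it in this form.\<close>

lemma counit_eq:
  "x \<in> carrier HZ \<Longrightarrow> counit Z x = (\<Oplus>\<^bsub>Z\<^esub>g\<in>carrier G. act Z g (proj (pd Z) g x))"
  by (simp add: counit_def proj_def)

lemma counit_closed [simp]: "x \<in> carrier HZ \<Longrightarrow> counit Z x \<in> carrier Z"
  by (simp add: counit_def)

text \<open>With a family x read as the sum of x g \<otimes> g, the counit is the action of
  \<open>LG\<close> on Z, and its linearity is associativity of that action. In coordinates the two
  sums are exchanged and k = g \<otimes> l is substituted, using (1 \<otimes> g)(a \<otimes> l) =
  \<beta> g a \<otimes> gl.\<close>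

lemma counit_hom: "counit Z \<in> module_homs LG HZ Z"
proof (rule module_homsI)
  show "counit Z \<in> extensional (carrier HZ)"
    by (simp add: counit_def)
  fix x assume x: "x \<in> carrier HZ"
  then show "counit Z x \<in> carrier Z"
    by simp
  show "counit Z (x \<oplus>\<^bsub>HZ\<^esub> y) = counit Z x \<oplus>\<^bsub>Z\<^esub> counit Z y"
    if y: "y \<in> carrier HZ" for y
  proof -
    have "counit Z (x \<oplus>\<^bsub>HZ\<^esub> y) =
        (\<Oplus>\<^bsub>Z\<^esub>g\<in>carrier G. act Z g (fam (pd Z) x g) \<oplus>\<^bsub>Z\<^esub> act Z g (fam (pd Z) y g))"
      unfolding counit_def using x y
      by (simp add: P.add_closed del: Z.M.finsum_addf)
        (rule Z.M.finsum_eqI, simp_all add: P.fam_add act_add)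
    also have "\<dots> = counit Z x \<oplus>\<^bsub>Z\<^esub> counit Z y"
      using x y by (subst Z.M.finsum_addf) (auto simp: counit_def)
    finally show ?thesis .
  qed
  show "counit Z (x \<diamondop>\<^bsub>HZ\<^esub> b) = counit Z x \<diamondop>\<^bsub>Z\<^esub> b" if b: "b \<in> carrier LG" for b
  proof -
    let ?x = "fam (pd Z) x"
    let ?t = "\<lambda>g k. ?x g \<diamondop>\<^bsub>Z\<^esub> single k (\<beta> g (b (inv g \<otimes> k)))"
    have t: "?t g k \<in> carrier Z" if "g \<in> carrier G" "k \<in> carrier G" for g k
      using that x b by (auto intro!: Z.ract_closed)
    have "counit Z (x \<diamondop>\<^bsub>HZ\<^esub> b) = (\<Oplus>\<^bsub>Z\<^esub>k\<in>carrier G. act Z k (conv (pd Z) ?x b k))"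
      using x b by (simp add: counit_def P.ract_closed P.fam_ract)
    also have "\<dots> = (\<Oplus>\<^bsub>Z\<^esub>k\<in>carrier G. \<Oplus>\<^bsub>Z\<^esub>g\<in>carrier G. ?t g k)"
    proof (rule Z.M.finsum_eqI)
      fix k assume k: "k \<in> carrier G"
      have s: "?x g \<diamondop>\<^bsub>Z\<^esub> skew_embed G L (\<beta> g (b (inv g \<otimes> k))) \<in> carrier Z"
        "?x g \<diamondop>\<^bsub>Z\<^esub> skew_embed G L (\<beta> g (b (inv g \<otimes> k))) \<diamondop>\<^bsub>Z\<^esub> single k \<one>\<^bsub>L\<^esub> = ?t g k"
        if "g \<in> carrier G" for g
        using that x b k
        by (auto simp: Z.ract_closed skew_embed_single single_mult_single simp flip: Z.ract_mult)
      have c: "conv (pd Z) ?x b k =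
          (\<Oplus>\<^bsub>Z\<^esub>g\<in>carrier G. ?x g \<diamondop>\<^bsub>Z\<^esub> skew_embed G L (\<beta> g (b (inv g \<otimes> k))))"
        using k by (simp add: conv_def)
      then have "conv (pd Z) ?x b k \<in> carrier Z"
        using s by (simp add: Z.M.finsum_in)
      then have "act Z k (conv (pd Z) ?x b k) = conv (pd Z) ?x b k \<diamondop>\<^bsub>Z\<^esub> single k \<one>\<^bsub>L\<^esub>"
        by (simp add: act_def)
      also have "\<dots> = (\<Oplus>\<^bsub>Z\<^esub>g\<in>carrier G. ?t g k)"
        unfolding c using s t k by (subst Z.finsum_ract) (auto intro!: Z.M.finsum_eqI)
      finally show "act Z k (conv (pd Z) ?x b k) = (\<Oplus>\<^bsub>Z\<^esub>g\<in>carrier G. ?t g k)" .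
      show "act Z k (conv (pd Z) ?x b k) \<in> carrier Z"
        using \<open>conv (pd Z) ?x b k \<in> carrier Z\<close> by simp
    qed
    also have "\<dots> = (\<Oplus>\<^bsub>Z\<^esub>g\<in>carrier G. \<Oplus>\<^bsub>Z\<^esub>k\<in>carrier G. ?t g k)"
      using t by (intro Z.M.finsum_swap) auto
    also have "\<dots> = (\<Oplus>\<^bsub>Z\<^esub>g\<in>carrier G. act Z g (?x g) \<diamondop>\<^bsub>Z\<^esub> b)"
    proof (rule Z.M.finsum_eqI)
      fix g assume g: "g \<in> carrier G"
      have "act Z g (?x g) \<diamondop>\<^bsub>Z\<^esub> b = (\<Oplus>\<^bsub>Z\<^esub>k\<in>carrier G. act Z g (?x g) \<diamondop>\<^bsub>Z\<^esub> single k (b k))"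
        using x g b by (intro ract_LG_decomp[OF Z.right_module_axioms]) auto
      also have "\<dots> = (\<Oplus>\<^bsub>Z\<^esub>k\<in>carrier G. ?t g (g \<otimes> k))"
        using x g b
        by (intro Z.M.finsum_eqI)
          (auto simp: act_def single_mult_single Z.ract_closed simp flip: Z.ract_mult)
      also have "\<dots> = (\<Oplus>\<^bsub>Z\<^esub>k\<in>carrier G. ?t g k)"
        using t g finsum_shift[OF Z.M.abelian_group_axioms g, of "?t g"] by simp
      finally show "(\<Oplus>\<^bsub>Z\<^esub>k\<in>carrier G. ?t g k) = act Z g (?x g) \<diamondop>\<^bsub>Z\<^esub> b" ..
      show "(\<Oplus>\<^bsub>Z\<^esub>k\<in>carrier G. ?t g k) \<in> carrier Z"
        using t g by (auto intro!: Z.M.finsum_in)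
    qed
    also have "\<dots> = counit Z x \<diamondop>\<^bsub>Z\<^esub> b"
      using x b by (subst Z.finsum_ract[symmetric]) (auto simp: counit_def)
    finally show ?thesis .
  qed
qed

text \<open>The triangle identity for induction as a left adjoint; \<open>incl (pd Z) \<one>\<close>
  is the unit of that adjunction at the restriction of Z.\<close>

lemma counit_incl:
  assumes "z \<in> carrier Z"
  shows "counit Z (incl (pd Z) \<one> z) = z"
proof -
  have zero: "act Z g \<zero>\<^bsub>Z\<^esub> = \<zero>\<^bsub>Z\<^esub>" for g
    by (simp add: act_def)
  have one: "act Z \<one> z = z"
    using assms by (simp add: act_def Z.ract_one flip: skew_embed_single one_LG)
  have "counit Z (incl (pd Z) \<one> z) = (\<Oplus>\<^bsub>Z\<^esub>g\<in>carrier G. if g = \<one> then z else \<zero>\<^bsub>Z\<^esub>)"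
    using assms P.incl_closed[of z]
    by (simp add: counit_def) (rule Z.M.finsum_eqI, simp_all add: P.fam_incl zero one)
  then show ?thesis
    using assms by (simp add: Z.M.finsum_delta)
qed

lemma unit_PiE: "z \<in> carrier Z \<Longrightarrow> (\<lambda>g\<in>carrier G. act Z (inv g) z) \<in> fams (pd Z)"
  by auto

lemma unit_closed: "z \<in> carrier Z \<Longrightarrow> unit Z z \<in> carrier HZ"
  by (simp add: unit_def P.code_closed[OF unit_PiE])

lemma fam_unit: "z \<in> carrier Z \<Longrightarrow> fam (pd Z) (unit Z z) = (\<lambda>g\<in>carrier G. act Z (inv g) z)"
  by (simp add: unit_def P.fam_code[OF unit_PiE])

text \<open>Coordinate k of both sides is the sum over g of z acted on by b (inv g \<otimes> k)
  \<otimes> inv g. On the left it comes from expanding b (1 \<otimes> inv k) and replacing g by its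
  inverse; on the right from moving the coefficients \<beta> g (b (inv g \<otimes> k)) across 1
  \<otimes> inv g.\<close>

lemma unit_hom: "unit Z \<in> module_homs LG Z HZ"
proof (rule module_homsI)
  show "unit Z \<in> extensional (carrier Z)"
    by (simp add: unit_def)
  fix z assume z: "z \<in> carrier Z"
  then show "unit Z z \<in> carrier HZ"
    by (rule unit_closed)
  show "unit Z (z \<oplus>\<^bsub>Z\<^esub> y) = unit Z z \<oplus>\<^bsub>HZ\<^esub> unit Z y" if "y \<in> carrier Z" for y
    using z that by (subst P.induced_eq_iff) (simp_all add: unit_closed P.add_closed P.fam_add fam_unit act_add)
  show "unit Z (z \<diamondop>\<^bsub>Z\<^esub> b) = unit Z z \<diamondop>\<^bsub>HZ\<^esub> b" if b: "b \<in> carrier LG" for b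
  proof (rule P.induced_eqI)
    fix k assume k: "k \<in> carrier G"
    let ?h = "\<lambda>g. z \<diamondop>\<^bsub>Z\<^esub> single g (b (g \<otimes> k))"
    have h: "?h g \<in> carrier Z" if "g \<in> carrier G" for g
      using that z b k by (auto intro!: Z.ract_closed)
    have "fam (pd Z) (unit Z (z \<diamondop>\<^bsub>Z\<^esub> b)) k = z \<diamondop>\<^bsub>Z\<^esub> (b \<otimes>\<^bsub>LG\<^esub> single (inv k) \<one>\<^bsub>L\<^esub>)"
      using z b k by (simp add: fam_unit act_def Z.ract_closed Z.ract_mult)
    also have "\<dots> = (\<Oplus>\<^bsub>Z\<^esub>g\<in>carrier G. ?h g)"
      using z b k
      by (subst ract_LG_decomp[OF Z.right_module_axioms])
        (auto simp: mult_LG_closed mult_LG_single intro!: Z.M.finsum_eqI Z.ract_closed)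
    also have "\<dots> = (\<Oplus>\<^bsub>Z\<^esub>g\<in>carrier G. ?h (inv g))"
      using finsum_inverse[OF Z.M.abelian_group_axioms, of ?h] h by simp
    also have "\<dots> = (\<Oplus>\<^bsub>Z\<^esub>g\<in>carrier G.
        fam (pd Z) (unit Z z) g \<diamondop>\<^bsub>Z\<^esub> skew_embed G L (\<beta> g (b (inv g \<otimes> k))))"
      using z b k
      by (intro Z.M.finsum_eqI)
        (auto simp: fam_unit act_def skew_embed_single single_mult_single Z.ract_closed simp flip: Z.ract_mult)
    also have "\<dots> = fam (pd Z) (unit Z z \<diamondop>\<^bsub>HZ\<^esub> b) k"
      using z b k by (simp add: P.fam_ract unit_closed conv_def)
    finally show "fam (pd Z) (unit Z (z \<diamondop>\<^bsub>Z\<^esub> b)) k = fam (pd Z) (unit Z z \<diamondop>\<^bsub>HZ\<^esub> b) k" .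
  qed (use z b in \<open>simp_all add: unit_closed P.ract_closed Z.ract_closed\<close>)
qed

text \<open>The analogue of \<open>counit_eq\<close>: the g-th term passes from \<open>pd Z\<close>
  to \<open>tw g (pd Z)\<close> and from there into the induced module.\<close>

lemma unit_eq:
  assumes z: "z \<in> carrier Z"
  shows "unit Z z = (\<Oplus>\<^bsub>HZ\<^esub>g\<in>carrier G. incl (pd Z) g (act Z (inv g) z))"
proof (rule P.induced_eqI)
  have incl: "incl (pd Z) g (act Z (inv g) z) \<in> carrier HZ" for g
    using z by (simp add: P.incl_closed)
  then show "(\<Oplus>\<^bsub>HZ\<^esub>g\<in>carrier G. incl (pd Z) g (act Z (inv g) z)) \<in> carrier HZ"
    by (intro P.HM.M.finsum_in)
  fix k assume k: "k \<in> carrier G"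
  have "fam (pd Z) (\<Oplus>\<^bsub>HZ\<^esub>g\<in>carrier G. incl (pd Z) g (act Z (inv g) z)) k
      = (\<Oplus>\<^bsub>Z\<^esub>g\<in>carrier G. if k = g then act Z (inv k) z else \<zero>\<^bsub>Z\<^esub>)"
    using incl k z by (simp add: P.fam_finsum) (rule Z.M.finsum_eqI, simp_all add: P.fam_incl)
  then show "fam (pd Z) (unit Z z) k =
      fam (pd Z) (\<Oplus>\<^bsub>HZ\<^esub>g\<in>carrier G. incl (pd Z) g (act Z (inv g) z)) k"
    using z k by (simp add: Z.M.finsum_delta fam_unit)
qed (rule unit_closed[OF z])

text \<open>The triangle identity for induction as a right adjoint, whose counit is the projection
  to the summand at \<one>.\<close>

lemma proj_unit: "z \<in> carrier Z \<Longrightarrow> proj (pd Z) \<one> (unit Z z) = z"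
  by (simp add: proj_def unit_closed fam_unit act_def Z.ract_one flip: skew_embed_single one_LG)

end

section \<open>Spaces of natural transformations\<close>

text \<open>Just enough for natural transformations to form a vector space and to be composed. It
  passes at once from T to its twists and to \<phi>(T), while the composition law and the
  finite-dimensional values stay with T itself.\<close>

definition linear_functor :: "'k ring \<Rightarrow> ('k, 'a) module \<Rightarrow> ('a, 'u, 'k, 'w) modfun \<Rightarrow> bool" where
  "linear_functor K A T \<longleftrightarrow> (\<forall>M\<in>fg_modules A. module K (fobj T M)) \<and>
     (\<forall>M\<in>fg_modules A. \<forall>N\<in>fg_modules A. \<forall>f\<in>module_homs A M N.
        fmap T M N f \<in> linear_maps K (fobj T N) (fobj T M))"

lemma linear_functorD:
  assumes "linear_functor K A T"
  shows "M \<in> fg_modules A \<Longrightarrow> module K (fobj T M)"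
    and "M \<in> fg_modules A \<Longrightarrow> N \<in> fg_modules A \<Longrightarrow> f \<in> module_homs A M N \<Longrightarrow>
      fmap T M N f \<in> linear_maps K (fobj T N) (fobj T M)"
  using assms by (auto simp: linear_functor_def)

lemma module_homs_add:
  assumes "right_module A M" "right_module A N" "f \<in> module_homs A M N" "h \<in> module_homs A M N"
  shows "(\<lambda>x\<in>carrier M. f x \<oplus>\<^bsub>N\<^esub> h x) \<in> module_homs A M N"
proof -
  interpret M: right_module A M by fact
  interpret N: right_module A N by fact
  show ?thesis
    by (intro module_homsI)
      (auto simp: module_homsD[OF assms(3)] module_homsD[OF assms(4)] N.M.a_ac N.ract_add_left M.ract_closed)
qed

locale contravariant_functor =
  fixes K :: "'k ring" and A :: "('k, 'a) module" and T :: "('a, 'u, 'k, 'w) modfun"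
  assumes in_all_functors: "T \<in> all_functors K A"
begin

lemma fobj_module: "M \<in> fg_modules A \<Longrightarrow> module K (fobj T M)"
  using in_all_functors by (simp add: all_functors_def)

lemma fmap_linear_map:
  assumes "M \<in> fg_modules A" "N \<in> fg_modules A"
  shows "restrict (fmap T M N) (module_homs A M N)
    \<in> linear_maps K (hom_space A M N) (linear_map_space K (fobj T N) (fobj T M))"
  using in_all_functors assms by (simp add: all_functors_def)

lemma fmap_linear:
  assumes "M \<in> fg_modules A" "N \<in> fg_modules A" "f \<in> module_homs A M N"
  shows "fmap T M N f \<in> linear_maps K (fobj T N) (fobj T M)"
  using linear_mapsD(1)[OF fmap_linear_map[OF assms(1,2)], of f] assms(3)
  by (simp add: hom_space_def linear_map_space_def)

lemma fmap_closed [simp]: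
  "M \<in> fg_modules A \<Longrightarrow> N \<in> fg_modules A \<Longrightarrow> f \<in> module_homs A M N \<Longrightarrow> x \<in> carrier (fobj T N) \<Longrightarrow>
    fmap T M N f x \<in> carrier (fobj T M)"
  by (rule linear_mapsD(1)[OF fmap_linear])

lemma linear_functor: "linear_functor K A T"
  by (simp add: linear_functor_def fobj_module fmap_linear)

lemma fmap_id:
  "M \<in> fg_modules A \<Longrightarrow> x \<in> carrier (fobj T M) \<Longrightarrow> fmap T M M (\<lambda>x\<in>carrier M. x) x = x"
  using in_all_functors by (simp add: all_functors_def)

lemma fmap_comp:
  assumes "L \<in> fg_modules A" "M \<in> fg_modules A" "N \<in> fg_modules A"
    and "f \<in> module_homs A L M" "h \<in> module_homs A M N" "x \<in> carrier (fobj T N)"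
  shows "fmap T L M f (fmap T M N h x) = fmap T L N (compose (carrier L) h f) x"
  using in_all_functors assms by (simp add: all_functors_def compose_def)

lemma fmap_add:
  assumes M: "M \<in> fg_modules A" and N: "N \<in> fg_modules A"
    and f: "f \<in> module_homs A M N" and h: "h \<in> module_homs A M N" and x: "x \<in> carrier (fobj T N)"
  shows "fmap T M N (\<lambda>x\<in>carrier M. f x \<oplus>\<^bsub>N\<^esub> h x) x = fmap T M N f x \<oplus>\<^bsub>fobj T M\<^esub> fmap T M N h x"
  using linear_mapsD(2)[OF fmap_linear_map[OF M N], of f h] f h x
    module_homs_add[OF fg_modules_right_module[OF M] fg_modules_right_module[OF N] f h]
  by (simp add: hom_space_def linear_map_space_def)

lemma fmap_zero:
  assumes M: "M \<in> fg_modules A" and N: "N \<in> fg_modules A" and x: "x \<in> carrier (fobj T N)"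
  shows "fmap T M N (\<lambda>x\<in>carrier M. \<zero>\<^bsub>N\<^esub>) x = \<zero>\<^bsub>fobj T M\<^esub>"
proof -
  interpret M: right_module A M using M by (rule fg_modules_right_module)
  interpret N: right_module A N using N by (rule fg_modules_right_module)
  interpret TM: module K "fobj T M" using M by (rule fobj_module)
  let ?z = "\<lambda>x\<in>carrier M. \<zero>\<^bsub>N\<^esub>"
  have z: "?z \<in> module_homs A M N"
    by (intro module_homsI) (auto simp: M.ract_closed)
  have "(\<lambda>x\<in>carrier M. ?z x \<oplus>\<^bsub>N\<^esub> ?z x) = ?z"
    by (intro restrict_ext) simp
  then show ?thesis
    using fmap_add[OF M N z z x] M N x z TM.add.r_cancel_one[of "fmap T M N ?z x" "fmap T M N ?z x"] by simp
qed

text \<open>The use of linearity of a functor on homomorphisms: a counit or unit, being a sum over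
  G, is carried to the sum of the maps induced by its terms.\<close>

lemma fmap_finsum:
  assumes M: "M \<in> fg_modules A" and N: "N \<in> fg_modules A" and J: "finite J"
    and f: "\<And>i. i \<in> J \<Longrightarrow> f i \<in> module_homs A M N" and x: "x \<in> carrier (fobj T N)"
  shows "fmap T M N (\<lambda>x\<in>carrier M. \<Oplus>\<^bsub>N\<^esub>i\<in>J. f i x) x = (\<Oplus>\<^bsub>fobj T M\<^esub>i\<in>J. fmap T M N (f i) x)"
proof -
  interpret M: right_module A M using M by (rule fg_modules_right_module)
  interpret N: right_module A N using N by (rule fg_modules_right_module)
  interpret TM: module K "fobj T M" using M by (rule fobj_module)
  \<comment> \<open>That the partial sums are homomorphisms is carried through the same induction,
    because \<open>fmap_add\<close> asks for it at each step.\<close>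
  have "(\<lambda>x\<in>carrier M. \<Oplus>\<^bsub>N\<^esub>i\<in>J. f i x) \<in> module_homs A M N \<and>
      fmap T M N (\<lambda>x\<in>carrier M. \<Oplus>\<^bsub>N\<^esub>i\<in>J. f i x) x = (\<Oplus>\<^bsub>fobj T M\<^esub>i\<in>J. fmap T M N (f i) x)"
    using J f
  proof (induction J)
    case empty
    have "(\<lambda>x\<in>carrier M. \<zero>\<^bsub>N\<^esub>) \<in> module_homs A M N"
      by (intro module_homsI) (auto simp: M.ract_closed)
    then show ?case
      unfolding N.M.finsum_empty TM.finsum_empty using fmap_zero[OF M N x] by (rule conjI)
  next
    case (insert i J)
    let ?s = "\<lambda>x\<in>carrier M. \<Oplus>\<^bsub>N\<^esub>i\<in>J. f i x"
    note IH = insert.IH[OF insert.prems[OF insertI2]]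
    have s: "?s \<in> module_homs A M N" "f i \<in> module_homs A M N"
      using conjunct1[OF IH] insert.prems[OF insertI1] by blast+
    have "(\<Oplus>\<^bsub>N\<^esub>i\<in>insert i J. f i y) = f i y \<oplus>\<^bsub>N\<^esub> ?s y" if y: "y \<in> carrier M" for y
      using insert.hyps y module_homsD(1)[OF insert.prems y] by (subst N.M.finsum_insert) auto
    then have sum: "(\<lambda>x\<in>carrier M. \<Oplus>\<^bsub>N\<^esub>i\<in>insert i J. f i x) = (\<lambda>x\<in>carrier M. f i x \<oplus>\<^bsub>N\<^esub> ?s x)"
      by (rule restrict_ext)
    have sum': "(\<Oplus>\<^bsub>fobj T M\<^esub>i\<in>insert i J. fmap T M N (f i) x) =
        fmap T M N (f i) x \<oplus>\<^bsub>fobj T M\<^esub> (\<Oplus>\<^bsub>fobj T M\<^esub>i\<in>J. fmap T M N (f i) x)"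
      using insert M N x by (intro TM.finsum_insert) auto
    show ?case
      unfolding sum sum'
      by (rule conjI[OF module_homs_add[OF M.right_module_axioms N.right_module_axioms s(2,1)]])
        (simp only: fmap_add[OF M N s(2,1) x] conjunct2[OF IH])
  qed
  then show ?thesis ..
qed

end

lemma nat_transD:
  assumes "\<iota> \<in> nat_trans K A T S" "M \<in> fg_modules A"
  shows "\<iota> M \<in> linear_maps K (fobj T M) (fobj S M)"
    and "x \<in> carrier (fobj T M) \<Longrightarrow> \<iota> M x \<in> carrier (fobj S M)"
    and "N \<in> fg_modules A \<Longrightarrow> f \<in> module_homs A M N \<Longrightarrow> x \<in> carrier (fobj T N) \<Longrightarrow>
      \<iota> M (fmap T M N f x) = fmap S M N f (\<iota> N x)"
proof -
  show *: "\<iota> M \<in> linear_maps K (fobj T M) (fobj S M)"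
    using assms by (auto simp: nat_trans_def)
  then show "x \<in> carrier (fobj T M) \<Longrightarrow> \<iota> M x \<in> carrier (fobj S M)"
    by (rule linear_mapsD)
  assume x: "N \<in> fg_modules A" "f \<in> module_homs A M N" "x \<in> carrier (fobj T N)"
  then have "compose (carrier (fobj T N)) (\<iota> M) (fmap T M N f) = compose (carrier (fobj T N)) (fmap S M N f) (\<iota> N)"
    using assms by (simp add: nat_trans_def)
  then show "\<iota> M (fmap T M N f x) = fmap S M N f (\<iota> N x)"
    using x(3) by (metis compose_eq)
qed

lemma nat_transI:
  assumes "\<And>M. M \<in> fg_modules A \<Longrightarrow> \<iota> M \<in> linear_maps K (fobj T M) (fobj S M)"
    and "\<iota> \<in> extensional (fg_modules A)"
    and "\<And>M N f x. M \<in> fg_modules A \<Longrightarrow> N \<in> fg_modules A \<Longrightarrow> f \<in> module_homs A M N \<Longrightarrow>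
      x \<in> carrier (fobj T N) \<Longrightarrow> \<iota> M (fmap T M N f x) = fmap S M N f (\<iota> N x)"
  shows "\<iota> \<in> nat_trans K A T S"
  using assms by (auto simp: nat_trans_def PiE_def compose_def intro!: restrict_ext)

lemma nat_trans_eqI:
  fixes T :: "('a, 'u, 'k, 'w) modfun"
  assumes "\<iota> \<in> nat_trans K A T S" "\<kappa> \<in> nat_trans K A T S"
    and "\<And>M x. M \<in> fg_modules A \<Longrightarrow> x \<in> carrier (fobj T M) \<Longrightarrow> \<iota> M x = \<kappa> M x"
  shows "\<iota> = \<kappa>"
proof (rule extensionalityI[where A = "fg_modules A"])
  fix M :: "('a, 'u) rmodule" assume M: "M \<in> fg_modules A"
  show "\<iota> M = \<kappa> M"
    using M assms nat_transD(1)[THEN linear_mapsD(4)]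
    by (intro extensionalityI[where A = "carrier (fobj T M)"]) blast+
qed (use assms in \<open>auto simp: nat_trans_def PiE_def\<close>)

lemma carrier_nat_space [simp]: "carrier (nat_space K A T S) = nat_trans K A T S"
  by (simp add: nat_space_def)

lemma nat_space_ops:
  "\<zero>\<^bsub>nat_space K A T S\<^esub> = (\<lambda>M\<in>fg_modules A. \<lambda>x\<in>carrier (fobj T M). \<zero>\<^bsub>fobj S M\<^esub>)"
  "\<iota> \<oplus>\<^bsub>nat_space K A T S\<^esub> \<kappa> = (\<lambda>M\<in>fg_modules A. \<lambda>x\<in>carrier (fobj T M). \<iota> M x \<oplus>\<^bsub>fobj S M\<^esub> \<kappa> M x)"
  "c \<odot>\<^bsub>nat_space K A T S\<^esub> \<iota> = (\<lambda>M\<in>fg_modules A. \<lambda>x\<in>carrier (fobj T M). c \<odot>\<^bsub>fobj S M\<^esub> \<iota> M x)"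
  by (simp_all add: nat_space_def)

lemma nat_space_apply [simp]:
  assumes "M \<in> fg_modules A" "x \<in> carrier (fobj T M)"
  shows "\<zero>\<^bsub>nat_space K A T S\<^esub> M x = \<zero>\<^bsub>fobj S M\<^esub>"
    and "(\<iota> \<oplus>\<^bsub>nat_space K A T S\<^esub> \<kappa>) M x = \<iota> M x \<oplus>\<^bsub>fobj S M\<^esub> \<kappa> M x"
    and "(c \<odot>\<^bsub>nat_space K A T S\<^esub> \<iota>) M x = c \<odot>\<^bsub>fobj S M\<^esub> \<iota> M x"
  using assms by (simp_all add: nat_space_ops)

lemma linear_mapsI:
  assumes "\<And>x. x \<in> carrier V \<Longrightarrow> f x \<in> carrier W" "f \<in> extensional (carrier V)"
    and "\<And>x y. x \<in> carrier V \<Longrightarrow> y \<in> carrier V \<Longrightarrow> f (x \<oplus>\<^bsub>V\<^esub> y) = f x \<oplus>\<^bsub>W\<^esub> f y"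
    and "\<And>c x. c \<in> carrier K \<Longrightarrow> x \<in> carrier V \<Longrightarrow> f (c \<odot>\<^bsub>V\<^esub> x) = c \<odot>\<^bsub>W\<^esub> f x"
  shows "f \<in> linear_maps K V W"
  using assms by (auto simp: linear_maps_def PiE_def)

lemma linear_maps_zero:
  assumes "module K V" "module K W" "f \<in> linear_maps K V W"
  shows "f \<zero>\<^bsub>V\<^esub> = \<zero>\<^bsub>W\<^esub>"
  using assms by (intro additive_zero) (auto simp: module_def linear_mapsD)

context
  fixes K :: "'k ring" and A :: "('k, 'a) module"
    and T :: "('a, 'u, 'k, 'w) modfun" and S :: "('a, 'u, 'k, 'x) modfun"
  assumes T: "linear_functor K A T" and S: "linear_functor K A S"
begin

private abbreviation (input) V where "V \<equiv> nat_space K A T S"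

lemma zero_nat_trans: "\<zero>\<^bsub>V\<^esub> \<in> nat_trans K A T S"
proof (rule nat_transI)
  fix M :: "('a, 'u) rmodule" assume M: "M \<in> fg_modules A"
  interpret TM: module K "fobj T M" using linear_functorD(1)[OF T M] .
  interpret SM: module K "fobj S M" using linear_functorD(1)[OF S M] .
  show "\<zero>\<^bsub>V\<^esub> M \<in> linear_maps K (fobj T M) (fobj S M)"
    using M by (auto intro!: linear_mapsI) (simp add: nat_space_ops)
  fix N :: "('a, 'u) rmodule" and f x
  assume N: "N \<in> fg_modules A" and f: "f \<in> module_homs A M N" and x: "x \<in> carrier (fobj T N)"
  have "fmap S M N f \<zero>\<^bsub>fobj S N\<^esub> = \<zero>\<^bsub>fobj S M\<^esub>"
    using linear_functorD[OF S] M N f by (intro linear_maps_zero[where K = K]) auto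
  then show "\<zero>\<^bsub>V\<^esub> M (fmap T M N f x) = fmap S M N f (\<zero>\<^bsub>V\<^esub> N x)"
    using M N x linear_mapsD(1)[OF linear_functorD(2)[OF T M N f] x] by simp
qed (simp add: nat_space_ops)

lemma add_nat_trans:
  assumes \<iota>: "\<iota> \<in> nat_trans K A T S" and \<kappa>: "\<kappa> \<in> nat_trans K A T S"
  shows "\<iota> \<oplus>\<^bsub>V\<^esub> \<kappa> \<in> nat_trans K A T S"
proof (rule nat_transI)
  fix M :: "('a, 'u) rmodule" assume M: "M \<in> fg_modules A"
  interpret TM: module K "fobj T M" using linear_functorD(1)[OF T M] .
  interpret SM: module K "fobj S M" using linear_functorD(1)[OF S M] .
  note facts = linear_mapsD(1-3)[OF nat_transD(1)[OF \<iota> M]] linear_mapsD(1-3)[OF nat_transD(1)[OF \<kappa> M]]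
  show "(\<iota> \<oplus>\<^bsub>V\<^esub> \<kappa>) M \<in> linear_maps K (fobj T M) (fobj S M)"
    using M by (intro linear_mapsI) (simp_all add: facts SM.a_ac SM.smult_r_distr, simp add: nat_space_ops)
  fix N :: "('a, 'u) rmodule" and f x
  assume N: "N \<in> fg_modules A" and f: "f \<in> module_homs A M N" and x: "x \<in> carrier (fobj T N)"
  show "(\<iota> \<oplus>\<^bsub>V\<^esub> \<kappa>) M (fmap T M N f x) = fmap S M N f ((\<iota> \<oplus>\<^bsub>V\<^esub> \<kappa>) N x)"
    using M N f x linear_mapsD(1)[OF linear_functorD(2)[OF T M N f] x]
    by (simp add: linear_mapsD(2)[OF linear_functorD(2)[OF S M N f]] nat_transD(2,3)[OF \<iota>] nat_transD(2,3)[OF \<kappa>])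
qed (simp add: nat_space_ops)

lemma smult_nat_trans:
  assumes c: "c \<in> carrier K" and \<iota>: "\<iota> \<in> nat_trans K A T S"
  shows "c \<odot>\<^bsub>V\<^esub> \<iota> \<in> nat_trans K A T S"
proof (rule nat_transI)
  fix M :: "('a, 'u) rmodule" assume M: "M \<in> fg_modules A"
  interpret TM: module K "fobj T M" using linear_functorD(1)[OF T M] .
  interpret SM: module K "fobj S M" using linear_functorD(1)[OF S M] .
  have comm: "c \<odot>\<^bsub>fobj S M\<^esub> (d \<odot>\<^bsub>fobj S M\<^esub> y) = d \<odot>\<^bsub>fobj S M\<^esub> (c \<odot>\<^bsub>fobj S M\<^esub> y)"
    if "d \<in> carrier K" "y \<in> carrier (fobj S M)" for d y
    using c that by (simp add: TM.m_comm flip: SM.smult_assoc1)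
  note facts = linear_mapsD(1-3)[OF nat_transD(1)[OF \<iota> M]]
  show "(c \<odot>\<^bsub>V\<^esub> \<iota>) M \<in> linear_maps K (fobj T M) (fobj S M)"
    using M c by (intro linear_mapsI) (simp_all add: facts SM.smult_r_distr comm, simp add: nat_space_ops)
  fix N :: "('a, 'u) rmodule" and f x
  assume N: "N \<in> fg_modules A" and f: "f \<in> module_homs A M N" and x: "x \<in> carrier (fobj T N)"
  show "(c \<odot>\<^bsub>V\<^esub> \<iota>) M (fmap T M N f x) = fmap S M N f ((c \<odot>\<^bsub>V\<^esub> \<iota>) N x)"
    using M N f x c linear_mapsD(1)[OF linear_functorD(2)[OF T M N f] x]
    by (simp add: linear_mapsD(3)[OF linear_functorD(2)[OF S M N f]] nat_transD(2,3)[OF \<iota>])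
qed (simp add: nat_space_ops)

lemma nat_space_module:
  assumes K: "cring K"
  shows "module K (V)"
proof -
  note S_module = linear_functorD(1)[OF S]
  note S_monoid = S_module[THEN module.axioms(2), THEN abelian_group.axioms(1)]
  note facts = nat_transD(2) zero_nat_trans add_nat_trans smult_nat_trans
  note eqI = nat_trans_eqI[of _ K A T S]
  interpret K: cring K by fact
  show ?thesis
  proof (rule moduleI[OF K])
    show "abelian_group (V)"
    proof (rule abelian_groupI)
      fix \<iota> assume \<iota>: "\<iota> \<in> carrier (V)"
      show "\<zero>\<^bsub>V\<^esub> \<oplus>\<^bsub>V\<^esub> \<iota> = \<iota>"
        using \<iota> by (intro eqI) (simp_all add: facts abelian_monoid.l_zero[OF S_monoid])
      \<comment> \<open>With the negative taken as a scalar multiple, its naturality is already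
        known from \<open>smult_nat_trans\<close>.\<close>
      let ?\<kappa> = "(\<ominus>\<^bsub>K\<^esub> \<one>\<^bsub>K\<^esub>) \<odot>\<^bsub>V\<^esub> \<iota>"
      have "?\<kappa> \<oplus>\<^bsub>V\<^esub> \<iota> = \<zero>\<^bsub>V\<^esub>"
      proof (rule eqI)
        fix M :: "('a, 'u) rmodule" and x assume M: "M \<in> fg_modules A" and x: "x \<in> carrier (fobj T M)"
        interpret SM: module K "fobj S M" using S_module[OF M] .
        have "\<iota> M x \<in> carrier (fobj S M)"
          using \<iota> M x by (simp add: facts)
        then show "(?\<kappa> \<oplus>\<^bsub>V\<^esub> \<iota>) M x = \<zero>\<^bsub>V\<^esub> M x"
          using M x by (simp add: SM.smult_l_minus SM.M.l_neg)
      qed (use \<iota> in \<open>simp_all add: facts\<close>)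
      then show "\<exists>\<kappa>\<in>carrier (V). \<kappa> \<oplus>\<^bsub>V\<^esub> \<iota> = \<zero>\<^bsub>V\<^esub>"
        using \<iota> by (intro bexI[of _ ?\<kappa>]) (simp_all add: facts)
      fix \<kappa> assume \<kappa>: "\<kappa> \<in> carrier (V)"
      show "\<iota> \<oplus>\<^bsub>V\<^esub> \<kappa> \<in> carrier (V)"
        using \<iota> \<kappa> by (simp add: facts)
      show "\<iota> \<oplus>\<^bsub>V\<^esub> \<kappa> = \<kappa> \<oplus>\<^bsub>V\<^esub> \<iota>"
        using \<iota> \<kappa> by (intro eqI) (simp_all add: facts abelian_monoid.a_comm[OF S_monoid])
      fix \<mu> assume \<mu>: "\<mu> \<in> carrier (V)"
      show "\<iota> \<oplus>\<^bsub>V\<^esub> \<kappa> \<oplus>\<^bsub>V\<^esub> \<mu> = \<iota> \<oplus>\<^bsub>V\<^esub> (\<kappa> \<oplus>\<^bsub>V\<^esub> \<mu>)"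
        using \<iota> \<kappa> \<mu> by (intro eqI) (simp_all add: facts abelian_monoid.a_assoc[OF S_monoid])
    qed (simp add: facts)
  next
    fix c \<iota> assume c: "c \<in> carrier K" and \<iota>: "\<iota> \<in> carrier (V)"
    show "c \<odot>\<^bsub>V\<^esub> \<iota> \<in> carrier (V)"
      using c \<iota> by (simp add: facts)
    show "(c \<oplus>\<^bsub>K\<^esub> d) \<odot>\<^bsub>V\<^esub> \<iota> =
        c \<odot>\<^bsub>V\<^esub> \<iota> \<oplus>\<^bsub>V\<^esub> d \<odot>\<^bsub>V\<^esub> \<iota>"
      if d: "d \<in> carrier K" for d
      using c d \<iota> by (intro eqI) (simp_all add: facts module.smult_l_distr[OF S_module])
    show "c \<odot>\<^bsub>V\<^esub> (\<iota> \<oplus>\<^bsub>V\<^esub> \<kappa>) =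
        c \<odot>\<^bsub>V\<^esub> \<iota> \<oplus>\<^bsub>V\<^esub> c \<odot>\<^bsub>V\<^esub> \<kappa>"
      if \<kappa>: "\<kappa> \<in> carrier (V)" for \<kappa>
      using c \<iota> \<kappa> by (intro eqI) (simp_all add: facts module.smult_r_distr[OF S_module])
    show "(c \<otimes>\<^bsub>K\<^esub> d) \<odot>\<^bsub>V\<^esub> \<iota> = c \<odot>\<^bsub>V\<^esub> (d \<odot>\<^bsub>V\<^esub> \<iota>)"
      if d: "d \<in> carrier K" for d
      using c d \<iota> by (intro eqI) (simp_all add: facts module.smult_assoc1[OF S_module])
  next
    fix \<iota> assume \<iota>: "\<iota> \<in> carrier (V)"
    show "\<one>\<^bsub>K\<^esub> \<odot>\<^bsub>V\<^esub> \<iota> = \<iota>"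
      using \<iota> by (intro eqI) (simp_all add: facts module.smult_one[OF S_module])
  qed
qed

lemma finsum_nat_space:
  assumes K: "cring K" and J: "finite J" and \<iota>: "\<And>i. i \<in> J \<Longrightarrow> \<iota> i \<in> nat_trans K A T S"
    and M: "M \<in> fg_modules A" and x: "x \<in> carrier (fobj T M)"
  shows "(\<Oplus>\<^bsub>V\<^esub>i\<in>J. \<iota> i) M x = (\<Oplus>\<^bsub>fobj S M\<^esub>i\<in>J. \<iota> i M x)"
  using J \<iota> M x nat_space_module[OF K] linear_functorD(1)[OF S M]
  by (intro additive_finsum[where f = "\<lambda>\<iota>. \<iota> M x"]) (auto simp: nat_transD module_def)

end

section \<open>Composition and inversion of natural transformations\<close>

lemma nat_comp_apply:
  "M \<in> fg_modules A \<Longrightarrow> x \<in> carrier (fobj T M) \<Longrightarrow> nat_comp A T \<kappa> \<iota> M x = \<kappa> M (\<iota> M x)"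
  by (simp add: nat_comp_def compose_def)

lemma nat_comp_closed:
  fixes T :: "('a, 'u, 'k, 'w) modfun"
  assumes T: "linear_functor K A T" and \<iota>: "\<iota> \<in> nat_trans K A T S" and \<kappa>: "\<kappa> \<in> nat_trans K A S R"
  shows "nat_comp A T \<kappa> \<iota> \<in> nat_trans K A T R"
proof (rule nat_transI)
  fix M :: "('a, 'u) rmodule" assume M: "M \<in> fg_modules A"
  interpret TM: module K "fobj T M" using linear_functorD(1)[OF T M] .
  show "nat_comp A T \<kappa> \<iota> M \<in> linear_maps K (fobj T M) (fobj R M)"
    using M linear_mapsD[OF nat_transD(1)[OF \<iota> M]] linear_mapsD[OF nat_transD(1)[OF \<kappa> M]]
    by (intro linear_mapsI) (auto simp: nat_comp_apply, simp add: nat_comp_def compose_def)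
  fix N :: "('a, 'u) rmodule" and f x
  assume N: "N \<in> fg_modules A" and f: "f \<in> module_homs A M N" and x: "x \<in> carrier (fobj T N)"
  show "nat_comp A T \<kappa> \<iota> M (fmap T M N f x) = fmap R M N f (nat_comp A T \<kappa> \<iota> N x)"
    using M N f x linear_mapsD(1)[OF linear_functorD(2)[OF T M N f] x]
    by (simp add: nat_comp_apply nat_transD[OF \<iota>] nat_transD[OF \<kappa>])
qed (simp add: nat_comp_def)

lemma nat_comp_add_left:
  assumes T: "linear_functor K A T" and S: "linear_functor K A S" and R: "linear_functor K A R"
    and \<iota>: "\<iota> \<in> nat_trans K A T S" and \<kappa>: "\<kappa> \<in> nat_trans K A S R" "\<kappa>' \<in> nat_trans K A S R"
  shows "nat_comp A T (\<kappa> \<oplus>\<^bsub>nat_space K A S R\<^esub> \<kappa>') \<iota> =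
    nat_comp A T \<kappa> \<iota> \<oplus>\<^bsub>nat_space K A T R\<^esub> nat_comp A T \<kappa>' \<iota>"
  using nat_comp_closed[OF T \<iota> add_nat_trans[OF S R \<kappa>]]
    add_nat_trans[OF T R nat_comp_closed[OF T \<iota> \<kappa>(1)] nat_comp_closed[OF T \<iota> \<kappa>(2)]]
  by (intro nat_trans_eqI[of _ K A T R]) (auto simp: nat_comp_apply nat_transD[OF \<iota>])

lemma nat_comp_smult_left:
  assumes T: "linear_functor K A T" and S: "linear_functor K A S" and R: "linear_functor K A R"
    and \<iota>: "\<iota> \<in> nat_trans K A T S" and \<kappa>: "\<kappa> \<in> nat_trans K A S R" and c: "c \<in> carrier K"
  shows "nat_comp A T (c \<odot>\<^bsub>nat_space K A S R\<^esub> \<kappa>) \<iota> = c \<odot>\<^bsub>nat_space K A T R\<^esub> nat_comp A T \<kappa> \<iota>"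
  using nat_comp_closed[OF T \<iota> smult_nat_trans[OF S R c \<kappa>]]
    smult_nat_trans[OF T R c nat_comp_closed[OF T \<iota> \<kappa>]]
  by (intro nat_trans_eqI[of _ K A T R]) (auto simp: nat_comp_apply nat_transD[OF \<iota>])

lemma nat_comp_add_right:
  assumes T: "linear_functor K A T" and S: "linear_functor K A S" and R: "linear_functor K A R"
    and \<iota>: "\<iota> \<in> nat_trans K A T S" "\<iota>' \<in> nat_trans K A T S" and \<kappa>: "\<kappa> \<in> nat_trans K A S R"
  shows "nat_comp A T \<kappa> (\<iota> \<oplus>\<^bsub>nat_space K A T S\<^esub> \<iota>') =
    nat_comp A T \<kappa> \<iota> \<oplus>\<^bsub>nat_space K A T R\<^esub> nat_comp A T \<kappa> \<iota>'"
  using nat_comp_closed[OF T add_nat_trans[OF T S \<iota>] \<kappa>]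
    add_nat_trans[OF T R nat_comp_closed[OF T \<iota>(1) \<kappa>] nat_comp_closed[OF T \<iota>(2) \<kappa>]]
  by (intro nat_trans_eqI[of _ K A T R])
    (auto simp: nat_comp_apply nat_transD[OF \<iota>(1)] nat_transD[OF \<iota>(2)] linear_mapsD(2)[OF nat_transD(1)[OF \<kappa>]])

lemma nat_comp_smult_right:
  assumes T: "linear_functor K A T" and S: "linear_functor K A S" and R: "linear_functor K A R"
    and \<iota>: "\<iota> \<in> nat_trans K A T S" and \<kappa>: "\<kappa> \<in> nat_trans K A S R" and c: "c \<in> carrier K"
  shows "nat_comp A T \<kappa> (c \<odot>\<^bsub>nat_space K A T S\<^esub> \<iota>) = c \<odot>\<^bsub>nat_space K A T R\<^esub> nat_comp A T \<kappa> \<iota>"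
  using nat_comp_closed[OF T smult_nat_trans[OF T S c \<iota>] \<kappa>]
    smult_nat_trans[OF T R c nat_comp_closed[OF T \<iota> \<kappa>]]
  by (intro nat_trans_eqI[of _ K A T R])
    (auto simp: nat_comp_apply nat_transD[OF \<iota>] c linear_mapsD(3)[OF nat_transD(1)[OF \<kappa>]])

lemma nat_comp_assoc:
  assumes "linear_functor K A T" "linear_functor K A S"
    and "\<iota> \<in> nat_trans K A T S" "\<kappa> \<in> nat_trans K A S R" "\<mu> \<in> nat_trans K A R P"
  shows "nat_comp A T (nat_comp A S \<mu> \<kappa>) \<iota> = nat_comp A T \<mu> (nat_comp A T \<kappa> \<iota>)"
  using assms nat_comp_closed[OF assms(1,3) nat_comp_closed[OF assms(2,4,5)]]
    nat_comp_closed[OF assms(1) nat_comp_closed[OF assms(1,3,4)] assms(5)]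
  by (intro nat_trans_eqI[of _ K A T P]) (auto simp: nat_comp_apply nat_transD)

lemma nat_isosD: "\<theta> \<in> nat_isos K A T S \<Longrightarrow> \<theta> \<in> nat_trans K A T S"
  by (simp add: nat_isos_def)

lemma nat_isosI:
  assumes "\<theta> \<in> nat_trans K A T S"
    and "\<And>M. M \<in> fg_modules A \<Longrightarrow> bij_betw (\<theta> M) (carrier (fobj T M)) (carrier (fobj S M))"
  shows "\<theta> \<in> nat_isos K A T S"
  using assms by (simp add: nat_isos_def)

lemma nat_comp_iso:
  fixes T :: "('a, 'u, 'k, 'w) modfun"
  assumes "linear_functor K A T" "\<iota> \<in> nat_isos K A T S" "\<kappa> \<in> nat_isos K A S R"
  shows "nat_comp A T \<kappa> \<iota> \<in> nat_isos K A T R"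
proof (rule nat_isosI)
  show "nat_comp A T \<kappa> \<iota> \<in> nat_trans K A T R"
    using assms by (blast intro: nat_comp_closed nat_isosD)
  fix M :: "('a, 'u) rmodule" assume M: "M \<in> fg_modules A"
  then have "bij_betw (\<kappa> M \<circ> \<iota> M) (carrier (fobj T M)) (carrier (fobj R M))"
    using assms(2,3) by (intro bij_betw_trans[of _ _ "carrier (fobj S M)"]) (auto simp: nat_isos_def)
  then show "bij_betw (nat_comp A T \<kappa> \<iota> M) (carrier (fobj T M)) (carrier (fobj R M))"
    using M by (subst bij_betw_cong[where g = "\<kappa> M \<circ> \<iota> M"]) (auto simp: nat_comp_apply)
qed

text \<open>The inverse is taken pointwise. To show that \<eta> M y equals a given element it
  suffices to apply \<theta> M to that element, so linearity and naturality of \<eta> reduce to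
  those of \<theta>.\<close>

lemma nat_iso_inverse:
  fixes T :: "('a, 'u, 'k, 'w) modfun"
  assumes T: "linear_functor K A T" and S: "linear_functor K A S" and \<theta>: "\<theta> \<in> nat_isos K A T S"
  obtains \<eta> where "\<eta> \<in> nat_trans K A S T"
    and "\<And>M x. M \<in> fg_modules A \<Longrightarrow> x \<in> carrier (fobj T M) \<Longrightarrow> \<eta> M (\<theta> M x) = x"
    and "\<And>M y. M \<in> fg_modules A \<Longrightarrow> y \<in> carrier (fobj S M) \<Longrightarrow> \<theta> M (\<eta> M y) = y"
proof -
  have bij: "bij_betw (\<theta> M) (carrier (fobj T M)) (carrier (fobj S M))" if "M \<in> fg_modules A" for M :: "('a, 'u) rmodule"
    using \<theta> that by (simp add: nat_isos_def)
  have \<theta>_trans: "\<theta> \<in> nat_trans K A T S"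
    using \<theta> by (rule nat_isosD)
  define \<eta> where "\<eta> = (\<lambda>M\<in>(fg_modules A :: ('a, 'u) rmodule set). \<lambda>y\<in>carrier (fobj S M). inv_into (carrier (fobj T M)) (\<theta> M) y)"
  have left: "\<eta> M (\<theta> M x) = x" if "M \<in> fg_modules A" "x \<in> carrier (fobj T M)" for M :: "('a, 'u) rmodule" and x
    using that bij[OF that(1)] by (simp add: \<eta>_def bij_betw_def nat_transD[OF \<theta>_trans])
  have right: "\<theta> M (\<eta> M y) = y" and closed: "\<eta> M y \<in> carrier (fobj T M)"
    if "M \<in> fg_modules A" "y \<in> carrier (fobj S M)" for M :: "('a, 'u) rmodule" and y
    using that bij[OF that(1)] by (auto simp: \<eta>_def bij_betw_def f_inv_into_f inv_into_into)
  have inverse: "\<eta> M y = x" if "M \<in> fg_modules A" "x \<in> carrier (fobj T M)" "y = \<theta> M x" for M :: "('a, 'u) rmodule" and x y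
    using left that by simp
  have "\<eta> \<in> nat_trans K A S T"
  proof (rule nat_transI)
    fix M :: "('a, 'u) rmodule" assume M: "M \<in> fg_modules A"
    interpret TM: module K "fobj T M" using linear_functorD(1)[OF T M] .
    interpret SM: module K "fobj S M" using linear_functorD(1)[OF S M] .
    note \<theta>_lin = linear_mapsD[OF nat_transD(1)[OF \<theta>_trans M]]
    show "\<eta> M \<in> linear_maps K (fobj S M) (fobj T M)"
    proof (rule linear_mapsI)
      show "\<eta> M \<in> extensional (carrier (fobj S M))"
        using M by (simp add: \<eta>_def)
    qed (use M in \<open>auto simp: closed right \<theta>_lin intro!: inverse\<close>)
    fix N :: "('a, 'u) rmodule" and f y
    assume N: "N \<in> fg_modules A" and f: "f \<in> module_homs A M N" and y: "y \<in> carrier (fobj S N)"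
    show "\<eta> M (fmap S M N f y) = fmap T M N f (\<eta> N y)"
      using M N f y linear_mapsD(1)[OF linear_functorD(2)[OF T M N f]]
      by (intro inverse) (simp_all add: closed right nat_transD(3)[OF \<theta>_trans])
  qed (simp add: \<eta>_def)
  then show thesis
    using left right that by blast
qed

section \<open>Natural transformations between restricted functors\<close>

context contravariant_functor
begin

text \<open>\<open>fmap_comp\<close> with the composite described by its values. This allows
  different factorizations of one map to be compared without rewriting composites.\<close>

lemma fmap_fmap:
  assumes "L \<in> fg_modules A" "M \<in> fg_modules A" "N \<in> fg_modules A"
    and "f \<in> module_homs A L M" "h \<in> module_homs A M N" "x \<in> carrier (fobj T N)"
    and "\<And>y. y \<in> carrier L \<Longrightarrow> h (f y) = k y" "k \<in> extensional (carrier L)"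
  shows "fmap T L M f (fmap T M N h x) = fmap T L N k x"
proof -
  have "compose (carrier L) h f = k"
    using assms(7,8) by (intro extensionalityI[where A = "carrier L"]) (auto simp: compose_def)
  then show ?thesis
    using fmap_comp[OF assms(1-6)] by simp
qed

lemma fmap_fmap_id:
  assumes "M \<in> fg_modules A" "N \<in> fg_modules A" "f \<in> module_homs A M N" "h \<in> module_homs A N M"
    and "x \<in> carrier (fobj T M)" "\<And>y. y \<in> carrier M \<Longrightarrow> h (f y) = y"
  shows "fmap T M N f (fmap T N M h x) = x"
  using fmap_fmap[OF assms(1,2,1,3-5), of "\<lambda>y\<in>carrier M. y"] assms(1,5,6) by (simp add: fmap_id)

lemma fmap_bij:
  assumes M: "M \<in> fg_modules A" and N: "N \<in> fg_modules A"
    and f: "f \<in> module_homs A M N" and h: "h \<in> module_homs A N M"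
    and "\<And>y. y \<in> carrier M \<Longrightarrow> h (f y) = y" "\<And>y. y \<in> carrier N \<Longrightarrow> f (h y) = y"
  shows "bij_betw (fmap T M N f) (carrier (fobj T N)) (carrier (fobj T M))"
proof (rule bij_betw_byWitness[where f' = "fmap T N M h"])
  show "\<forall>x\<in>carrier (fobj T N). fmap T N M h (fmap T M N f x) = x"
    using fmap_fmap_id[OF N M h f] assms(6) by blast
  show "\<forall>x\<in>carrier (fobj T M). fmap T M N f (fmap T N M h x) = x"
    using fmap_fmap_id[OF M N f h] assms(5) by blast
qed (use assms in auto)

text \<open>
  Here \<open>u\<close> and \<open>v\<close> are functors between categories of modules, and \<open>U\<close>, \<open>V\<close> are the composites of \<open>T\<close>
  with them.
\<close>

lemma nat_trans_of_homs:
  fixes U V :: "('b, 'u, 'k, 'w) modfun" and B :: "('k, 'b) module"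
  assumes U: "\<And>M. fobj U M = fobj T (u M)" "\<And>M N f. fmap U M N f = fmap T (u M) (u N) (u' M N f)"
    and V: "\<And>M. fobj V M = fobj T (v M)" "\<And>M N f. fmap V M N f = fmap T (v M) (v N) (v' M N f)"
    and u: "\<And>M. M \<in> fg_modules B \<Longrightarrow> u M \<in> fg_modules A"
      "\<And>M N f. M \<in> fg_modules B \<Longrightarrow> N \<in> fg_modules B \<Longrightarrow> f \<in> module_homs B M N \<Longrightarrow>
        u' M N f \<in> module_homs A (u M) (u N)"
    and v: "\<And>M. M \<in> fg_modules B \<Longrightarrow> v M \<in> fg_modules A"
      "\<And>M N f. M \<in> fg_modules B \<Longrightarrow> N \<in> fg_modules B \<Longrightarrow> f \<in> module_homs B M N \<Longrightarrow>
        v' M N f \<in> module_homs A (v M) (v N)"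
    and k: "\<And>M. M \<in> fg_modules B \<Longrightarrow> k M \<in> module_homs A (v M) (u M)"
    and natural: "\<And>M N f y. M \<in> fg_modules B \<Longrightarrow> N \<in> fg_modules B \<Longrightarrow> f \<in> module_homs B M N \<Longrightarrow>
        y \<in> carrier (v M) \<Longrightarrow> k N (v' M N f y) = u' M N f (k M y)"
  shows "(\<lambda>M\<in>fg_modules B. fmap T (v M) (u M) (k M)) \<in> nat_trans K B U V"
proof (rule nat_transI)
  fix M :: "('b, 'u) rmodule" assume M: "M \<in> fg_modules B"
  then show "(\<lambda>M\<in>fg_modules B. fmap T (v M) (u M) (k M)) M \<in> linear_maps K (fobj U M) (fobj V M)"
    by (simp add: U V u v k fmap_linear)
  fix N :: "('b, 'u) rmodule" and f x
  assume N: "N \<in> fg_modules B" and f: "f \<in> module_homs B M N" and x: "x \<in> carrier (fobj U N)"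
  let ?h = "\<lambda>y\<in>carrier (v M). u' M N f (k M y)"
  have "fmap T (v M) (u M) (k M) (fmap T (u M) (u N) (u' M N f) x) = fmap T (v M) (u N) ?h x"
    using M N f x by (intro fmap_fmap) (auto simp: U u v k)
  moreover have "fmap T (v M) (v N) (v' M N f) (fmap T (v N) (u N) (k N) x) = fmap T (v M) (u N) ?h x"
    using M N f x by (intro fmap_fmap) (auto simp: U u v k natural)
  ultimately show "(\<lambda>M\<in>fg_modules B. fmap T (v M) (u M) (k M)) M (fmap U M N f x) =
      fmap V M N f ((\<lambda>M\<in>fg_modules B. fmap T (v M) (u M) (k M)) N x)"
    using M N by (simp add: U V)
qed simp

end

section \<open>The functor \<phi>, twists, and the isomorphisms induced by group elements\<close>

context skew_action
begin

lemma twist_functor_simps [simp]: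
  "fobj (twist_functor G \<beta> g T) M = fobj T (tw g M)"
  "fmap (twist_functor G \<beta> g T) M N f = fmap T (tw g M) (tw g N) f"
  by (simp_all add: twist_functor_def)

lemma phi_simps [simp]:
  "fobj (phi G L T) Z = fobj T (pd Z)"
  "fmap (phi G L T) Z Y f = fmap T (pd Z) (pd Y) f"
  by (simp_all add: phi_def)

lemma twist_linear_functor:
  "linear_functor K L T \<Longrightarrow> g \<in> carrier G \<Longrightarrow> linear_functor K L (twist_functor G \<beta> g T)"
  by (auto simp: linear_functor_def tw_fg module_homs_tw)

lemma phi_linear_functor: "linear_functor K L T \<Longrightarrow> linear_functor K LG (phi G L T)"
  by (auto simp: linear_functor_def pd_fg module_homs_pd)

lemma phi_map_apply [simp]: "Z \<in> fg_modules LG \<Longrightarrow> phi_map G \<beta> L \<iota> Z = \<iota> (pd Z)"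
  by (simp add: phi_map_def)

lemma phi_map_closed:
  "\<iota> \<in> nat_trans K L T S \<Longrightarrow> phi_map G \<beta> L \<iota> \<in> nat_trans K LG (phi G L T) (phi G L S)"
  by (rule nat_transI) (auto simp: nat_transD pd_fg module_homs_pd, simp add: phi_map_def)

lemma phi_map_add:
  "phi_map G \<beta> L (\<iota> \<oplus>\<^bsub>nat_space K L T S\<^esub> \<kappa>) =
    phi_map G \<beta> L \<iota> \<oplus>\<^bsub>nat_space K LG (phi G L T) (phi G L S)\<^esub> phi_map G \<beta> L \<kappa>"
  by (auto simp: phi_map_def nat_space_ops pd_fg intro!: restrict_ext)

lemma phi_map_smult:
  "phi_map G \<beta> L (c \<odot>\<^bsub>nat_space K L T S\<^esub> \<iota>) =
    c \<odot>\<^bsub>nat_space K LG (phi G L T) (phi G L S)\<^esub> phi_map G \<beta> L \<iota>"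
  by (auto simp: phi_map_def nat_space_ops pd_fg intro!: restrict_ext)

lemma phi_map_comp:
  "phi_map G \<beta> L (nat_comp L T \<kappa> \<iota>) = nat_comp LG (phi G L T) (phi_map G \<beta> L \<kappa>) (phi_map G \<beta> L \<iota>)"
  by (auto simp: phi_map_def nat_comp_def pd_fg intro!: restrict_ext)

lemma phi_map_iso:
  "\<theta> \<in> nat_isos K L T S \<Longrightarrow> phi_map G \<beta> L \<theta> \<in> nat_isos K LG (phi G L T) (phi G L S)"
  by (auto simp: nat_isos_def phi_map_closed pd_fg)

text \<open>T is contravariant, so \<open>act Z g\<close>, which goes from
  \<open>tw g (pd Z)\<close> to \<open>pd Z\<close>, yields a map from \<phi>(T) to \<phi> of the
  twist of T by g. \<open>unshift\<close> goes back by way of the inverse group element.\<close>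

definition shift :: "('a, 'u, 'k, 'w) modfun \<Rightarrow> 'g \<Rightarrow> ('g \<Rightarrow> 'a, 'u) rmodule \<Rightarrow> 'w \<Rightarrow> 'w" where
  "shift T g = (\<lambda>Z\<in>fg_modules LG. fmap T (tw g (pd Z)) (pd Z) (act Z g))"

definition unshift :: "('a, 'u, 'k, 'w) modfun \<Rightarrow> 'g \<Rightarrow> ('g \<Rightarrow> 'a, 'u) rmodule \<Rightarrow> 'w \<Rightarrow> 'w" where
  "unshift T g = (\<lambda>Z\<in>fg_modules LG. fmap T (pd Z) (tw g (pd Z)) (act Z (inv g)))"

lemma shift_iso:
  fixes T :: "('a, 'u, 'k, 'w) modfun"
  assumes "contravariant_functor K L T" "g \<in> carrier G"
  shows "shift T g \<in> nat_isos K LG (phi G L T) (phi G L (twist_functor G \<beta> g T))"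
    and "unshift T g \<in> nat_isos K LG (phi G L (twist_functor G \<beta> g T)) (phi G L T)"
proof -
  interpret T: contravariant_functor K L T by fact
  note mem = pd_fg tw_fg[OF pd_fg assms(2)] act_hom[OF fg_modules_right_module assms(2)]
    act_inv_hom[OF fg_modules_right_module assms(2)] act_act_inv[OF fg_modules_right_module assms(2)]
    module_homs_pd module_homs_tw[OF module_homs_pd assms(2)]
  note natural = act_natural[OF fg_modules_right_module, symmetric]
  have bij: "bij_betw (fmap T (tw g (pd Z)) (pd Z) (act Z g)) (carrier (fobj T (pd Z))) (carrier (fobj T (tw g (pd Z))))"
    "bij_betw (fmap T (pd Z) (tw g (pd Z)) (act Z (inv g))) (carrier (fobj T (tw g (pd Z)))) (carrier (fobj T (pd Z)))"
    if "Z \<in> fg_modules LG" for Z :: "('g \<Rightarrow> 'a, 'u) rmodule"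
    using that T.fmap_bij[of "tw g (pd Z)" "pd Z" "act Z g" "act Z (inv g)"]
      T.fmap_bij[of "pd Z" "tw g (pd Z)" "act Z (inv g)" "act Z g"] by (simp_all add: mem)
  show "shift T g \<in> nat_isos K LG (phi G L T) (phi G L (twist_functor G \<beta> g T))"
    unfolding shift_def
    by (rule nat_isosI[OF T.nat_trans_of_homs[where u' = "\<lambda>_ _ f. f" and v' = "\<lambda>_ _ f. f"]])
      (auto simp: mem natural bij)
  show "unshift T g \<in> nat_isos K LG (phi G L (twist_functor G \<beta> g T)) (phi G L T)"
    unfolding unshift_def
    by (rule nat_isosI[OF T.nat_trans_of_homs[where u' = "\<lambda>_ _ f. f" and v' = "\<lambda>_ _ f. f"]])
      (auto simp: mem natural bij)
qed

end

section \<open>Functors evaluated on restrictions of induced modules\<close>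

locale functor_pair = skew_action L G \<beta> + K: cring K +
    T1: contravariant_functor K L T1 + T2: contravariant_functor K L T2
  for K :: "'k ring" and L :: "('k, 'a) module" and G :: "'g monoid" (structure) and \<beta> :: "'g \<Rightarrow> 'a \<Rightarrow> 'a"
    and T1 T2 :: "('a, 'u, 'k, 'w) modfun" +
  assumes embed: "\<And>M :: ('a, 'u) rmodule. right_module L M \<Longrightarrow>
      \<exists>j :: ('g \<Rightarrow> 'u) \<Rightarrow> 'u. inj_on j (fams M)"
begin

text \<open>T after induction and restriction, which is the direct sum of the twists of T.
  Contravariance exchanges the roles: \<open>proj_trans\<close> supplies the inclusions of the
  twists and \<open>incl_trans\<close> the projections onto them.\<close>

definition coinduced :: "('a, 'u, 'k, 'w) modfun \<Rightarrow> ('a, 'u, 'k, 'w) modfun" where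
  "coinduced T = \<lparr>fobj = (\<lambda>M. fobj T (pd (induced M))),
     fmap = (\<lambda>M N f. fmap T (pd (induced M)) (pd (induced N)) (induced_map M N f))\<rparr>"

lemma coinduced_simps [simp]:
  "fobj (coinduced T) M = fobj T (pd (induced M))"
  "fmap (coinduced T) M N f = fmap T (pd (induced M)) (pd (induced N)) (induced_map M N f)"
  by (simp_all add: coinduced_def)

lemma induction: "(M :: ('a, 'u) rmodule) \<in> fg_modules L \<Longrightarrow> induction L G \<beta> M"
  using embed[of M] fg_modules_right_module[of M L] skew_action_axioms
  by (simp add: induction_def induction_axioms_def)

lemma restriction: "(Z :: ('g \<Rightarrow> 'a, 'u) rmodule) \<in> fg_modules LG \<Longrightarrow> restriction L G \<beta> Z"
  using induction[OF pd_fg] fg_modules_right_module[of Z LG] skew_action_axioms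
  by (simp add: restriction_def)

lemmas fg_closed = pd_fg tw_fg induction.induced_fg[OF induction]

lemma coinduced_homs:
  "(M :: ('a, 'u) rmodule) \<in> fg_modules L \<Longrightarrow> N \<in> fg_modules L \<Longrightarrow> f \<in> module_homs L M N \<Longrightarrow>
    induced_map M N f \<in> module_homs L (pd (induced M)) (pd (induced N))"
  by (intro module_homs_pd induced_map_hom induction)

lemma proj_trans:
  assumes "contravariant_functor K L T"
  shows "g \<in> carrier G \<Longrightarrow> (\<lambda>M\<in>fg_modules L. fmap T (pd (induced M)) (tw g M) (proj M g))
      \<in> nat_trans K L (twist_functor G \<beta> g T) (coinduced T)"
    and "(\<lambda>M\<in>fg_modules L. fmap T (pd (induced M)) M (proj M \<one>)) \<in> nat_trans K L T (coinduced T)"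
  by (rule contravariant_functor.nat_trans_of_homs[OF assms, where u' = "\<lambda>_ _ f. f" and v' = induced_map],
      simp_all add: fg_closed coinduced_homs module_homs_tw proj_natural induction
        induction.proj_hom induction.proj_one_hom)+

lemma incl_trans:
  assumes "contravariant_functor K L T"
  shows "g \<in> carrier G \<Longrightarrow> (\<lambda>M\<in>fg_modules L. fmap T (tw g M) (pd (induced M)) (incl M g))
      \<in> nat_trans K L (coinduced T) (twist_functor G \<beta> g T)"
    and "(\<lambda>M\<in>fg_modules L. fmap T M (pd (induced M)) (incl M \<one>)) \<in> nat_trans K L (coinduced T) T"
  by (rule contravariant_functor.nat_trans_of_homs[OF assms, where u' = induced_map and v' = "\<lambda>_ _ f. f"],
      simp_all add: fg_closed coinduced_homs module_homs_tw incl_natural induction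
        induction.incl_hom induction.incl_one_hom)+

abbreviation W :: "('k, ('g \<Rightarrow> 'a, 'u) rmodule \<Rightarrow> 'w \<Rightarrow> 'w) module" where
  "W \<equiv> nat_space K LG (phi G L T1) (phi G L T2)"

abbreviation tw1 :: "'g \<Rightarrow> ('a, 'u, 'k, 'w) modfun" where
  "tw1 g \<equiv> twist_functor G \<beta> g T1"

abbreviation tw2 :: "'g \<Rightarrow> ('a, 'u, 'k, 'w) modfun" where
  "tw2 g \<equiv> twist_functor G \<beta> g T2"

lemmas functors [simp] = T1.contravariant_functor_axioms T2.contravariant_functor_axioms

lemma linear [simp]:
  "linear_functor K L T1" "linear_functor K L T2"
  "linear_functor K LG (phi G L T1)" "linear_functor K LG (phi G L T2)"
  "g \<in> carrier G \<Longrightarrow> linear_functor K L (tw1 g)" "g \<in> carrier G \<Longrightarrow> linear_functor K L (tw2 g)"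
  "g \<in> carrier G \<Longrightarrow> linear_functor K LG (phi G L (tw1 g))"
  "g \<in> carrier G \<Longrightarrow> linear_functor K LG (phi G L (tw2 g))"
  by (simp_all add: T1.linear_functor T2.linear_functor twist_linear_functor phi_linear_functor)

lemma W_module: "module K W"
  by (rule nat_space_module) (simp_all add: K.is_cring)

text \<open>The adjunct of \<open>\<kappa>\<close>; \<open>a\<close> will come from a projection and \<open>b\<close> from an inclusion of a summand of the
  restriction of the induced module.\<close>

definition transpose :: "('a, 'u, 'k, 'w) modfun \<Rightarrow> (('a, 'u) rmodule \<Rightarrow> 'w \<Rightarrow> 'w) \<Rightarrow>
    (('a, 'u) rmodule \<Rightarrow> 'w \<Rightarrow> 'w) \<Rightarrow> (('g \<Rightarrow> 'a, 'u) rmodule \<Rightarrow> 'w \<Rightarrow> 'w) \<Rightarrow> (('a, 'u) rmodule \<Rightarrow> 'w \<Rightarrow> 'w)" where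
  "transpose S b a \<kappa> = nat_comp L S b (nat_comp L S (\<lambda>M\<in>fg_modules L. \<kappa> (induced M)) a)"

lemma transpose_closed:
  assumes \<kappa>: "\<kappa> \<in> carrier W" and S: "linear_functor K L S"
    and a: "a \<in> nat_trans K L S (coinduced T1)" and b: "b \<in> nat_trans K L (coinduced T2) R"
  shows "transpose S b a \<kappa> \<in> nat_trans K L S R"
proof -
  note \<kappa> = \<kappa>[simplified]
  \<comment> \<open>\<kappa> is natural only for \<open>LG\<close>-linear maps. Evaluating it on
    induced modules gives naturality over L, since \<open>induced_map\<close> turns L-linear maps
    into \<open>LG\<close>-linear ones.\<close>
  have "(\<lambda>M\<in>fg_modules L. \<kappa> (induced M)) \<in> nat_trans K L (coinduced T1) (coinduced T2)"
  proof (rule nat_transI)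
    fix M :: "('a, 'u) rmodule" assume M: "M \<in> fg_modules L"
    then show "(\<lambda>M\<in>fg_modules L. \<kappa> (induced M)) M \<in> linear_maps K (fobj (coinduced T1) M) (fobj (coinduced T2) M)"
      using nat_transD(1)[OF \<kappa>, of "induced M"] by (simp add: fg_closed)
    fix N :: "('a, 'u) rmodule" and f x
    assume N: "N \<in> fg_modules L" and f: "f \<in> module_homs L M N" and x: "x \<in> carrier (fobj (coinduced T1) N)"
    then show "(\<lambda>M\<in>fg_modules L. \<kappa> (induced M)) M (fmap (coinduced T1) M N f x) =
        fmap (coinduced T2) M N f ((\<lambda>M\<in>fg_modules L. \<kappa> (induced M)) N x)"
      using M nat_transD(3)[OF \<kappa>, of "induced M" "induced N" "induced_map M N f" x]
      by (simp add: fg_closed induced_map_hom induction)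
  qed simp
  then show ?thesis
    unfolding transpose_def by (intro nat_comp_closed[OF S _ b] nat_comp_closed[OF S a])
qed

lemma transpose_apply:
  "M \<in> fg_modules L \<Longrightarrow> x \<in> carrier (fobj S M) \<Longrightarrow> transpose S b a \<kappa> M x = b M (\<kappa> (induced M) (a M x))"
  by (simp add: transpose_def nat_comp_apply)

lemma transpose_add:
  assumes \<kappa>: "\<kappa> \<in> carrier W" "\<kappa>' \<in> carrier W" and S: "linear_functor K L S" and R: "linear_functor K L R"
    and a: "a \<in> nat_trans K L S (coinduced T1)" and b: "b \<in> nat_trans K L (coinduced T2) R"
  shows "transpose S b a (\<kappa> \<oplus>\<^bsub>W\<^esub> \<kappa>') = transpose S b a \<kappa> \<oplus>\<^bsub>nat_space K L S R\<^esub> transpose S b a \<kappa>'"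
proof (rule nat_trans_eqI)
  interpret W: module K W by (rule W_module)
  show "transpose S b a (\<kappa> \<oplus>\<^bsub>W\<^esub> \<kappa>') \<in> nat_trans K L S R"
    by (rule transpose_closed[OF W.a_closed[OF \<kappa>] S a b])
  show "transpose S b a \<kappa> \<oplus>\<^bsub>nat_space K L S R\<^esub> transpose S b a \<kappa>' \<in> nat_trans K L S R"
    using \<kappa> by (intro add_nat_trans[OF S R] transpose_closed[OF _ S a b])
  fix M :: "('a, 'u) rmodule" and x assume M: "M \<in> fg_modules L" and x: "x \<in> carrier (fobj S M)"
  then show "transpose S b a (\<kappa> \<oplus>\<^bsub>W\<^esub> \<kappa>') M x = (transpose S b a \<kappa> \<oplus>\<^bsub>nat_space K L S R\<^esub> transpose S b a \<kappa>') M x"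
    using nat_transD(2)[OF a M x] linear_mapsD(2)[OF nat_transD(1)[OF b M]]
      nat_transD(2)[OF \<kappa>(1)[simplified], of "induced M" "a M x"]
      nat_transD(2)[OF \<kappa>(2)[simplified], of "induced M" "a M x"]
    by (simp add: transpose_apply fg_closed)
qed

section \<open>Twists of the source: induction as a left adjoint\<close>

definition \<Psi>1 :: "'g \<Rightarrow> (('a, 'u) rmodule \<Rightarrow> 'w \<Rightarrow> 'w) \<Rightarrow> (('g \<Rightarrow> 'a, 'u) rmodule \<Rightarrow> 'w \<Rightarrow> 'w)" where
  "\<Psi>1 g \<iota> = nat_comp LG (phi G L T1) (phi_map G \<beta> L \<iota>) (shift T1 g)"

text \<open>The g-component of the adjunct of \<kappa>: the projection to the summand g brings in
  the twist of \<open>T1\<close>, and \<open>incl M \<one>\<close> is the unit of the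
  adjunction.\<close>

definition \<Phi>1 :: "'g \<Rightarrow> (('g \<Rightarrow> 'a, 'u) rmodule \<Rightarrow> 'w \<Rightarrow> 'w) \<Rightarrow> (('a, 'u) rmodule \<Rightarrow> 'w \<Rightarrow> 'w)" where
  "\<Phi>1 g = transpose (tw1 g) (\<lambda>M\<in>fg_modules L. fmap T2 M (pd (induced M)) (incl M \<one>))
     (\<lambda>M\<in>fg_modules L. fmap T1 (pd (induced M)) (tw g M) (proj M g))"

lemma shift1: "g \<in> carrier G \<Longrightarrow> shift T1 g \<in> nat_trans K LG (phi G L T1) (phi G L (tw1 g))"
  using shift_iso(1)[OF functors(1)] by (rule nat_isosD)

lemma \<Psi>1_closed: "g \<in> carrier G \<Longrightarrow> \<iota> \<in> nat_trans K L (tw1 g) T2 \<Longrightarrow> \<Psi>1 g \<iota> \<in> carrier W"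
  unfolding \<Psi>1_def carrier_nat_space
  by (rule nat_comp_closed[OF _ shift1 phi_map_closed]) simp_all

lemma \<Psi>1_add:
  "g \<in> carrier G \<Longrightarrow> \<iota> \<in> nat_trans K L (tw1 g) T2 \<Longrightarrow> \<iota>' \<in> nat_trans K L (tw1 g) T2 \<Longrightarrow>
    \<Psi>1 g (\<iota> \<oplus>\<^bsub>nat_space K L (tw1 g) T2\<^esub> \<iota>') = \<Psi>1 g \<iota> \<oplus>\<^bsub>W\<^esub> \<Psi>1 g \<iota>'"
  unfolding \<Psi>1_def phi_map_add
  by (rule nat_comp_add_left[OF _ _ _ shift1 phi_map_closed phi_map_closed]) simp_all

lemma \<Psi>1_smult:
  "g \<in> carrier G \<Longrightarrow> c \<in> carrier K \<Longrightarrow> \<iota> \<in> nat_trans K L (tw1 g) T2 \<Longrightarrow>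
    \<Psi>1 g (c \<odot>\<^bsub>nat_space K L (tw1 g) T2\<^esub> \<iota>) = c \<odot>\<^bsub>W\<^esub> \<Psi>1 g \<iota>"
  unfolding \<Psi>1_def phi_map_smult
  by (rule nat_comp_smult_left[OF _ _ _ shift1 phi_map_closed]) simp_all

lemma \<Psi>1_apply:
  "g \<in> carrier G \<Longrightarrow> Z \<in> fg_modules LG \<Longrightarrow> x \<in> carrier (fobj T1 (pd Z)) \<Longrightarrow>
    \<Psi>1 g \<iota> Z x = \<iota> (pd Z) (fmap T1 (tw g (pd Z)) (pd Z) (act Z g) x)"
  by (simp add: \<Psi>1_def nat_comp_apply shift_def)

lemma \<Phi>1_apply:
  "M \<in> fg_modules L \<Longrightarrow> x \<in> carrier (fobj T1 (tw g M)) \<Longrightarrow>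
    \<Phi>1 g \<kappa> M x = fmap T2 M (pd (induced M)) (incl M \<one>)
       (\<kappa> (induced M) (fmap T1 (pd (induced M)) (tw g M) (proj M g) x))"
  by (simp add: \<Phi>1_def transpose_apply)

lemma \<Phi>1_closed: "g \<in> carrier G \<Longrightarrow> \<kappa> \<in> carrier W \<Longrightarrow> \<Phi>1 g \<kappa> \<in> nat_trans K L (tw1 g) T2"
  unfolding \<Phi>1_def
  by (rule transpose_closed[OF _ _ proj_trans(1) incl_trans(2)]) simp_all

lemma \<Phi>1_add:
  "g \<in> carrier G \<Longrightarrow> \<kappa> \<in> carrier W \<Longrightarrow> \<kappa>' \<in> carrier W \<Longrightarrow>
    \<Phi>1 g (\<kappa> \<oplus>\<^bsub>W\<^esub> \<kappa>') = \<Phi>1 g \<kappa> \<oplus>\<^bsub>nat_space K L (tw1 g) T2\<^esub> \<Phi>1 g \<kappa>'"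
  unfolding \<Phi>1_def
  by (rule transpose_add[OF _ _ _ _ proj_trans(1) incl_trans(2)]) simp_all

text \<open>Naturality of \<iota> along \<open>incl M \<one>\<close> collects everything inside
  \<iota> M. There \<open>T1\<close> is applied to the projection to g after the action of h after
  the inclusion at \<one>, and \<open>proj_act_incl\<close> evaluates this composite.\<close>

lemma \<Phi>\<Psi>1:
  assumes g: "g \<in> carrier G" and h: "h \<in> carrier G" and \<iota>: "\<iota> \<in> nat_trans K L (tw1 h) T2"
  shows "\<Phi>1 g (\<Psi>1 h \<iota>) = (if h = g then \<iota> else \<zero>\<^bsub>nat_space K L (tw1 g) T2\<^esub>)"
proof (rule nat_trans_eqI)
  show "\<Phi>1 g (\<Psi>1 h \<iota>) \<in> nat_trans K L (tw1 g) T2"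
    using g \<Psi>1_closed[OF h \<iota>] by (rule \<Phi>1_closed)
  show "(if h = g then \<iota> else \<zero>\<^bsub>nat_space K L (tw1 g) T2\<^esub>) \<in> nat_trans K L (tw1 g) T2"
    using \<iota> g zero_nat_trans[of K L "tw1 g" T2] by auto
  fix M :: "('a, 'u) rmodule" and x assume M: "M \<in> fg_modules L" and x: "x \<in> carrier (fobj (tw1 g) M)"
  interpret I: induction L G \<beta> M using M by (rule induction)
  interpret T2M: module K "fobj T2 M" using M by (rule T2.fobj_module)
  let ?HM = "induced M"
  have x': "x \<in> carrier (fobj T1 (tw g M))"
    using x by simp
  note mem = fg_closed M I.proj_hom[OF g] I.incl_one_hom act_hom[OF I.induced_module h]
    module_homs_tw[OF I.incl_one_hom h]
  let ?k = "\<lambda>m\<in>carrier M. if h = g then m else \<zero>\<^bsub>M\<^esub>"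
  let ?y = "fmap T1 (pd ?HM) (tw g M) (proj M g) x"
  let ?z = "fmap T1 (tw h (pd ?HM)) (pd ?HM) (act ?HM h) ?y"
  have y: "?y \<in> carrier (fobj T1 (pd ?HM))"
    using x' g by (simp add: mem)
  have z: "?z \<in> carrier (fobj T1 (tw h (pd ?HM)))"
    using y h by (simp add: mem)
  have "\<Phi>1 g (\<Psi>1 h \<iota>) M x = fmap T2 M (pd ?HM) (incl M \<one>) (\<iota> (pd ?HM) ?z)"
    using M x' y h by (simp add: \<Phi>1_apply \<Psi>1_apply fg_closed)
  also have "\<dots> = \<iota> M (fmap T1 (tw h M) (tw h (pd ?HM)) (incl M \<one>) ?z)"
    using nat_transD(3)[OF \<iota> M, of "pd ?HM" "incl M \<one>" ?z] z by (simp add: mem)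
  also have "fmap T1 (tw h M) (tw h (pd ?HM)) (incl M \<one>) ?z =
      fmap T1 (tw h M) (pd ?HM) (\<lambda>m\<in>carrier M. act ?HM h (incl M \<one> m)) ?y"
    using y h by (intro T1.fmap_fmap) (auto simp: mem)
  also have "\<dots> = fmap T1 (tw h M) (tw g M) ?k x"
  proof (rule T1.fmap_fmap)
    have "compose (carrier (tw h M)) (act ?HM h) (incl M \<one>) \<in> module_homs L (tw h M) (pd ?HM)"
      by (rule module_homs_compose[OF module_homs_tw[OF I.incl_one_hom h] act_hom[OF I.induced_module h]
            tw_module[OF I.M.right_module_axioms h]])
    then show "(\<lambda>m\<in>carrier M. act ?HM h (incl M \<one> m)) \<in> module_homs L (tw h M) (pd ?HM)"
      by (simp add: compose_def)
  qed (use x' g h in \<open>auto simp: mem I.proj_act_incl\<close>)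
  finally have "\<Phi>1 g (\<Psi>1 h \<iota>) M x = \<iota> M (fmap T1 (tw h M) (tw g M) ?k x)" .
  \<comment> \<open>For h = g the two twists are the same module and \<open>?k\<close> is its
    identity; otherwise \<open>?k\<close> is the zero map.\<close>
  moreover have "fmap T1 (tw h M) (tw g M) ?k x = (if h = g then x else \<zero>\<^bsub>fobj T1 (tw h M)\<^esub>)"
    using T1.fmap_id[of "tw g M" x] T1.fmap_zero[of "tw h M" "tw g M" x] x' g h M
    by (auto simp: fg_closed)
  moreover have "\<iota> M \<zero>\<^bsub>fobj T1 (tw h M)\<^esub> = \<zero>\<^bsub>fobj T2 M\<^esub>"
    using M h nat_transD(1)[OF \<iota> M]
    by (intro linear_maps_zero[where K = K]) (auto simp: T1.fobj_module T2.fobj_module fg_closed)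
  ultimately show "\<Phi>1 g (\<Psi>1 h \<iota>) M x = (if h = g then \<iota> else \<zero>\<^bsub>nat_space K L (tw1 g) T2\<^esub>) M x"
    using M x by simp
qed

text \<open>Linearity collects the sum over G inside \<kappa>, where it becomes \<open>T1\<close>
  applied to the counit. Naturality along the counit then brings out \<kappa> Z, and
  \<open>counit_incl\<close> shows that the remaining map induced on \<open>T2\<close> is the
  identity.\<close>

lemma \<Psi>\<Phi>1:
  assumes \<kappa>: "\<kappa> \<in> carrier W"
  shows "(\<Oplus>\<^bsub>W\<^esub>g\<in>carrier G. \<Psi>1 g (\<Phi>1 g \<kappa>)) = \<kappa>"
proof (rule nat_trans_eqI)
  interpret W: module K W by (rule W_module)
  have \<Psi>\<Phi>: "\<Psi>1 g (\<Phi>1 g \<kappa>) \<in> carrier W" if "g \<in> carrier G" for g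
    using that \<Phi>1_closed[OF that \<kappa>] by (rule \<Psi>1_closed)
  then show "(\<Oplus>\<^bsub>W\<^esub>g\<in>carrier G. \<Psi>1 g (\<Phi>1 g \<kappa>)) \<in> nat_trans K LG (phi G L T1) (phi G L T2)"
    using W.finsum_in[of "carrier G"] by simp
  show "\<kappa> \<in> nat_trans K LG (phi G L T1) (phi G L T2)"
    using \<kappa> by simp
  note \<kappa> = \<kappa>[simplified]
  fix Z :: "('g \<Rightarrow> 'a, 'u) rmodule" and x assume Z: "Z \<in> fg_modules LG" and x: "x \<in> carrier (fobj (phi G L T1) Z)"
  interpret R: restriction L G \<beta> Z using Z by (rule restriction)
  have x': "x \<in> carrier (fobj T1 (pd Z))"
    using x by simp
  let ?H = "induced (pd Z)"
  let ?i = "fmap T2 (pd Z) (pd ?H) (incl (pd Z) \<one>)"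
  let ?p = "\<lambda>g. fmap T1 (pd ?H) (tw g (pd Z)) (proj (pd Z) g)"
  let ?m = "\<lambda>g. fmap T1 (tw g (pd Z)) (pd Z) (act Z g)"
  note mem = fg_closed Z R.P.proj_hom R.P.incl_one_hom act_hom[OF R.Z.right_module_axioms]
  have H: "?H \<in> fg_modules LG"
    using Z by (simp add: fg_closed)
  interpret T1H: module K "fobj T1 (pd ?H)" using H by (simp add: T1.fobj_module fg_closed)
  interpret T2H: module K "fobj T2 (pd ?H)" using H by (simp add: T2.fobj_module fg_closed)
  interpret T2Z: module K "fobj T2 (pd Z)" using Z by (simp add: T2.fobj_module fg_closed)
  have y: "?p g (?m g x) \<in> carrier (fobj T1 (pd ?H))" if "g \<in> carrier G" for g
    using that x' by (simp add: mem)
  let ?k = "\<lambda>g. \<lambda>z\<in>carrier ?H. act Z g (proj (pd Z) g z)"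
  have k: "?k g \<in> module_homs L (pd ?H) (pd Z)" if g: "g \<in> carrier G" for g
  proof -
    have "compose (carrier (pd ?H)) (act Z g) (proj (pd Z) g) \<in> module_homs L (pd ?H) (pd Z)"
      by (rule module_homs_compose[OF R.P.proj_hom[OF g] act_hom[OF R.Z.right_module_axioms g]
            pd_module[OF R.P.induced_module]])
    then show ?thesis
      by (simp add: compose_def)
  qed
  have lin: "?i \<in> linear_maps K (fobj T2 (pd ?H)) (fobj T2 (pd Z))"
    "\<kappa> ?H \<in> linear_maps K (fobj T1 (pd ?H)) (fobj T2 (pd ?H))"
    using nat_transD(1)[OF \<kappa> H] by (simp_all add: T2.fmap_linear mem)
  have "(\<Oplus>\<^bsub>W\<^esub>g\<in>carrier G. \<Psi>1 g (\<Phi>1 g \<kappa>)) Z x = (\<Oplus>\<^bsub>fobj T2 (pd Z)\<^esub>g\<in>carrier G. \<Psi>1 g (\<Phi>1 g \<kappa>) Z x)"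
    using finsum_nat_space[of K LG "phi G L T1" "phi G L T2" "carrier G" "\<lambda>g. \<Psi>1 g (\<Phi>1 g \<kappa>)" Z x] \<Psi>\<Phi> Z x
    by (simp add: K.is_cring)
  also have "\<dots> = (\<Oplus>\<^bsub>fobj T2 (pd Z)\<^esub>g\<in>carrier G. ?i (\<kappa> ?H (?p g (?m g x))))"
    using y linear_mapsD(1)[OF lin(1)] linear_mapsD(1)[OF lin(2)] Z x'
    by (intro T2Z.finsum_eqI) (auto simp: \<Psi>1_apply \<Phi>1_apply mem)
  also have "\<dots> = ?i (\<kappa> ?H (\<Oplus>\<^bsub>fobj T1 (pd ?H)\<^esub>g\<in>carrier G. ?p g (?m g x)))"
    using y linear_mapsD(1)[OF lin(2)]
    by (simp add: linear_maps_finsum[OF T1H.module_axioms T2H.module_axioms lin(2)]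
        linear_maps_finsum[OF T2H.module_axioms T2Z.module_axioms lin(1)])
  also have "(\<Oplus>\<^bsub>fobj T1 (pd ?H)\<^esub>g\<in>carrier G. ?p g (?m g x)) =
      (\<Oplus>\<^bsub>fobj T1 (pd ?H)\<^esub>g\<in>carrier G. fmap T1 (pd ?H) (pd Z) (?k g) x)"
  proof (rule T1H.finsum_eqI)
    fix g assume g: "g \<in> carrier G"
    then show "?p g (?m g x) = fmap T1 (pd ?H) (pd Z) (?k g) x"
      using x' by (intro T1.fmap_fmap) (auto simp: mem)
    show "?p g (?m g x) \<in> carrier (fobj T1 (pd ?H))"
      using g by (rule y)
  qed
  also have "\<dots> = fmap T1 (pd ?H) (pd Z) (\<lambda>z\<in>carrier (pd ?H). \<Oplus>\<^bsub>pd Z\<^esub>g\<in>carrier G. ?k g z) x"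
    using k x' by (intro T1.fmap_finsum[symmetric]) (auto simp: mem)
  \<comment> \<open>Each \<open>?k g\<close> is linear only over L. Their sum is linear over
    \<open>LG\<close>, so naturality of \<kappa> becomes applicable here.\<close>
  also have "(\<lambda>z\<in>carrier (pd ?H). \<Oplus>\<^bsub>pd Z\<^esub>g\<in>carrier G. ?k g z) = counit Z"
    using R.counit_eq module_homsD(4)[OF R.counit_hom]
    by (intro extensionalityI[where A = "carrier ?H"]) auto
  also have "\<kappa> ?H (fmap T1 (pd ?H) (pd Z) (counit Z) x) = fmap T2 (pd ?H) (pd Z) (counit Z) (\<kappa> Z x)"
    using nat_transD(3)[OF \<kappa> H Z R.counit_hom x] by simp
  also have "?i \<dots> = \<kappa> Z x"
    using nat_transD(2)[OF \<kappa> Z x] R.counit_incl module_homs_pd[OF R.counit_hom]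
    by (intro T2.fmap_fmap_id) (auto simp: mem)
  finally show "(\<Oplus>\<^bsub>W\<^esub>g\<in>carrier G. \<Psi>1 g (\<Phi>1 g \<kappa>)) Z x = \<kappa> Z x" .
qed

theorem iso_twisted_source:
  "(\<lambda>\<iota>\<in>carrier (direct_sum (carrier G) (\<lambda>g. nat_space K L (tw1 g) T2)).
      \<Oplus>\<^bsub>W\<^esub>g\<in>carrier G. nat_comp LG (phi G L T1) (phi_map G \<beta> L (\<iota> g)) (shift T1 g))
    \<in> linear_isos K (direct_sum (carrier G) (\<lambda>g. nat_space K L (tw1 g) T2)) W"
  unfolding \<Psi>1_def[symmetric]
proof (rule direct_sum_linear_iso[where \<Phi> = \<Phi>1])
  show "module K (nat_space K L (tw1 g) T2)" if "g \<in> carrier G" for g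
    using that by (intro nat_space_module K.is_cring) simp_all
qed (simp_all add: W_module \<Psi>1_closed[simplified] \<Psi>1_add \<Psi>1_smult \<Phi>1_closed \<Phi>1_add \<Phi>\<Psi>1 \<Psi>\<Phi>1)

end

section \<open>Twists of the target: induction as a right adjoint\<close>

context functor_pair
begin

definition \<Psi>2 :: "'g \<Rightarrow> (('a, 'u) rmodule \<Rightarrow> 'w \<Rightarrow> 'w) \<Rightarrow> (('g \<Rightarrow> 'a, 'u) rmodule \<Rightarrow> 'w \<Rightarrow> 'w)" where
  "\<Psi>2 g \<iota> = nat_comp LG (phi G L T1) (unshift T2 g) (phi_map G \<beta> L \<iota>)"

text \<open>The adjunct for the other adjunction: \<open>proj M \<one>\<close> is now the counit,
  and the inclusion of the summand g leads to the twist of \<open>T2\<close>.\<close>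

definition \<Phi>2 :: "'g \<Rightarrow> (('g \<Rightarrow> 'a, 'u) rmodule \<Rightarrow> 'w \<Rightarrow> 'w) \<Rightarrow> (('a, 'u) rmodule \<Rightarrow> 'w \<Rightarrow> 'w)" where
  "\<Phi>2 g = transpose T1 (\<lambda>M\<in>fg_modules L. fmap T2 (tw g M) (pd (induced M)) (incl M g))
     (\<lambda>M\<in>fg_modules L. fmap T1 (pd (induced M)) M (proj M \<one>))"

lemma unshift2: "g \<in> carrier G \<Longrightarrow> unshift T2 g \<in> nat_trans K LG (phi G L (tw2 g)) (phi G L T2)"
  using shift_iso(2)[OF functors(2)] by (rule nat_isosD)

lemma \<Psi>2_closed: "g \<in> carrier G \<Longrightarrow> \<iota> \<in> nat_trans K L T1 (tw2 g) \<Longrightarrow> \<Psi>2 g \<iota> \<in> carrier W"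
  unfolding \<Psi>2_def carrier_nat_space
  by (rule nat_comp_closed[OF _ phi_map_closed unshift2]) simp_all

lemma \<Psi>2_add:
  "g \<in> carrier G \<Longrightarrow> \<iota> \<in> nat_trans K L T1 (tw2 g) \<Longrightarrow> \<iota>' \<in> nat_trans K L T1 (tw2 g) \<Longrightarrow>
    \<Psi>2 g (\<iota> \<oplus>\<^bsub>nat_space K L T1 (tw2 g)\<^esub> \<iota>') = \<Psi>2 g \<iota> \<oplus>\<^bsub>W\<^esub> \<Psi>2 g \<iota>'"
  unfolding \<Psi>2_def phi_map_add
  by (rule nat_comp_add_right[OF _ _ _ phi_map_closed phi_map_closed unshift2]) simp_all

lemma \<Psi>2_smult:
  "g \<in> carrier G \<Longrightarrow> c \<in> carrier K \<Longrightarrow> \<iota> \<in> nat_trans K L T1 (tw2 g) \<Longrightarrow>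
    \<Psi>2 g (c \<odot>\<^bsub>nat_space K L T1 (tw2 g)\<^esub> \<iota>) = c \<odot>\<^bsub>W\<^esub> \<Psi>2 g \<iota>"
  unfolding \<Psi>2_def phi_map_smult
  by (rule nat_comp_smult_right[OF _ _ _ phi_map_closed unshift2]) simp_all

lemma \<Psi>2_apply:
  "g \<in> carrier G \<Longrightarrow> Z \<in> fg_modules LG \<Longrightarrow> x \<in> carrier (fobj T1 (pd Z)) \<Longrightarrow>
    \<Psi>2 g \<iota> Z x = fmap T2 (pd Z) (tw g (pd Z)) (act Z (inv g)) (\<iota> (pd Z) x)"
  by (simp add: \<Psi>2_def nat_comp_apply unshift_def)

lemma \<Phi>2_apply:
  "M \<in> fg_modules L \<Longrightarrow> x \<in> carrier (fobj T1 M) \<Longrightarrow>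
    \<Phi>2 g \<kappa> M x = fmap T2 (tw g M) (pd (induced M)) (incl M g)
       (\<kappa> (induced M) (fmap T1 (pd (induced M)) M (proj M \<one>) x))"
  by (simp add: \<Phi>2_def transpose_apply)

lemma \<Phi>2_closed: "g \<in> carrier G \<Longrightarrow> \<kappa> \<in> carrier W \<Longrightarrow> \<Phi>2 g \<kappa> \<in> nat_trans K L T1 (tw2 g)"
  unfolding \<Phi>2_def
  by (rule transpose_closed[OF _ _ proj_trans(2) incl_trans(1)]) simp_all

lemma \<Phi>2_add:
  "g \<in> carrier G \<Longrightarrow> \<kappa> \<in> carrier W \<Longrightarrow> \<kappa>' \<in> carrier W \<Longrightarrow>
    \<Phi>2 g (\<kappa> \<oplus>\<^bsub>W\<^esub> \<kappa>') = \<Phi>2 g \<kappa> \<oplus>\<^bsub>nat_space K L T1 (tw2 g)\<^esub> \<Phi>2 g \<kappa>'"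
  unfolding \<Phi>2_def
  by (rule transpose_add[OF _ _ _ _ proj_trans(2) incl_trans(1)]) simp_all

text \<open>Here naturality of \<iota> is used along \<open>proj M \<one>\<close> and collects
  everything outside \<iota> M: \<open>T2\<close> is applied to the projection to \<one> after the
  inverse of h after the inclusion at g, which \<open>proj_act_inv_incl\<close> evaluates.\<close>

lemma \<Phi>\<Psi>2:
  assumes g: "g \<in> carrier G" and h: "h \<in> carrier G" and \<iota>: "\<iota> \<in> nat_trans K L T1 (tw2 h)"
  shows "\<Phi>2 g (\<Psi>2 h \<iota>) = (if h = g then \<iota> else \<zero>\<^bsub>nat_space K L T1 (tw2 g)\<^esub>)"
proof (rule nat_trans_eqI)
  show "\<Phi>2 g (\<Psi>2 h \<iota>) \<in> nat_trans K L T1 (tw2 g)"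
    using g \<Psi>2_closed[OF h \<iota>] by (rule \<Phi>2_closed)
  show "(if h = g then \<iota> else \<zero>\<^bsub>nat_space K L T1 (tw2 g)\<^esub>) \<in> nat_trans K L T1 (tw2 g)"
    using \<iota> g zero_nat_trans[of K L T1 "tw2 g"] by auto
  fix M :: "('a, 'u) rmodule" and x assume M: "M \<in> fg_modules L" and x: "x \<in> carrier (fobj T1 M)"
  interpret I: induction L G \<beta> M using M by (rule induction)
  let ?HM = "induced M"
  note mem = fg_closed M I.proj_one_hom I.incl_hom[OF g] act_inv_hom[OF I.induced_module h]
    module_homs_tw[OF I.proj_one_hom h]
  let ?k = "\<lambda>m\<in>carrier M. if h = g then m else \<zero>\<^bsub>M\<^esub>"
  let ?y = "\<iota> M x"
  have y: "?y \<in> carrier (fobj T2 (tw h M))"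
    using nat_transD(2)[OF \<iota> M x] by simp
  have "\<Phi>2 g (\<Psi>2 h \<iota>) M x = fmap T2 (tw g M) (pd ?HM) (incl M g)
      (fmap T2 (pd ?HM) (tw h (pd ?HM)) (act ?HM (inv h)) (\<iota> (pd ?HM) (fmap T1 (pd ?HM) M (proj M \<one>) x)))"
    using x h by (simp add: \<Phi>2_apply \<Psi>2_apply mem)
  also have "\<iota> (pd ?HM) (fmap T1 (pd ?HM) M (proj M \<one>) x) =
      fmap T2 (tw h (pd ?HM)) (tw h M) (proj M \<one>) ?y"
    using nat_transD(3)[OF \<iota>, of "pd ?HM" M "proj M \<one>" x] x by (simp add: mem)
  also have "fmap T2 (pd ?HM) (tw h (pd ?HM)) (act ?HM (inv h))
      (fmap T2 (tw h (pd ?HM)) (tw h M) (proj M \<one>) ?y) =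
      fmap T2 (pd ?HM) (tw h M) (\<lambda>m\<in>carrier ?HM. proj M \<one> (act ?HM (inv h) m)) ?y"
    using y h by (intro T2.fmap_fmap) (auto simp: mem)
  also have "fmap T2 (tw g M) (pd ?HM) (incl M g) \<dots> = fmap T2 (tw g M) (tw h M) ?k ?y"
  proof (rule T2.fmap_fmap)
    have "compose (carrier (pd ?HM)) (proj M \<one>) (act ?HM (inv h)) \<in> module_homs L (pd ?HM) (tw h M)"
      by (rule module_homs_compose[OF act_inv_hom[OF I.induced_module h] module_homs_tw[OF I.proj_one_hom h]
            pd_module[OF I.induced_module]])
    then show "(\<lambda>m\<in>carrier ?HM. proj M \<one> (act ?HM (inv h) m)) \<in> module_homs L (pd ?HM) (tw h M)"
      by (simp add: compose_def)
  qed (use y g h in \<open>auto simp: mem I.proj_act_inv_incl\<close>)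
  finally have "\<Phi>2 g (\<Psi>2 h \<iota>) M x = fmap T2 (tw g M) (tw h M) ?k ?y" .
  moreover have "fmap T2 (tw g M) (tw h M) ?k ?y = (if h = g then ?y else \<zero>\<^bsub>fobj T2 (tw g M)\<^esub>)"
    using T2.fmap_id[of "tw g M" ?y] T2.fmap_zero[of "tw g M" "tw h M" ?y] y g h M
    by (auto simp: fg_closed)
  ultimately show "\<Phi>2 g (\<Psi>2 h \<iota>) M x = (if h = g then \<iota> else \<zero>\<^bsub>nat_space K L T1 (tw2 g)\<^esub>) M x"
    using M x by simp
qed

text \<open>The terms have \<kappa> innermost, so the sum is formed outside it and becomes
  \<open>T2\<close> applied to the unit. Naturality along the unit brings \<kappa> Z to the outside,
  and \<open>proj_unit\<close> turns the remaining map induced on \<open>T1\<close> into the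
  identity.\<close>

lemma \<Psi>\<Phi>2:
  assumes \<kappa>: "\<kappa> \<in> carrier W"
  shows "(\<Oplus>\<^bsub>W\<^esub>g\<in>carrier G. \<Psi>2 g (\<Phi>2 g \<kappa>)) = \<kappa>"
proof (rule nat_trans_eqI)
  interpret W: module K W by (rule W_module)
  have \<Psi>\<Phi>: "\<Psi>2 g (\<Phi>2 g \<kappa>) \<in> carrier W" if "g \<in> carrier G" for g
    using that \<Phi>2_closed[OF that \<kappa>] by (rule \<Psi>2_closed)
  then show "(\<Oplus>\<^bsub>W\<^esub>g\<in>carrier G. \<Psi>2 g (\<Phi>2 g \<kappa>)) \<in> nat_trans K LG (phi G L T1) (phi G L T2)"
    using W.finsum_in[of "carrier G"] by simp
  show "\<kappa> \<in> nat_trans K LG (phi G L T1) (phi G L T2)"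
    using \<kappa> by simp
  note \<kappa> = \<kappa>[simplified]
  fix Z :: "('g \<Rightarrow> 'a, 'u) rmodule" and x
  assume Z: "Z \<in> fg_modules LG" and x: "x \<in> carrier (fobj (phi G L T1) Z)"
  interpret R: restriction L G \<beta> Z using Z by (rule restriction)
  have x': "x \<in> carrier (fobj T1 (pd Z))"
    using x by simp
  let ?H = "induced (pd Z)"
  let ?p = "fmap T1 (pd ?H) (pd Z) (proj (pd Z) \<one>)"
  let ?i = "\<lambda>g. fmap T2 (tw g (pd Z)) (pd ?H) (incl (pd Z) g)"
  let ?m = "\<lambda>g. fmap T2 (pd Z) (tw g (pd Z)) (act Z (inv g))"
  note mem = fg_closed Z R.P.incl_hom R.P.proj_one_hom act_inv_hom[OF R.Z.right_module_axioms]
  have H: "?H \<in> fg_modules LG"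
    using Z by (simp add: fg_closed)
  interpret T2Z: module K "fobj T2 (pd Z)" using Z by (simp add: T2.fobj_module fg_closed)
  let ?y = "\<kappa> ?H (?p x)"
  have px: "?p x \<in> carrier (fobj T1 (pd ?H))"
    using x' by (simp add: mem)
  then have y: "?y \<in> carrier (fobj T2 (pd ?H))"
    using nat_transD(2)[OF \<kappa> H, of "?p x"] by simp
  let ?k = "\<lambda>g. \<lambda>z\<in>carrier Z. incl (pd Z) g (act Z (inv g) z)"
  have k: "?k g \<in> module_homs L (pd Z) (pd ?H)" if g: "g \<in> carrier G" for g
  proof -
    have "compose (carrier (pd Z)) (incl (pd Z) g) (act Z (inv g)) \<in> module_homs L (pd Z) (pd ?H)"
      by (rule module_homs_compose[OF act_inv_hom[OF R.Z.right_module_axioms g] R.P.incl_hom[OF g]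
            R.P.M.right_module_axioms])
    then show ?thesis
      by (simp add: compose_def)
  qed
  have "(\<Oplus>\<^bsub>W\<^esub>g\<in>carrier G. \<Psi>2 g (\<Phi>2 g \<kappa>)) Z x = (\<Oplus>\<^bsub>fobj T2 (pd Z)\<^esub>g\<in>carrier G. \<Psi>2 g (\<Phi>2 g \<kappa>) Z x)"
    using finsum_nat_space[of K LG "phi G L T1" "phi G L T2" "carrier G" "\<lambda>g. \<Psi>2 g (\<Phi>2 g \<kappa>)" Z x] \<Psi>\<Phi> Z x
    by (simp add: K.is_cring)
  also have "\<dots> = (\<Oplus>\<^bsub>fobj T2 (pd Z)\<^esub>g\<in>carrier G. fmap T2 (pd Z) (pd ?H) (?k g) ?y)"
  proof (rule T2Z.finsum_eqI)
    fix g assume g: "g \<in> carrier G"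
    have "\<Psi>2 g (\<Phi>2 g \<kappa>) Z x = ?m g (?i g ?y)"
      using Z x' g by (simp add: \<Psi>2_apply \<Phi>2_apply mem)
    also have "\<dots> = fmap T2 (pd Z) (pd ?H) (?k g) ?y"
      using y g by (intro T2.fmap_fmap) (auto simp: mem)
    finally show "\<Psi>2 g (\<Phi>2 g \<kappa>) Z x = fmap T2 (pd Z) (pd ?H) (?k g) ?y" .
    then show "\<Psi>2 g (\<Phi>2 g \<kappa>) Z x \<in> carrier (fobj T2 (pd Z))"
      using k[OF g] y by (simp add: mem)
  qed
  also have "\<dots> = fmap T2 (pd Z) (pd ?H) (\<lambda>z\<in>carrier (pd Z). \<Oplus>\<^bsub>pd ?H\<^esub>g\<in>carrier G. ?k g z) ?y"
    using k y by (intro T2.fmap_finsum[symmetric]) (auto simp: mem)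
  also have "(\<lambda>z\<in>carrier (pd Z). \<Oplus>\<^bsub>pd ?H\<^esub>g\<in>carrier G. ?k g z) = unit Z"
    using R.unit_eq module_homsD(4)[OF R.unit_hom]
    by (intro extensionalityI[where A = "carrier Z"]) auto
  also have "fmap T2 (pd Z) (pd ?H) (unit Z) ?y = \<kappa> Z (fmap T1 (pd Z) (pd ?H) (unit Z) (?p x))"
    using nat_transD(3)[OF \<kappa> Z H R.unit_hom, of "?p x"] px by simp
  also have "fmap T1 (pd Z) (pd ?H) (unit Z) (?p x) = x"
    using x' R.proj_unit module_homs_pd[OF R.unit_hom] by (intro T1.fmap_fmap_id) (auto simp: mem)
  finally show "(\<Oplus>\<^bsub>W\<^esub>g\<in>carrier G. \<Psi>2 g (\<Phi>2 g \<kappa>)) Z x = \<kappa> Z x" .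
qed

theorem iso_twisted_target:
  "(\<lambda>\<iota>\<in>carrier (direct_sum (carrier G) (\<lambda>g. nat_space K L T1 (tw2 g))).
      \<Oplus>\<^bsub>W\<^esub>g\<in>carrier G. nat_comp LG (phi G L T1) (unshift T2 g) (phi_map G \<beta> L (\<iota> g)))
    \<in> linear_isos K (direct_sum (carrier G) (\<lambda>g. nat_space K L T1 (tw2 g))) W"
  unfolding \<Psi>2_def[symmetric]
proof (rule direct_sum_linear_iso[where \<Phi> = \<Phi>2])
  show "module K (nat_space K L T1 (tw2 g))" if "g \<in> carrier G" for g
    using that by (intro nat_space_module K.is_cring) simp_all
qed (simp_all add: W_module \<Psi>2_closed[simplified] \<Psi>2_add \<Psi>2_smult \<Phi>2_closed \<Phi>2_add \<Phi>\<Psi>2 \<Psi>\<Phi>2)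

text \<open>Composition with \<theta> g is a linear bijection from the transformations
  \<open>T1\<close> to \<open>T2\<close> onto those from the g-twist of \<open>T1\<close> to
  \<open>T2\<close>. The isomorphism for twisted sources is transported along these bijections, one
  for each g, chosen independently of each other.\<close>

theorem iso_invariant_source:
  assumes \<theta>: "\<And>g. g \<in> carrier G \<Longrightarrow> \<theta> g \<in> nat_isos K L (tw1 g) T1"
  shows "(\<lambda>\<iota>\<in>carrier (direct_sum (carrier G) (\<lambda>g. nat_space K L T1 T2)).
      \<Oplus>\<^bsub>W\<^esub>g\<in>carrier G. nat_comp LG (phi G L T1) (phi_map G \<beta> L (\<iota> g))
        (nat_comp LG (phi G L T1) (phi_map G \<beta> L (\<theta> g)) (shift T1 g)))
    \<in> linear_isos K (direct_sum (carrier G) (\<lambda>g. nat_space K L T1 T2)) W"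
proof -
  note \<theta>_trans = \<theta>[THEN nat_isosD]
  have "\<exists>\<eta>. \<eta> \<in> nat_trans K L T1 (tw1 g) \<and>
      (\<forall>M\<in>fg_modules L. \<forall>x\<in>carrier (fobj (tw1 g) M). \<eta> M (\<theta> g M x) = x) \<and>
      (\<forall>M\<in>fg_modules L. \<forall>x\<in>carrier (fobj T1 M). \<theta> g M (\<eta> M x) = x)" if "g \<in> carrier G" for g
    using nat_iso_inverse[OF linear(5)[OF that] linear(1) \<theta>[OF that]] by metis
  then obtain \<eta> where \<eta>: "\<And>g. g \<in> carrier G \<Longrightarrow> \<eta> g \<in> nat_trans K L T1 (tw1 g)"
    and \<eta>\<theta>: "\<And>g M x. g \<in> carrier G \<Longrightarrow> M \<in> fg_modules L \<Longrightarrow> x \<in> carrier (fobj (tw1 g) M) \<Longrightarrow> \<eta> g M (\<theta> g M x) = x"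
    and \<theta>\<eta>: "\<And>g M x. g \<in> carrier G \<Longrightarrow> M \<in> fg_modules L \<Longrightarrow> x \<in> carrier (fobj T1 M) \<Longrightarrow> \<theta> g M (\<eta> g M x) = x"
    by metis
  let ?V = "nat_space K L T1 T2"
  let ?a = "\<lambda>g \<iota>. nat_comp L (tw1 g) \<iota> (\<theta> g)"
  let ?b = "\<lambda>g \<iota>. nat_comp L T1 \<iota> (\<eta> g)"
  have V: "module K ?V"
    by (rule nat_space_module) (simp_all add: K.is_cring)
  have a: "?a g \<iota> \<in> nat_trans K L (tw1 g) T2" if "g \<in> carrier G" "\<iota> \<in> nat_trans K L T1 T2" for g \<iota>
    using that by (intro nat_comp_closed[OF _ \<theta>_trans]) simp_all
  have b: "?b g \<iota> \<in> nat_trans K L T1 T2" if "g \<in> carrier G" "\<iota> \<in> nat_trans K L (tw1 g) T2" for g \<iota>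
    using that by (intro nat_comp_closed[OF _ \<eta>]) simp_all
  have ba: "?b g (?a g \<iota>) = \<iota>" if "g \<in> carrier G" "\<iota> \<in> nat_trans K L T1 T2" for g \<iota>
    using that a b nat_transD(2)[OF \<eta>]
    by (intro nat_trans_eqI[of _ K L T1 T2]) (simp_all add: nat_comp_apply \<theta>\<eta>)
  have ab: "?a g (?b g \<iota>) = \<iota>" if "g \<in> carrier G" "\<iota> \<in> nat_trans K L (tw1 g) T2" for g \<iota>
    using that a b nat_transD(2)[OF \<theta>_trans]
    by (intro nat_trans_eqI[of _ K L "tw1 g" T2]) (simp_all add: nat_comp_apply \<eta>\<theta>)
  have b_zero: "?b g \<zero>\<^bsub>nat_space K L (tw1 g) T2\<^esub> = \<zero>\<^bsub>?V\<^esub>" if "g \<in> carrier G" for g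
    using that b zero_nat_trans[of K L "tw1 g" T2] zero_nat_trans[of K L T1 T2] nat_transD(2)[OF \<eta>]
    by (intro nat_trans_eqI[of _ K L T1 T2]) (simp_all add: nat_comp_apply)
  \<comment> \<open>\<phi> respects composition, so \<theta> g may be absorbed into the L-linear
    side or kept as part of the fixed automorphism of \<phi>(T1).\<close>
  have \<Psi>: "nat_comp LG (phi G L T1) (phi_map G \<beta> L \<iota>)
      (nat_comp LG (phi G L T1) (phi_map G \<beta> L (\<theta> g)) (shift T1 g)) = \<Psi>1 g (?a g \<iota>)"
    if g: "g \<in> carrier G" and \<iota>: "\<iota> \<in> nat_trans K L T1 T2" for g \<iota>
    using nat_comp_assoc[OF linear(3) linear(7)[OF g] shift1[OF g] phi_map_closed[OF \<theta>_trans[OF g]] phi_map_closed[OF \<iota>]]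
    by (simp add: \<Psi>1_def phi_map_comp)
  have "(\<lambda>\<iota>\<in>carrier (direct_sum (carrier G) (\<lambda>g. ?V)). \<Oplus>\<^bsub>W\<^esub>g\<in>carrier G. \<Psi>1 g (?a g (\<iota> g)))
    \<in> linear_isos K (direct_sum (carrier G) (\<lambda>g. ?V)) W"
  proof (rule direct_sum_linear_iso[where \<Phi> = "\<lambda>g \<kappa>. ?b g (\<Phi>1 g \<kappa>)"])
    fix g h assume g: "g \<in> carrier G"
    show "\<Psi>1 g (?a g \<iota>) \<in> carrier W" if "\<iota> \<in> carrier ?V" for \<iota>
      using that g a by (intro \<Psi>1_closed) simp_all
    show "\<Psi>1 g (?a g (\<iota> \<oplus>\<^bsub>?V\<^esub> \<iota>')) = \<Psi>1 g (?a g \<iota>) \<oplus>\<^bsub>W\<^esub> \<Psi>1 g (?a g \<iota>')"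
      if "\<iota> \<in> carrier ?V" "\<iota>' \<in> carrier ?V" for \<iota> \<iota>'
      using that g a nat_comp_add_left[OF linear(5)[OF g] linear(1,2) \<theta>_trans[OF g], of \<iota> \<iota>'] \<Psi>1_add[OF g] by simp
    show "\<Psi>1 g (?a g (c \<odot>\<^bsub>?V\<^esub> \<iota>)) = c \<odot>\<^bsub>W\<^esub> \<Psi>1 g (?a g \<iota>)" if "c \<in> carrier K" "\<iota> \<in> carrier ?V" for c \<iota>
      using that g a nat_comp_smult_left[OF linear(5)[OF g] linear(1,2) \<theta>_trans[OF g], of \<iota> c] \<Psi>1_smult[OF g] by simp
    show "?b g (\<Phi>1 g \<kappa>) \<in> carrier ?V" if "\<kappa> \<in> carrier W" for \<kappa>
      using that g b \<Phi>1_closed by simp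
    show "?b g (\<Phi>1 g (\<kappa> \<oplus>\<^bsub>W\<^esub> \<kappa>')) = ?b g (\<Phi>1 g \<kappa>) \<oplus>\<^bsub>?V\<^esub> ?b g (\<Phi>1 g \<kappa>')"
      if "\<kappa> \<in> carrier W" "\<kappa>' \<in> carrier W" for \<kappa> \<kappa>'
      using that g \<Phi>1_add[OF g] \<Phi>1_closed[OF g]
        nat_comp_add_left[OF linear(1) linear(5)[OF g] linear(2) \<eta>[OF g], of "\<Phi>1 g \<kappa>" "\<Phi>1 g \<kappa>'"] by simp
    show "?b g (\<Phi>1 g (\<Psi>1 h (?a h \<iota>))) = (if h = g then \<iota> else \<zero>\<^bsub>?V\<^esub>)"
      if "h \<in> carrier G" "\<iota> \<in> carrier ?V" for h \<iota>
      using that g a \<Phi>\<Psi>1[OF g that(1) a] ba b_zero by simp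
  next
    fix \<kappa> assume \<kappa>: "\<kappa> \<in> carrier W"
    interpret W: module K W by (rule W_module)
    have "(\<Oplus>\<^bsub>W\<^esub>g\<in>carrier G. \<Psi>1 g (?a g (?b g (\<Phi>1 g \<kappa>)))) = (\<Oplus>\<^bsub>W\<^esub>g\<in>carrier G. \<Psi>1 g (\<Phi>1 g \<kappa>))"
      using ab \<Phi>1_closed[OF _ \<kappa>] \<Psi>1_closed by (intro W.finsum_eqI) simp_all
    then show "(\<Oplus>\<^bsub>W\<^esub>g\<in>carrier G. \<Psi>1 g (?a g (?b g (\<Phi>1 g \<kappa>)))) = \<kappa>"
      using \<Psi>\<Phi>1[OF \<kappa>] by simp
  qed (simp_all add: V W_module)
  moreover have "(\<lambda>\<iota>\<in>carrier (direct_sum (carrier G) (\<lambda>g. ?V)). \<Oplus>\<^bsub>W\<^esub>g\<in>carrier G.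
        nat_comp LG (phi G L T1) (phi_map G \<beta> L (\<iota> g))
          (nat_comp LG (phi G L T1) (phi_map G \<beta> L (\<theta> g)) (shift T1 g))) =
      (\<lambda>\<iota>\<in>carrier (direct_sum (carrier G) (\<lambda>g. ?V)). \<Oplus>\<^bsub>W\<^esub>g\<in>carrier G. \<Psi>1 g (?a g (\<iota> g)))"
  proof (rule restrict_ext)
    interpret W: module K W by (rule W_module)
    fix \<iota> assume "\<iota> \<in> carrier (direct_sum (carrier G) (\<lambda>g. ?V))"
    then have "\<iota> g \<in> nat_trans K L T1 T2" if "g \<in> carrier G" for g
      using that by (auto simp: direct_sum_def)
    then show "(\<Oplus>\<^bsub>W\<^esub>g\<in>carrier G. nat_comp LG (phi G L T1) (phi_map G \<beta> L (\<iota> g))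
          (nat_comp LG (phi G L T1) (phi_map G \<beta> L (\<theta> g)) (shift T1 g))) =
        (\<Oplus>\<^bsub>W\<^esub>g\<in>carrier G. \<Psi>1 g (?a g (\<iota> g)))"
      using \<Psi>1_closed[OF _ a] by (intro W.finsum_eqI) (simp_all add: \<Psi>)
  qed
  ultimately show ?thesis
    by simp
qed

end

section \<open>The quotient of the path algebra\<close>

text \<open>In a finite field with m units every x satisfies x^(m+1) = x. The polynomial X^(m+1) - X
  + 1 would then have the value 1 everywhere and no root.\<close>

lemma (in algebraically_closed) infinite_carrier: "infinite (carrier L)"
proof
  assume fin: "finite (carrier L)"
  interpret M: group "Multiplicative_Group.mult_of L"
    by (rule field_mult_group)
  define m where "m = order (Multiplicative_Group.mult_of L)"
  have m: "m > 0"
    using fin M.order_gt_0_iff_finite by (simp add: m_def)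
  have fermat: "x [^] Suc m = x" if "x \<in> carrier L" for x
  proof (cases "x = \<zero>")
    case True
    then show ?thesis
      by simp
  next
    case False
    then have "x [^] m = \<one>"
      using M.pow_order_eq_1[of x] that by (simp add: m_def Multiplicative_Group.nat_pow_mult_of)
    then show ?thesis
      using that by simp
  qed
  \<comment> \<open>The coefficients of X^(m+1) - X + 1, leading coefficient first; m - 1 zeros are
    right because m > 0.\<close>
  let ?p = "\<one> # replicate (m - 1) \<zero> @ [\<ominus> \<one>, \<one>]"
  have p: "?p \<in> carrier (poly_ring L)"
    by (auto simp: univ_poly_carrier[symmetric] polynomial_def)
  have "eval ?p x = \<one>" if x: "x \<in> carrier L" for x
  proof -
    have "eval ?p x = x [^] Suc m \<oplus> (\<ominus> x \<oplus> \<one>)"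
      using x m by (simp add: eval_replicate l_minus)
    also have "\<dots> = \<one>"
      using x by (simp only: fermat) (simp add: r_neg flip: a_assoc)
    finally show ?thesis .
  qed
  then have no_root: "\<not> is_root ?p x" for x
    by (auto simp: is_root_def)
  have "size (roots ?p) = degree ?p"
    using roots_over_carrier[OF p] by (simp add: splitted_def)
  then have "roots ?p \<noteq> {#}"
    using m by auto
  then obtain a where "a \<in># roots ?p"
    by blast
  then show False
    using no_root roots_mem_iff_is_root[OF p] by simp
qed

text \<open>Induction on J with a bijection from A \<times> A to A, which exists because A is
  infinite. The image is kept inside A so that the pairing can be applied again.\<close>

lemma infinite_power_embeds:
  assumes "infinite A" "finite J"
  shows "\<exists>j :: ('i \<Rightarrow> 'u) \<Rightarrow> 'u. inj_on j (J \<rightarrow>\<^sub>E A) \<and> j ` (J \<rightarrow>\<^sub>E A) \<subseteq> A"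
  using assms(2)
proof (induction J)
  case empty
  obtain a where "a \<in> A"
    using assms(1) by fastforce
  then show ?case
    by (intro exI[where x = "\<lambda>_. a"]) auto
next
  case (insert i J)
  then obtain j :: "('i \<Rightarrow> 'u) \<Rightarrow> 'u" where j: "inj_on j (J \<rightarrow>\<^sub>E A)" "j ` (J \<rightarrow>\<^sub>E A) \<subseteq> A"
    by blast
  obtain p where p: "bij_betw p (A \<times> A) A"
    using card_of_Times_same_infinite[OF assms(1)] card_of_ordIso by blast
  let ?j = "\<lambda>f. p (f i, j (restrict f J))"
  have mem: "(f i, j (restrict f J)) \<in> A \<times> A" "restrict f J \<in> J \<rightarrow>\<^sub>E A" if "f \<in> insert i J \<rightarrow>\<^sub>E A" for f
  proof -
    show "restrict f J \<in> J \<rightarrow>\<^sub>E A"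
      using that by auto
    then show "(f i, j (restrict f J)) \<in> A \<times> A"
      using j(2) that by auto
  qed
  have "inj_on ?j (insert i J \<rightarrow>\<^sub>E A)"
  proof (rule inj_onI)
    fix f g assume f: "f \<in> insert i J \<rightarrow>\<^sub>E A" and g: "g \<in> insert i J \<rightarrow>\<^sub>E A" and eq: "?j f = ?j g"
    from eq have "(f i, j (restrict f J)) = (g i, j (restrict g J))"
      using inj_onD[OF bij_betw_imp_inj_on[OF p]] mem[OF f] mem[OF g] by blast
    then have *: "f i = g i" "restrict f J = restrict g J"
      using inj_onD[OF j(1)] mem(2)[OF f] mem(2)[OF g] by auto
    show "f = g"
    proof (rule extensionalityI[where A = "insert i J"])
      fix k assume "k \<in> insert i J"
      then show "f k = g k"
        using *(1) fun_cong[OF *(2), of k] by (auto simp: restrict_def split: if_splits)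
    qed (use f g in \<open>auto simp: PiE_def\<close>)
  qed
  moreover have "?j ` (insert i J \<rightarrow>\<^sub>E A) \<subseteq> A"
    using mem(1) bij_betw_imp_surj_on[OF p] by blast
  ultimately show ?case
    by (intro exI[where x = ?j]) simp
qed

text \<open>The multiples of m by the elements of K are pairwise distinct: if two agreed, the
  difference of the scalars would annihilate m, and as it is invertible in K, m would be
  zero.\<close>

lemma (in right_module) infinite_if_nonzero:
  assumes "field K" "infinite (carrier K)" and s: "s \<in> ring_hom K A"
    and m: "m \<in> carrier M" "m \<noteq> \<zero>\<^bsub>M\<^esub>"
  shows "infinite (carrier M)"
proof -
  interpret K: field K by fact
  have s_closed: "s c \<in> carrier A" if "c \<in> carrier K" for c
    using s that by (rule ring_hom_closed)
  have s_zero: "s \<zero>\<^bsub>K\<^esub> = \<zero>\<^bsub>A\<^esub>"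
    by (rule additive_zero[OF K.abelian_group_axioms A.abelian_group_axioms])
      (use s in \<open>auto simp: ring_hom_def\<close>)
  have "inj_on (\<lambda>c. m \<diamondop>\<^bsub>M\<^esub> s c) (carrier K)"
  proof (rule inj_onI, rule ccontr)
    fix c d assume c: "c \<in> carrier K" and d: "d \<in> carrier K" and eq: "m \<diamondop>\<^bsub>M\<^esub> s c = m \<diamondop>\<^bsub>M\<^esub> s d" and ne: "c \<noteq> d"
    define e where "e = c \<ominus>\<^bsub>K\<^esub> d"
    have e: "e \<in> carrier K" "e \<noteq> \<zero>\<^bsub>K\<^esub>"
      using c d ne by (auto simp: e_def)
    \<comment> \<open>Taken at x = c and at x = d: equality of the two multiples of m then
      identifies the multiple by e with the multiple by zero.\<close>
    have diff: "m \<diamondop>\<^bsub>M\<^esub> s (x \<ominus>\<^bsub>K\<^esub> d) = m \<diamondop>\<^bsub>M\<^esub> s x \<oplus>\<^bsub>M\<^esub> m \<diamondop>\<^bsub>M\<^esub> s (\<ominus>\<^bsub>K\<^esub> d)" if "x \<in> carrier K" for x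
      using that d m s_closed by (simp add: a_minus_def ring_hom_add[OF s] ract_add_right)
    have "m \<diamondop>\<^bsub>M\<^esub> s e = m \<diamondop>\<^bsub>M\<^esub> s (d \<ominus>\<^bsub>K\<^esub> d)"
      using diff[OF c] diff[OF d] eq by (simp add: e_def)
    also have "\<dots> = \<zero>\<^bsub>M\<^esub>"
      using d m by (simp add: K.r_neg a_minus_def s_zero)
    finally have "m \<diamondop>\<^bsub>M\<^esub> s e = \<zero>\<^bsub>M\<^esub>" .
    moreover have "s e \<otimes>\<^bsub>A\<^esub> s (inv\<^bsub>K\<^esub> e) = \<one>\<^bsub>A\<^esub>"
      using e by (simp add: K.field_Units ring_hom_one[OF s] flip: ring_hom_mult[OF s])
    then have "m = (m \<diamondop>\<^bsub>M\<^esub> s e) \<diamondop>\<^bsub>M\<^esub> s (inv\<^bsub>K\<^esub> e)"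
      using m e s_closed by (simp add: K.field_Units ract_one flip: ract_mult)
    ultimately show False
      using m e s_closed by (simp add: K.field_Units)
  qed
  moreover have "(\<lambda>c. m \<diamondop>\<^bsub>M\<^esub> s c) ` carrier K \<subseteq> carrier M"
    using m s_closed ract_closed by auto
  ultimately show ?thesis
    using assms(2) inj_on_finite by blast
qed

lemma (in right_module) power_embeds:
  assumes "field K" "infinite (carrier K)" "s \<in> ring_hom K A" "finite J"
  shows "\<exists>j :: ('i \<Rightarrow> 'u) \<Rightarrow> 'u. inj_on j (J \<rightarrow>\<^sub>E carrier M)"
proof (cases "carrier M = {\<zero>\<^bsub>M\<^esub>}")
  case True
  \<comment> \<open>The zero module has only one family, so a constant map is injective on
    families.\<close>
  then have "inj_on (\<lambda>_. undefined :: 'u) (J \<rightarrow>\<^sub>E carrier M)"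
    by (auto intro!: inj_onI simp: PiE_iff fun_eq_iff)
  then show ?thesis
    by blast
next
  case False
  then obtain m where "m \<in> carrier M" "m \<noteq> \<zero>\<^bsub>M\<^esub>"
    using M.zero_closed by blast
  then show ?thesis
    using infinite_power_embeds[OF infinite_if_nonzero[OF assms(1-3)] assms(4)] by blast
qed

section \<open>The ring structure of the quotient and the action on it\<close>

lemma ring_record_cong:
  assumes "carrier N = carrier M" "monoid.mult N = monoid.mult M" "\<one>\<^bsub>N\<^esub> = \<one>\<^bsub>M\<^esub>" "\<zero>\<^bsub>N\<^esub> = \<zero>\<^bsub>M\<^esub>" "add N = add M"
  shows "ring N \<longleftrightarrow> ring M"
proof -
  have "abelian_group N \<longleftrightarrow> abelian_group M"
    using assms by (intro abelian_group_cong)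
  moreover have "Group.monoid N \<longleftrightarrow> Group.monoid M"
    by (simp only: Group.monoid_def assms)
  ultimately show ?thesis
    by (simp only: ring_def ring_axioms_def assms)
qed

lemma quotient_simps [simp]:
  "carrier (V QuotK W) = carrier (V Quot W)" "monoid.mult (V QuotK W) = monoid.mult (V Quot W)"
  "\<one>\<^bsub>V QuotK W\<^esub> = \<one>\<^bsub>V Quot W\<^esub>" "\<zero>\<^bsub>V QuotK W\<^esub> = \<zero>\<^bsub>V Quot W\<^esub>" "add (V QuotK W) = add (V Quot W)"
  by (simp_all add: quotient_def ring.defs module.defs)

lemma ring_quotient: "ideal I R \<Longrightarrow> ring (R QuotK I)"
  using ideal.quotient_is_ring ring_record_cong[of "R QuotK I" "R Quot I"] by auto

lemma coset_ring_hom: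
  assumes "ideal I R"
  shows "(\<lambda>x. I +>\<^bsub>R\<^esub> x) \<in> ring_hom R (R QuotK I)"
  using ideal.rcos_ring_hom[OF assms] by (simp add: ring_hom_def)

context skew_setting
begin

abbreviation P :: "('k, ('v, 'e) path \<Rightarrow> 'k) module" where
  "P \<equiv> path_algebra K Q"

text \<open>The setting supplies the ring laws of P. This compatibility with scalars, read off from
  the sum over splittings, makes the map from c to c \<odot> \<one> multiplicative.\<close>

lemma path_algebra_scalar_mult:
  assumes c: "c \<in> carrier K" and y: "y \<in> carrier P"
  shows "(c \<odot>\<^bsub>P\<^esub> \<one>\<^bsub>P\<^esub>) \<otimes>\<^bsub>P\<^esub> y = c \<odot>\<^bsub>P\<^esub> y"
proof
  fix p
  have coeffs: "x p \<in> carrier K" if "x \<in> carrier P" for x p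
    using that by (cases p) (simp add: path_algebra_def)
  have one: "\<one>\<^bsub>P\<^esub> p \<in> carrier K" for p
    by (rule coeffs) simp
  let ?S = "splittings Q p"
  let ?t = "\<lambda>(r, s). \<one>\<^bsub>P\<^esub> r \<otimes>\<^bsub>K\<^esub> y s"
  have "((c \<odot>\<^bsub>P\<^esub> \<one>\<^bsub>P\<^esub>) \<otimes>\<^bsub>P\<^esub> y) p = finsum K (\<lambda>(r, s). (c \<otimes>\<^bsub>K\<^esub> \<one>\<^bsub>P\<^esub> r) \<otimes>\<^bsub>K\<^esub> y s) ?S"
    by (simp add: path_algebra_def)
  also have "\<dots> = (\<Oplus>\<^bsub>K\<^esub>q\<in>?S. c \<otimes>\<^bsub>K\<^esub> ?t q)"
    using c one coeffs[OF y] by (intro K.add.finprod_cong') (auto simp: K.m_assoc)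
  also have "\<dots> = c \<otimes>\<^bsub>K\<^esub> (\<Oplus>\<^bsub>K\<^esub>q\<in>?S. ?t q)"
  \<comment> \<open>Over an infinite index set \<open>finsum\<close> is zero by convention, so the
    identity holds in that case as well.\<close>
  proof (cases "finite ?S")
    case True
    then show ?thesis
      using c one coeffs[OF y] by (intro K.finsum_rdistr[symmetric]) auto
  qed (use c in \<open>simp add: K.finsum_infinite\<close>)
  also have "(\<Oplus>\<^bsub>K\<^esub>q\<in>?S. ?t q) = (\<one>\<^bsub>P\<^esub> \<otimes>\<^bsub>P\<^esub> y) p"
    by (simp add: path_algebra_def)
  also have "\<dots> = y p"
    using y by simp
  also have "c \<otimes>\<^bsub>K\<^esub> y p = (c \<odot>\<^bsub>P\<^esub> y) p"
    by (simp add: path_algebra_def)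
  finally show "((c \<odot>\<^bsub>P\<^esub> \<one>\<^bsub>P\<^esub>) \<otimes>\<^bsub>P\<^esub> y) p = (c \<odot>\<^bsub>P\<^esub> y) p" .
qed

lemma path_algebra_smult_closed:
  assumes "c \<in> carrier K" "x \<in> carrier P"
  shows "c \<odot>\<^bsub>P\<^esub> x \<in> carrier P"
proof -
  have "{p. c \<otimes>\<^bsub>K\<^esub> x p \<noteq> \<zero>\<^bsub>K\<^esub>} \<subseteq> {p. x p \<noteq> \<zero>\<^bsub>K\<^esub>}"
    using assms(1) by auto
  then show ?thesis
    using assms by (auto simp: path_algebra_def intro: finite_subset)
qed

lemma scalars_ring_hom: "(\<lambda>c. c \<odot>\<^bsub>P\<^esub> \<one>\<^bsub>P\<^esub>) \<in> ring_hom K P"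
proof (rule ring_hom_memI)
  have one: "\<one>\<^bsub>P\<^esub> p \<in> carrier K" for p
    using I.one_closed by (cases p) (simp add: path_algebra_def)
  show "\<one>\<^bsub>K\<^esub> \<odot>\<^bsub>P\<^esub> \<one>\<^bsub>P\<^esub> = \<one>\<^bsub>P\<^esub>"
    using one by (auto simp: path_algebra_def)
  fix c d assume c: "c \<in> carrier K" and d: "d \<in> carrier K"
  show "c \<odot>\<^bsub>P\<^esub> \<one>\<^bsub>P\<^esub> \<in> carrier P"
    using c by (simp add: path_algebra_smult_closed)
  show "(c \<oplus>\<^bsub>K\<^esub> d) \<odot>\<^bsub>P\<^esub> \<one>\<^bsub>P\<^esub> = c \<odot>\<^bsub>P\<^esub> \<one>\<^bsub>P\<^esub> \<oplus>\<^bsub>P\<^esub> d \<odot>\<^bsub>P\<^esub> \<one>\<^bsub>P\<^esub>"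
    using c d one by (simp add: path_algebra_def fun_eq_iff K.l_distr)
  show "(c \<otimes>\<^bsub>K\<^esub> d) \<odot>\<^bsub>P\<^esub> \<one>\<^bsub>P\<^esub> = c \<odot>\<^bsub>P\<^esub> \<one>\<^bsub>P\<^esub> \<otimes>\<^bsub>P\<^esub> (d \<odot>\<^bsub>P\<^esub> \<one>\<^bsub>P\<^esub>)"
    using c d one
    by (subst path_algebra_scalar_mult)
      (simp_all add: path_algebra_smult_closed, simp add: path_algebra_def fun_eq_iff K.m_assoc)
qed

lemma \<alpha>_closed: "g \<in> carrier G \<Longrightarrow> x \<in> carrier P \<Longrightarrow> \<alpha> g x \<in> carrier P"
  using action.element_image by blast

text \<open>The reverse inclusion is the assumed one for the inverse of g.\<close>

lemma \<alpha>_ideal: "g \<in> carrier G \<Longrightarrow> \<alpha> g ` I = I"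
proof (rule antisym)
  assume g: "g \<in> carrier G"
  then show "\<alpha> g ` I \<subseteq> I"
    by (rule action_ideal)
  show "I \<subseteq> \<alpha> g ` I"
  proof
    fix x assume x: "x \<in> I"
    then have xP: "x \<in> carrier P"
      using I.a_subset by blast
    have "x = \<alpha> (g \<otimes>\<^bsub>G\<^esub> inv\<^bsub>G\<^esub> g) x"
      using g xP by (simp flip: action.id_eq_one)
    also have "\<dots> = \<alpha> g (\<alpha> (inv\<^bsub>G\<^esub> g) x)"
      using g xP by (intro action.composition_rule) auto
    finally show "x \<in> \<alpha> g ` I"
      using action_ideal[of "inv\<^bsub>G\<^esub> g"] g x by blast
  qed
qed

text \<open>Since \<alpha> g maps I onto I, the image of the coset of x fills the whole coset of
  \<alpha> g x. The setwise image is thus the action on representatives.\<close>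

lemma induced_action_coset:
  assumes g: "g \<in> carrier G" and x: "x \<in> carrier P"
  shows "induced_action \<alpha> g (I +>\<^bsub>P\<^esub> x) = I +>\<^bsub>P\<^esub> \<alpha> g x"
proof -
  have "\<alpha> g (i \<oplus>\<^bsub>P\<^esub> x) = \<alpha> g i \<oplus>\<^bsub>P\<^esub> \<alpha> g x" if "i \<in> I" for i
    using that x I.a_subset by (intro ring_hom_add[OF action_ring_hom[OF g]]) auto
  then have "induced_action \<alpha> g (I +>\<^bsub>P\<^esub> x) = (\<Union>i\<in>I. {\<alpha> g i \<oplus>\<^bsub>P\<^esub> \<alpha> g x})"
    by (simp add: induced_action_def a_r_coset_def' image_UN)
  also have "\<dots> = (\<Union>i\<in>\<alpha> g ` I. {i \<oplus>\<^bsub>P\<^esub> \<alpha> g x})"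
    by auto
  finally show ?thesis
    using g by (simp add: \<alpha>_ideal a_r_coset_def')
qed

lemma quotient_cosetE:
  assumes "Z \<in> carrier (P QuotK I)"
  obtains x where "x \<in> carrier P" "Z = I +>\<^bsub>P\<^esub> x"
  using assms by (auto simp: FactRing_def A_RCOSETS_def')

lemma skew_action_quotient: "skew_action (P QuotK I) G (induced_action \<alpha>)"
proof (intro skew_action.intro skew_action_axioms.intro)
  show "ring (P QuotK I)"
    by (rule ring_quotient[OF I.ideal_axioms])
  show "group G" "finite (carrier G)"
    by (rule G.is_group) (rule finite_group)
  note hom = ring_hom_closed[OF coset_ring_hom[OF I.ideal_axioms]] ring_hom_add[OF coset_ring_hom[OF I.ideal_axioms], symmetric]
    ring_hom_mult[OF coset_ring_hom[OF I.ideal_axioms], symmetric] ring_hom_one[OF coset_ring_hom[OF I.ideal_axioms], symmetric]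
  fix g assume g: "g \<in> carrier G"
  note \<alpha> = ring_hom_add[OF action_ring_hom[OF g], symmetric] ring_hom_mult[OF action_ring_hom[OF g], symmetric]
    ring_hom_one[OF action_ring_hom[OF g]]
  show "induced_action \<alpha> g \<in> ring_hom (P QuotK I) (P QuotK I)"
  proof (rule ring_hom_memI)
    show "induced_action \<alpha> g \<one>\<^bsub>P QuotK I\<^esub> = \<one>\<^bsub>P QuotK I\<^esub>"
      unfolding hom(4) using g by (simp only: induced_action_coset I.one_closed \<alpha>)
  next
    fix Z Y assume "Z \<in> carrier (P QuotK I)" "Y \<in> carrier (P QuotK I)"
    then obtain x y where x: "x \<in> carrier P" and y: "y \<in> carrier P" and ZY: "Z = I +>\<^bsub>P\<^esub> x" "Y = I +>\<^bsub>P\<^esub> y"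
      by (metis quotient_cosetE)
    show "induced_action \<alpha> g Z \<in> carrier (P QuotK I)"
      unfolding ZY using g x by (simp only: induced_action_coset \<alpha>_closed hom(1))
    show "induced_action \<alpha> g (Z \<otimes>\<^bsub>P QuotK I\<^esub> Y) =
        induced_action \<alpha> g Z \<otimes>\<^bsub>P QuotK I\<^esub> induced_action \<alpha> g Y"
      unfolding ZY using g x y by (simp only: induced_action_coset \<alpha>_closed hom \<alpha> I.m_closed)
    show "induced_action \<alpha> g (Z \<oplus>\<^bsub>P QuotK I\<^esub> Y) =
        induced_action \<alpha> g Z \<oplus>\<^bsub>P QuotK I\<^esub> induced_action \<alpha> g Y"
      unfolding ZY using g x y by (simp only: induced_action_coset \<alpha>_closed hom \<alpha> I.a_closed)
  qed
  fix h Z assume h: "h \<in> carrier G" and Z: "Z \<in> carrier (P QuotK I)"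
  from Z obtain x where x: "x \<in> carrier P" "Z = I +>\<^bsub>P\<^esub> x"
    by (rule quotient_cosetE)
  show "induced_action \<alpha> (g \<otimes>\<^bsub>G\<^esub> h) Z = induced_action \<alpha> g (induced_action \<alpha> h Z)"
    using g h x by (simp add: induced_action_coset \<alpha>_closed action.composition_rule)
next
  fix Z assume "Z \<in> carrier (P QuotK I)"
  then obtain x where x: "x \<in> carrier P" "Z = I +>\<^bsub>P\<^esub> x"
    by (rule quotient_cosetE)
  then show "induced_action \<alpha> \<one>\<^bsub>G\<^esub> Z = Z"
    by (simp add: induced_action_coset flip: action.id_eq_one)
qed

lemma quotient_power_embeds:
  fixes M :: "((('v, 'e) path \<Rightarrow> 'k) set, 'u) rmodule"
  assumes "right_module (P QuotK I) M"
  shows "\<exists>j :: ('g \<Rightarrow> 'u) \<Rightarrow> 'u. inj_on j (carrier G \<rightarrow>\<^sub>E carrier M)"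
proof -
  have "(\<lambda>x. I +>\<^bsub>P\<^esub> x) \<circ> (\<lambda>c. c \<odot>\<^bsub>P\<^esub> \<one>\<^bsub>P\<^esub>) \<in> ring_hom K (P QuotK I)"
    by (rule ring_hom_trans[OF scalars_ring_hom coset_ring_hom[OF I.ideal_axioms]])
  then show ?thesis
    using right_module.power_embeds[OF assms K.field_axioms K.infinite_carrier _ finite_group] by blast
qed

end

text \<open>That the isomorphisms are induced by \<phi> is expressed by fixed natural isomorphisms
  \<sigma> g or \<tau> g: a family \<iota> goes to the sum over G of the composites of
  \<phi>(\<iota> g) with them.\<close>

theorem theorem1p4:
  fixes K :: "'k ring"
    and Q :: "('v, 'e) pre_digraph"
    and I :: "(('v, 'e) path \<Rightarrow> 'k) set"
    and G :: "'g monoid"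
    and \<alpha> :: "'g \<Rightarrow> (('v, 'e) path \<Rightarrow> 'k) \<Rightarrow> (('v, 'e) path \<Rightarrow> 'k)"
    and \<Lambda> :: "('k, (('v, 'e) path \<Rightarrow> 'k) set) module"
    and \<beta> :: "'g \<Rightarrow> (('v, 'e) path \<Rightarrow> 'k) set \<Rightarrow> (('v, 'e) path \<Rightarrow> 'k) set"
    and \<Lambda>G :: "('k, 'g \<Rightarrow> (('v, 'e) path \<Rightarrow> 'k) set) module"
    and T1 T2 :: "((('v, 'e) path \<Rightarrow> 'k) set, 'u, 'k, 'w) modfun"
  assumes setting: "skew_setting K Q I G \<alpha>"
    and universe: "\<exists>j :: 'k \<Rightarrow> 'u. inj_on j (carrier K)"
    and \<Lambda>: "\<Lambda> = path_algebra K Q QuotK I"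
    and \<beta>: "\<beta> = induced_action \<alpha>"
    and \<Lambda>G: "\<Lambda>G = skew_group_algebra G \<beta> \<Lambda>"
    and T1: "T1 \<in> fp_functors K \<Lambda>"
    and T2: "T2 \<in> fp_functors K \<Lambda>"
  shows
    "(functor_stabilizer K \<Lambda> G \<beta> T1 \<noteq> carrier G \<longrightarrow>
       (\<exists>\<sigma>. (\<forall>g\<in>carrier G. \<sigma> g \<in> nat_isos K \<Lambda>G (phi G \<Lambda> T1) (phi G \<Lambda> (twist_functor G \<beta> g T1))) \<and>
          (let V = direct_sum (carrier G) (\<lambda>g. nat_space K \<Lambda> (twist_functor G \<beta> g T1) T2);
               W = nat_space K \<Lambda>G (phi G \<Lambda> T1) (phi G \<Lambda> T2)
           in (\<lambda>\<iota>\<in>carrier V. \<Oplus>\<^bsub>W\<^esub>g\<in>carrier G.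
                 nat_comp \<Lambda>G (phi G \<Lambda> T1) (phi_map G \<beta> \<Lambda> (\<iota> g)) (\<sigma> g)) \<in> linear_isos K V W)))
     \<and>
     (functor_stabilizer K \<Lambda> G \<beta> T2 \<noteq> carrier G \<longrightarrow>
       (\<exists>\<tau>. (\<forall>g\<in>carrier G. \<tau> g \<in> nat_isos K \<Lambda>G (phi G \<Lambda> (twist_functor G \<beta> g T2)) (phi G \<Lambda> T2)) \<and>
          (let V = direct_sum (carrier G) (\<lambda>g. nat_space K \<Lambda> T1 (twist_functor G \<beta> g T2));
               W = nat_space K \<Lambda>G (phi G \<Lambda> T1) (phi G \<Lambda> T2)
           in (\<lambda>\<iota>\<in>carrier V. \<Oplus>\<^bsub>W\<^esub>g\<in>carrier G.
                 nat_comp \<Lambda>G (phi G \<Lambda> T1) (\<tau> g) (phi_map G \<beta> \<Lambda> (\<iota> g))) \<in> linear_isos K V W)))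
     \<and>
     (functor_stabilizer K \<Lambda> G \<beta> T1 \<inter> functor_stabilizer K \<Lambda> G \<beta> T2 = carrier G \<longrightarrow>
       (\<exists>\<sigma>. (\<forall>g\<in>carrier G. \<sigma> g \<in> nat_isos K \<Lambda>G (phi G \<Lambda> T1) (phi G \<Lambda> T1)) \<and>
          (let V = direct_sum (carrier G) (\<lambda>g. nat_space K \<Lambda> T1 T2);
               W = nat_space K \<Lambda>G (phi G \<Lambda> T1) (phi G \<Lambda> T2)
           in (\<lambda>\<iota>\<in>carrier V. \<Oplus>\<^bsub>W\<^esub>g\<in>carrier G.
                 nat_comp \<Lambda>G (phi G \<Lambda> T1) (phi_map G \<beta> \<Lambda> (\<iota> g)) (\<sigma> g)) \<in> linear_isos K V W)))"
proof -
  interpret S: skew_setting K Q I G \<alpha> by fact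
  interpret skew_action \<Lambda> G \<beta>
    unfolding \<Lambda> \<beta> by (rule S.skew_action_quotient)
  interpret functor_pair K \<Lambda> G \<beta> T1 T2
  proof (unfold_locales)
    show "T1 \<in> all_functors K \<Lambda>" "T2 \<in> all_functors K \<Lambda>"
      using T1 T2 by (simp_all add: fp_functors_def)
    show "\<exists>j :: ('g \<Rightarrow> 'u) \<Rightarrow> 'u. inj_on j (carrier G \<rightarrow>\<^sub>E carrier M)"
      if "right_module \<Lambda> M" for M :: "((('v, 'e) path \<Rightarrow> 'k) set, 'u) rmodule"
      using S.quotient_power_embeds[of M] that by (simp add: \<Lambda>)
  qed
  show ?thesis
    unfolding Let_def \<Lambda>G
  proof (intro conjI impI)
    show "\<exists>\<sigma>. (\<forall>g\<in>carrier G. \<sigma> g \<in> nat_isos K LG (phi G \<Lambda> T1) (phi G \<Lambda> (tw1 g))) \<and>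
        (\<lambda>\<iota>\<in>carrier (direct_sum (carrier G) (\<lambda>g. nat_space K \<Lambda> (tw1 g) T2)). \<Oplus>\<^bsub>W\<^esub>g\<in>carrier G.
          nat_comp LG (phi G \<Lambda> T1) (phi_map G \<beta> \<Lambda> (\<iota> g)) (\<sigma> g))
        \<in> linear_isos K (direct_sum (carrier G) (\<lambda>g. nat_space K \<Lambda> (tw1 g) T2)) W"
      using shift_iso(1)[OF functors(1)] iso_twisted_source by blast
    show "\<exists>\<tau>. (\<forall>g\<in>carrier G. \<tau> g \<in> nat_isos K LG (phi G \<Lambda> (tw2 g)) (phi G \<Lambda> T2)) \<and>
        (\<lambda>\<iota>\<in>carrier (direct_sum (carrier G) (\<lambda>g. nat_space K \<Lambda> T1 (tw2 g))). \<Oplus>\<^bsub>W\<^esub>g\<in>carrier G.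
          nat_comp LG (phi G \<Lambda> T1) (\<tau> g) (phi_map G \<beta> \<Lambda> (\<iota> g)))
        \<in> linear_isos K (direct_sum (carrier G) (\<lambda>g. nat_space K \<Lambda> T1 (tw2 g))) W"
      using shift_iso(2)[OF functors(2)] iso_twisted_target by blast
    assume "functor_stabilizer K \<Lambda> G \<beta> T1 \<inter> functor_stabilizer K \<Lambda> G \<beta> T2 = carrier G"
    \<comment> \<open>An intersection equal to G forces the stabilizer of \<open>T1\<close> to be G,
      so every twist of \<open>T1\<close> is isomorphic to \<open>T1\<close>.\<close>
    then have "\<forall>g\<in>carrier G. \<exists>\<theta>. \<theta> \<in> nat_isos K \<Lambda> (tw1 g) T1"
      unfolding functor_stabilizer_def by blast
    then obtain \<theta> where \<theta>: "\<And>g. g \<in> carrier G \<Longrightarrow> \<theta> g \<in> nat_isos K \<Lambda> (tw1 g) T1"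
      by metis
    \<comment> \<open>The shift leads from \<phi>(T1) to \<phi> of the twist, and \<phi>(\<theta> g)
      leads back to \<phi>(T1).\<close>
    let ?\<sigma> = "\<lambda>g. nat_comp LG (phi G \<Lambda> T1) (phi_map G \<beta> \<Lambda> (\<theta> g)) (shift T1 g)"
    have "?\<sigma> g \<in> nat_isos K LG (phi G \<Lambda> T1) (phi G \<Lambda> T1)" if "g \<in> carrier G" for g
      using nat_comp_iso[OF linear(3) shift_iso(1)[OF functors(1) that] phi_map_iso[OF \<theta>[OF that]]] .
    then show "\<exists>\<sigma>. (\<forall>g\<in>carrier G. \<sigma> g \<in> nat_isos K LG (phi G \<Lambda> T1) (phi G \<Lambda> T1)) \<and>
        (\<lambda>\<iota>\<in>carrier (direct_sum (carrier G) (\<lambda>g. nat_space K \<Lambda> T1 T2)). \<Oplus>\<^bsub>W\<^esub>g\<in>carrier G.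
          nat_comp LG (phi G \<Lambda> T1) (phi_map G \<beta> \<Lambda> (\<iota> g)) (\<sigma> g))
        \<in> linear_isos K (direct_sum (carrier G) (\<lambda>g. nat_space K \<Lambda> T1 T2)) W"
      using iso_invariant_source[OF \<theta>] by (intro exI[where x = ?\<sigma>]) blast
  qed
qed

end
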